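(* Consider either the variational or the discretised control approach, with corresponding estimator $\eta$ and distance function $\mathbf d$. There exists a constant $\Lambda_1>0$, independent of the mesh size, such that for every triangulation $\mathcal T\in\mathbb T$ and every refinement $\widehat{\mathcal T}\in\mathbb T(\mathcal T)$, $$|\widehat\eta(\mathcal T\cap\widehat{\mathcal T})-\eta(\mathcal T\cap\widehat{\mathcal T})|\le\Lambda_1\,\mathbf d(\mathcal T,\widehat{\mathcal T}).$$
   Context: Data: $\Omega\subset\mathbb R^2$ is a bounded polygonal domain, $\mathbf f,\mathbf y_d\in\mathbf L^2(\Omega):=[L^2(\Omega)]^2$, $\alpha>0$ fixed, $\mathbf u_a,\mathbf u_b\in\mathbb R^2$, $\mathbf U_{\rm ad}=\{\mathbf u\in\mathbf L^2(\Omega):\mathbf u_a\le\mathbf u(x)\le\mathbf u_b\text{ a.e.}\}$ (componentwise). $\|\cdot\|$, $(\cdot,\cdot)$: $L^2(\Omega)$ norm and inner product; $\|\cdot\|_R$: $L^2(R)$ norm. Meshes: $\mathbb T$ is the set of admissible (conforming), shape-regular triangulations of $\Omega$ into triangles obtained from an initial one by newest vertex bisection (NVB); $\mathbb T(\mathcal T)$ is the set of admissible NVB refinements of $\mathcal T$; $h_K=|K|^{1/2}$; $\mathcal E_K$ is the set of edges of $K$. Discrete problem on $\mathcal T$: $\mathcal P_0(\mathcal T)$ are the piecewise constants; $\mathbf V_h$ is the lowest-order Crouzeix–Raviart space (vector fields in $\mathbf L^2(\Omega)$, affine on each triangle, continuous at midpoints of interior edges, zero at midpoints of boundary edges); $Q_h=\{q\in\mathcal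 P_0(\mathcal T):\int_\Omega q\,dx=0\}$. $a_h(\mathbf w,\mathbf v)=\sum_K\int_K\nabla\mathbf w:\nabla\mathbf v\,dx$, $b_h(\mathbf v,q)=\sum_K\int_Kq\,{\rm div}\,\mathbf v\,dx$, $|||\mathbf v|||_{\rm pw}^2=\sum_K\int_K|\nabla\mathbf v|^2dx$ (sum over the finer mesh when two meshes are involved), $\nabla_h$ is the piecewise gradient. The discrete solution $(\bar{\mathbf y}_h,\bar r_h,\bar{\mathbf p}_h,\bar s_h,\bar{\mathbf u}_h)\in\mathbf V_h\times Q_h\times\mathbf V_h\times Q_h\times\mathbf U_h$ satisfies, for all $(\mathbf v_h,q_h)\in\mathbf V_h\times Q_h$, $a_h(\bar{\mathbf y}_h,\mathbf v_h)-b_h(\mathbf v_h,\bar r_h)=(\mathbf f+\bar{\mathbf u}_h,\mathbf v_h)$, $b_h(\bar{\mathbf y}_h,q_h)=0$, $a_h(\bar{\mathbf p}_h,\mathbf v_h)+b_h(\mathbf v_h,\bar s_h)=(\bar{\mathbf y}_h-\mathbf y_d,\mathbf v_h)$, $b_h(\bar{\mathbf p}_h,q_h)=0$, and $(\alpha\bar{\mathbf u}_h+\bar{\mathbf p}_h,\mathbf z_h-\bar{\mathbf u}_h)\ge0$ for all $\mathbf z_h\in\mathbf U_h$. Variational approach: $\mathbf U_h=\mathbf U_{\rm ad}$; discretised approach: $\mathbf U_h=\mathbf U_{\rm ad}\cap[\mathcal P_0(\mathcal T)]^2$. Hats denote the solution on $\widehat{\mathcal T}$. Estimators: $\mu_{S,K}^2=h_K^2\|\mathbf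 f+\bar{\mathbf u}_h\|_K^2$, $\rho_{S,\mathcal E(K)}^2=\sum_{E\in\mathcal E_K}h_K\|[\nabla_h\bar{\mathbf y}_h\,t_E]\|_E^2$, $\mu_{A,K}^2=h_K^2\|\bar{\mathbf y}_h-\mathbf y_d\|_K^2$, $\rho_{A,\mathcal E(K)}^2=\sum_{E\in\mathcal E_K}h_K\|[\nabla_h\bar{\mathbf p}_h\,t_E]\|_E^2$, $\eta_{C,K}^2=h_K^2\|\nabla_h(\bar{\mathbf u}_h-\alpha^{-1}\bar{\mathbf p}_h)\|_K^2$, with $t_E$ a unit tangent of $E$ and $[\cdot]$ the jump across $E$ (the trace if $E\subset\partial\Omega$). For $\mathcal M\subseteq\mathcal T$, $\eta^2(\mathcal M)=\sum_{K\in\mathcal M}(\mu_{S,K}^2+\rho_{S,\mathcal E(K)}^2+\mu_{A,K}^2+\rho_{A,\mathcal E(K)}^2)$ in the variational approach, with $\eta_{C,K}^2$ added to each summand in the discretised approach. $\widehat\eta$ is the same quantity defined with $\widehat{\mathcal T}$ and the solution on $\widehat{\mathcal T}$. Distance: $\mathbf d^2(\mathcal T,\widehat{\mathcal T})=|||\widehat{\bar{\mathbf y}}_h-\bar{\mathbf y}_h|||_{\rm pw}^2+|||\widehat{\bar{\mathbf p}}_h-\bar{\mathbf p}_h|||_{\rm pw}^2$ (variational); with the additional term $\|\widehat{\bar{\mathbf u}}_h-\bar{\mathbf u}_h\|^2$ (discretised). *)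

theory Defs
  imports "HOL-Analysis.Analysis"
begin

type_synonym vec2 = "real ^ 2"

text \<open>
  The condition \<open>interior (closure \<Omega>) = \<Omega>\<close> says that the domain lies on one side of
  its boundary (no slits, no punctures).
\<close>

definition polygonal_domain :: "vec2 set \<Rightarrow> bool" where
  "polygonal_domain \<Omega> \<longleftrightarrow>
     open \<Omega> \<and> connected \<Omega> \<and> bounded \<Omega> \<and> \<Omega> \<noteq> {} \<and> interior (closure \<Omega>) = \<Omega> \<and>
     (\<exists>S. finite S \<and> frontier \<Omega> = (\<Union>(a, b)\<in>S. closed_segment a b))"


section \<open>Lebesgue spaces\<close>

text \<open>
  Elements of \<open>L\<^sup>2\<close> are represented by functions; nothing below depends on values on null sets
  of the continuous data or controls.
\<close>

definition L2 :: "vec2 set \<Rightarrow> (vec2 \<Rightarrow> 'b::euclidean_space) set" where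
  "L2 R = {v. v \<in> borel_measurable (lebesgue_on R) \<and>
              integrable (lebesgue_on R) (\<lambda>x. (norm (v x))\<^sup>2)}"

definition L2_inner :: "vec2 set \<Rightarrow> (vec2 \<Rightarrow> 'b::euclidean_space) \<Rightarrow> (vec2 \<Rightarrow> 'b) \<Rightarrow> real" where
  "L2_inner R v w = (LINT x|lebesgue_on R. v x \<bullet> w x)"

text \<open>For matrix-valued functions, \<open>norm\<close> and \<open>\<bullet>\<close> on \<open>real ^ 2 ^ 2\<close> are the Frobenius ones.\<close>

definition L2_norm :: "vec2 set \<Rightarrow> (vec2 \<Rightarrow> 'b::euclidean_space) \<Rightarrow> real" where
  "L2_norm R v = sqrt (LINT x|lebesgue_on R. (norm (v x))\<^sup>2)"


section \<open>Triangulations and newest vertex bisection\<close>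

definition triangulation_of :: "vec2 set \<Rightarrow> vec2 set set \<Rightarrow> bool" where
  "triangulation_of \<Omega> \<T> \<longleftrightarrow>
     triangulation \<T> \<and> (\<forall>K\<in>\<T>. 2 simplex K) \<and> \<Union>\<T> = closure \<Omega>"

text \<open>
  A labelled triangle \<open>(v, a, b)\<close> has newest vertex \<open>v\<close> and refinement edge \<open>ab\<close>. Bisection joins
  \<open>v\<close> to the midpoint of \<open>ab\<close>, which is the newest vertex of both children.
\<close>

type_synonym ltriangle = "vec2 \<times> vec2 \<times> vec2"

fun triangle :: "ltriangle \<Rightarrow> vec2 set" where
  "triangle (v, a, b) = convex hull {v, a, b}"

definition mesh :: "ltriangle set \<Rightarrow> vec2 set set" where
  "mesh L = triangle ` L"

fun children :: "ltriangle \<Rightarrow> ltriangle set" where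
  "children (v, a, b) = {(midpoint a b, v, a), (midpoint a b, b, v)}"

definition nvb_step :: "ltriangle set \<Rightarrow> ltriangle set \<Rightarrow> bool" where
  "nvb_step L L' \<longleftrightarrow> (\<exists>K\<in>L. L' = (L - {K}) \<union> children K)"

definition initial_mesh :: "vec2 set \<Rightarrow> ltriangle set \<Rightarrow> bool" where
  "initial_mesh \<Omega> L \<longleftrightarrow> inj_on triangle L \<and> triangulation_of \<Omega> (mesh L)"

text \<open>
  The admissible refinements of \<open>L\<close>: only the final mesh has to be conforming, the intermediate
  ones may have hanging nodes.
\<close>

definition admissible_refinements :: "vec2 set \<Rightarrow> ltriangle set \<Rightarrow> ltriangle set set" where
  "admissible_refinements \<Omega> L = {L'. nvb_step\<^sup>*\<^sup>* L L' \<and> triangulation_of \<Omega> (mesh L')}"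

definition mesh_size :: "vec2 set \<Rightarrow> real" where
  "mesh_size K = sqrt (measure lebesgue K)"


section \<open>Piecewise functions, gradients and jumps\<close>

definition side_trace :: "vec2 set \<Rightarrow> (vec2 \<Rightarrow> 'b::t2_space) \<Rightarrow> vec2 \<Rightarrow> 'b" where
  "side_trace K g x = Lim (at x within interior K) g"

text \<open>
  Piecewise functions are only prescribed in the interiors of the triangles, where the classical
  Jacobian below is the piecewise gradient; the skeleton is a null set.
\<close>

definition grad :: "(vec2 \<Rightarrow> vec2) \<Rightarrow> vec2 \<Rightarrow> real ^ 2 ^ 2" where
  "grad v x = matrix (frechet_derivative v (at x))"

definition divergence :: "(vec2 \<Rightarrow> vec2) \<Rightarrow> vec2 \<Rightarrow> real" where
  "divergence v x = trace (grad v x)"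

text \<open>An edge is oriented by an arbitrary but fixed choice of the order of its end points.\<close>

definition edge_ends :: "vec2 set \<Rightarrow> vec2 \<times> vec2" where
  "edge_ends E = (SOME (a, b). E = closed_segment a b)"

definition tangent :: "vec2 set \<Rightarrow> vec2" where
  "tangent E = (case edge_ends E of (a, b) \<Rightarrow> (1 / norm (b - a)) *\<^sub>R (b - a))"

text \<open>The \<open>L\<^sup>2\<close> norm on an edge with respect to arc length.\<close>

definition edge_norm :: "vec2 set \<Rightarrow> (vec2 \<Rightarrow> vec2) \<Rightarrow> real" where
  "edge_norm E g = (case edge_ends E of (a, b) \<Rightarrow>
     sqrt (dist a b * (LINT t|lebesgue_on {0..1}. (norm (g (linepath a b t)))\<^sup>2)))"

text \<open>
  The jump across an edge \<open>E\<close> of \<open>K\<close>, with the sign for which \<open>K\<close> counts positively (only norms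
  of jumps are used).
\<close>

definition jump ::
  "vec2 set \<Rightarrow> vec2 set set \<Rightarrow> vec2 set \<Rightarrow> vec2 set \<Rightarrow> (vec2 \<Rightarrow> vec2) \<Rightarrow> vec2 \<Rightarrow> vec2" where
  "jump \<Omega> \<T> K E g x =
     (if E \<subseteq> frontier \<Omega> then side_trace K g x
      else side_trace K g x - side_trace (THE K'. K' \<in> \<T> \<and> K' \<noteq> K \<and> E edge_of K') g x)"


section \<open>The discrete optimal control problem\<close>

definition P0 :: "vec2 set set \<Rightarrow> (vec2 \<Rightarrow> 'b) set" where
  "P0 \<T> = {q. \<forall>K\<in>\<T>. \<exists>c. \<forall>x\<in>interior K. q x = c}"

definition Qh :: "vec2 set \<Rightarrow> vec2 set set \<Rightarrow> (vec2 \<Rightarrow> real) set" where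
  "Qh \<Omega> \<T> = {q \<in> P0 \<T>. (LINT x|lebesgue_on \<Omega>. q x) = 0}"

definition Vh :: "vec2 set \<Rightarrow> vec2 set set \<Rightarrow> (vec2 \<Rightarrow> vec2) set" where
  "Vh \<Omega> \<T> = {v \<in> L2 \<Omega>.
     (\<forall>K\<in>\<T>. \<exists>A c. \<forall>x\<in>interior K. v x = A *v x + c) \<and>
     (\<forall>K\<in>\<T>. \<forall>K'\<in>\<T>. \<forall>a b. closed_segment a b edge_of K \<and> closed_segment a b edge_of K' \<and>
        \<not> closed_segment a b \<subseteq> frontier \<Omega> \<longrightarrow>
        side_trace K v (midpoint a b) = side_trace K' v (midpoint a b)) \<and>
     (\<forall>K\<in>\<T>. \<forall>a b. closed_segment a b edge_of K \<and> closed_segment a b \<subseteq> frontier \<Omega> \<longrightarrow>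
        side_trace K v (midpoint a b) = 0)}"

definition ah :: "vec2 set set \<Rightarrow> (vec2 \<Rightarrow> vec2) \<Rightarrow> (vec2 \<Rightarrow> vec2) \<Rightarrow> real" where
  "ah \<T> w v = (\<Sum>K\<in>\<T>. LINT x|lebesgue_on K. grad w x \<bullet> grad v x)"

definition bh :: "vec2 set set \<Rightarrow> (vec2 \<Rightarrow> vec2) \<Rightarrow> (vec2 \<Rightarrow> real) \<Rightarrow> real" where
  "bh \<T> v q = (\<Sum>K\<in>\<T>. LINT x|lebesgue_on K. q x * divergence v x)"

definition energy_norm :: "vec2 set set \<Rightarrow> (vec2 \<Rightarrow> vec2) \<Rightarrow> real" where
  "energy_norm \<T> v = sqrt (\<Sum>K\<in>\<T>. LINT x|lebesgue_on K. (norm (grad v x))\<^sup>2)"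

definition Uad :: "vec2 set \<Rightarrow> vec2 \<Rightarrow> vec2 \<Rightarrow> (vec2 \<Rightarrow> vec2) set" where
  "Uad \<Omega> ua ub =
     {u \<in> L2 \<Omega>. AE x in lebesgue_on \<Omega>. \<forall>i. ua $ i \<le> u x $ i \<and> u x $ i \<le> ub $ i}"

datatype approach = Variational | Discretised

fun Uh :: "approach \<Rightarrow> vec2 set \<Rightarrow> vec2 \<Rightarrow> vec2 \<Rightarrow> vec2 set set \<Rightarrow> (vec2 \<Rightarrow> vec2) set" where
  "Uh Variational \<Omega> ua ub \<T> = Uad \<Omega> ua ub"
| "Uh Discretised \<Omega> ua ub \<T> = Uad \<Omega> ua ub \<inter> P0 \<T>"

definition discrete_solution ::
  "approach \<Rightarrow> vec2 set \<Rightarrow> (vec2 \<Rightarrow> vec2) \<Rightarrow> (vec2 \<Rightarrow> vec2) \<Rightarrow> real \<Rightarrow> vec2 \<Rightarrow> vec2 \<Rightarrow> vec2 set set \<Rightarrow>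
   (vec2 \<Rightarrow> vec2) \<Rightarrow> (vec2 \<Rightarrow> real) \<Rightarrow> (vec2 \<Rightarrow> vec2) \<Rightarrow> (vec2 \<Rightarrow> real) \<Rightarrow> (vec2 \<Rightarrow> vec2) \<Rightarrow> bool" where
  "discrete_solution ap \<Omega> f yd \<alpha> ua ub \<T> y r p s u \<longleftrightarrow>
     y \<in> Vh \<Omega> \<T> \<and> r \<in> Qh \<Omega> \<T> \<and> p \<in> Vh \<Omega> \<T> \<and> s \<in> Qh \<Omega> \<T> \<and> u \<in> Uh ap \<Omega> ua ub \<T> \<and>
     (\<forall>v\<in>Vh \<Omega> \<T>. ah \<T> y v - bh \<T> v r = L2_inner \<Omega> (\<lambda>x. f x + u x) v) \<and>
     (\<forall>q\<in>Qh \<Omega> \<T>. bh \<T> y q = 0) \<and>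
     (\<forall>v\<in>Vh \<Omega> \<T>. ah \<T> p v + bh \<T> v s = L2_inner \<Omega> (\<lambda>x. y x - yd x) v) \<and>
     (\<forall>q\<in>Qh \<Omega> \<T>. bh \<T> p q = 0) \<and>
     (\<forall>z\<in>Uh ap \<Omega> ua ub \<T>. L2_inner \<Omega> (\<lambda>x. \<alpha> *\<^sub>R u x + p x) (\<lambda>x. z x - u x) \<ge> 0)"


section \<open>Estimators and distance\<close>

text \<open>
  \<open>volume_sq K g\<close> is the square of both \<open>\<mu>\<close> contributions, for \<open>g = f + u\<close> and \<open>g = y - y\<^sub>d\<close>;
  \<open>edges_sq\<close> that of both \<open>\<rho>\<close> contributions, for \<open>v = y\<close> and \<open>v = p\<close>.
\<close>

definition volume_sq :: "vec2 set \<Rightarrow> (vec2 \<Rightarrow> vec2) \<Rightarrow> real" where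
  "volume_sq K g = (mesh_size K)\<^sup>2 * (L2_norm K g)\<^sup>2"

definition edges_sq :: "vec2 set \<Rightarrow> vec2 set set \<Rightarrow> vec2 set \<Rightarrow> (vec2 \<Rightarrow> vec2) \<Rightarrow> real" where
  "edges_sq \<Omega> \<T> K v =
     (\<Sum>E | E edge_of K.
        mesh_size K * (edge_norm E (jump \<Omega> \<T> K E (\<lambda>x. grad v x *v tangent E)))\<^sup>2)"

definition control_sq :: "vec2 set \<Rightarrow> real \<Rightarrow> (vec2 \<Rightarrow> vec2) \<Rightarrow> (vec2 \<Rightarrow> vec2) \<Rightarrow> real" where
  "control_sq K \<alpha> u p =
     (mesh_size K)\<^sup>2 * (L2_norm K (grad (\<lambda>x. u x - (1 / \<alpha>) *\<^sub>R p x)))\<^sup>2"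

definition estimator ::
  "approach \<Rightarrow> vec2 set \<Rightarrow> (vec2 \<Rightarrow> vec2) \<Rightarrow> (vec2 \<Rightarrow> vec2) \<Rightarrow> real \<Rightarrow> vec2 set set \<Rightarrow>
   (vec2 \<Rightarrow> vec2) \<Rightarrow> (vec2 \<Rightarrow> vec2) \<Rightarrow> (vec2 \<Rightarrow> vec2) \<Rightarrow> vec2 set set \<Rightarrow> real" where
  "estimator ap \<Omega> f yd \<alpha> \<T> y p u M =
     sqrt (\<Sum>K\<in>M. volume_sq K (\<lambda>x. f x + u x) + edges_sq \<Omega> \<T> K y +
                   volume_sq K (\<lambda>x. y x - yd x) + edges_sq \<Omega> \<T> K p +
                   (case ap of Variational \<Rightarrow> 0 | Discretised \<Rightarrow> control_sq K \<alpha> u p))"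

text \<open>Here \<open>\<T>'\<close> is the finer mesh, with solution components \<open>y'\<close>, \<open>p'\<close>, \<open>u'\<close>.\<close>

definition distance ::
  "approach \<Rightarrow> vec2 set \<Rightarrow> vec2 set set \<Rightarrow> (vec2 \<Rightarrow> vec2) \<Rightarrow> (vec2 \<Rightarrow> vec2) \<Rightarrow> (vec2 \<Rightarrow> vec2) \<Rightarrow>
   (vec2 \<Rightarrow> vec2) \<Rightarrow> (vec2 \<Rightarrow> vec2) \<Rightarrow> (vec2 \<Rightarrow> vec2) \<Rightarrow> real" where
  "distance ap \<Omega> \<T>' y p u y' p' u' =
     sqrt ((energy_norm \<T>' (\<lambda>x. y' x - y x))\<^sup>2 + (energy_norm \<T>' (\<lambda>x. p' x - p x))\<^sup>2 +
           (case ap of Variational \<Rightarrow> 0 | Discretised \<Rightarrow> (L2_norm \<Omega> (\<lambda>x. u' x - u x))\<^sup>2))"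

end

theory Submission
  imports Defs
begin

text \<open>
  Why the theorem is true. On a triangle \<open>K\<close> that belongs to both meshes the two estimators are
  built from the same expressions in the two discrete solutions, so by the triangle inequality
  their difference is an estimator of the differences \<open>y' - y\<close>, \<open>p' - p\<close>, \<open>u' - u\<close>. This needs that
  an edge of \<open>K\<close> sees, on its other side, a triangle of the fine mesh lying inside the triangle of the
  coarse mesh, so that the coarse gradient has the same trace from both (\<open>edges_young\<close>). The triangle
  inequality in the many \<open>L\<^sup>2\<close> spaces involved is used through Young's inequality with a free
  parameter \<open>t\<close>: the relation \<open>young A B D\<close> is additive, and it implies \<open>\<bar>\<surd>A - \<surd>B\<bar> \<le> \<surd>D\<close>.

  It remains to bound the estimator of the differences by the distance. The gradient jumps are
  constant on the edges, hence controlled by the energy norm with a constant that depends only on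
  the shape of the triangles (\<open>sum_edge_terms_le\<close>). Newest vertex bisection preserves the shape exactly:
  by the parallelogram law, the sum of the squared lengths of the two sides at the newest vertex
  is halved by a bisection, and so is the area. In the variational approach the two variational
  inequalities, each tested with the other solution, give \<open>\<alpha> \<parallel>u' - u\<parallel> \<le> \<parallel>p' - p\<parallel>\<close>
  (\<open>control_difference\<close>); in the discretised approach \<open>\<parallel>u' - u\<parallel>\<close> is a part of the distance, and
  the controls, being piecewise constant, disappear from the gradient in the last term of the estimator.

  The heart of the matter is then a Friedrichs inequality \<open>\<parallel>v' - v\<parallel> \<le> C |||v' - v|||\<close> for
  Crouzeix-Raviart functions \<open>v\<close>, \<open>v'\<close> on a coarse and a fine mesh (\<open>friedrichs_two_meshes\<close>). The
  difference is nonconforming for either mesh, but both functions have continuous mean values across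
  every segment along which an ancestor of a triangle is bisected. Going up the bisection tree, the two affine
  functions on a pair of siblings are therefore replaced by the affine function on their parent with the
  same edge means. Its gradient is the mean of the two gradients, so the changes of gradient in
  different generations are orthogonal, while the lengths decrease geometrically; this yields a
  Poincare inequality on each triangle of the initial mesh (\<open>tree_poincare\<close>). What is
  left is a Crouzeix-Raviart function on the initial mesh, and on this one fixed mesh the
  inequality follows by walking from triangle to triangle through common edges until the boundary is
  reached (\<open>cr_sup_bound\<close>).
\<close>


section \<open>Plane geometry of triangles\<close>

definition cross2 :: "vec2 \<Rightarrow> vec2 \<Rightarrow> real" where
  "cross2 u w = u $ 1 * w $ 2 - u $ 2 * w $ 1"

lemma norm_sq_vec2: "(norm (x::vec2))\<^sup>2 = (x $ 1)\<^sup>2 + (x $ 2)\<^sup>2"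
  unfolding power2_norm_eq_inner inner_vec_def sum_2 by (simp add: power2_eq_square)

lemma cross2_norm_le: "\<bar>cross2 u w\<bar> \<le> norm u * norm w"
proof (rule power2_le_imp_le)
  have "(norm u * norm w)\<^sup>2 - \<bar>cross2 u w\<bar>\<^sup>2 = (u $ 1 * w $ 1 + u $ 2 * w $ 2)\<^sup>2"
    unfolding power_mult_distrib norm_sq_vec2 cross2_def power2_abs by algebra
  then show "\<bar>cross2 u w\<bar>\<^sup>2 \<le> (norm u * norm w)\<^sup>2"
    by (smt (verit) zero_le_power2)
qed simp

lemma collinear_iff_cross2: "collinear {z, w, c} \<longleftrightarrow> cross2 (w - z) (c - z) = 0"
proof (cases "w = z")
  case True
  then show ?thesis by (simp add: cross2_def collinear_2)
next
  case False
  have *: "cross2 u d = 0 \<longleftrightarrow> (\<exists>k. d = k *\<^sub>R u)" if "u \<noteq> 0" for u d :: vec2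
  proof
    assume c0: "cross2 u d = 0"
    show "\<exists>k. d = k *\<^sub>R u"
    proof (cases "u $ 1 = 0")
      case True
      then have "u $ 2 \<noteq> 0" using that by (metis vec_eq_iff exhaust_2 zero_index)
      with True c0 show ?thesis
        by (intro exI[of _ "d $ 2 / u $ 2"]) (auto simp: vec_eq_iff forall_2 cross2_def)
    next
      case False
      with c0 show ?thesis
        by (intro exI[of _ "d $ 1 / u $ 1"]) (auto simp: vec_eq_iff forall_2 cross2_def field_simps)
    qed
  qed (auto simp: cross2_def)
  have "collinear {z, w, c} \<longleftrightarrow> collinear {0, w - z, c - z}"
    by (metis (no_types) NO_MATCH_def collinear_3 insert_commute)
  also have "\<dots> \<longleftrightarrow> c - z = 0 \<or> (\<exists>k. c - z = k *\<^sub>R (w - z))"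
    using False by (simp add: collinear_lemma)
  also have "\<dots> \<longleftrightarrow> cross2 (w - z) (c - z) = 0"
    using *[of "w - z" "c - z"] False by (auto intro: exI[of _ 0])
  finally show ?thesis .
qed

lemma simplex_2_iff:
  "2 simplex K \<longleftrightarrow> (\<exists>a b c. K = convex hull {a, b, c} \<and> cross2 (b - a) (c - a) \<noteq> 0)"
proof
  assume "2 simplex K"
  then obtain C where C: "\<not> affine_dependent C" "int (card C) = 2 + 1" "K = convex hull C"
    unfolding simplex_def by blast
  then have "card C = 3" by linarith
  then obtain a b c where abc: "C = {a, b, c}" "a \<noteq> b" "a \<noteq> c" "b \<noteq> c"
    by (auto simp: card_3_iff)
  then have "\<not> collinear {a, b, c}"
    using C(1) by (simp add: collinear_3_eq_affine_dependent)
  then show "\<exists>a b c. K = convex hull {a, b, c} \<and> cross2 (b - a) (c - a) \<noteq> 0"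
    using abc C(3) collinear_iff_cross2 by blast
next
  assume "\<exists>a b c. K = convex hull {a, b, c} \<and> cross2 (b - a) (c - a) \<noteq> 0"
  then obtain a b c where abc: "K = convex hull {a, b, c}" "\<not> collinear {a, b, c}"
    using collinear_iff_cross2 by blast
  then have "\<not> affine_dependent {a, b, c}" "a \<noteq> b" "a \<noteq> c" "b \<noteq> c"
    by (simp_all add: collinear_3_eq_affine_dependent)
  then show "2 simplex K"
    unfolding simplex_def using abc(1) by (intro exI[of _ "{a, b, c}"]) auto
qed

lemma interior_triangle:
  fixes a b c :: vec2
  assumes "cross2 (b - a) (c - a) \<noteq> 0"
  shows "interior (convex hull {a, b, c}) =
    {v. \<exists>x y z. 0 < x \<and> 0 < y \<and> 0 < z \<and> x + y + z = 1 \<and> x *\<^sub>R a + y *\<^sub>R b + z *\<^sub>R c = v}"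
proof (rule interior_convex_hull_3_minimal)
  show "\<not> collinear {a, b, c}" using assms collinear_iff_cross2 by blast
qed simp

lemma measure_triangle:
  fixes a b c :: vec2
  shows "measure lebesgue (convex hull {a, b, c}) = \<bar>cross2 (b - a) (c - a)\<bar> / 2"
proof -
  have "compact (convex hull {a, b, c})"
    by (simp add: compact_convex_hull finite_imp_compact)
  then have "measure lebesgue (convex hull {a, b, c}) = measure lborel (convex hull {a, b, c})"
    by (simp add: measure_completion borel_compact)
  then show ?thesis
    unfolding content_triangle cross2_def by (simp add: abs_minus_commute algebra_simps)
qed

lemma edge_of_triangle:
  fixes a b c :: vec2
  assumes "cross2 (b - a) (c - a) \<noteq> 0"
  shows "E edge_of (convex hull {a, b, c}) \<longleftrightarrow>
    E = closed_segment a b \<or> E = closed_segment a c \<or> E = closed_segment b c"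
proof -
  have nc: "\<not> collinear {a, b, c}" using assms collinear_iff_cross2 by blast
  then have d: "a \<noteq> b" "a \<noteq> c" "b \<noteq> c" and ai: "\<not> affine_dependent {a, b, c}"
    by (simp_all add: collinear_3_eq_affine_dependent)
  have face: "F face_of (convex hull {a, b, c}) \<longleftrightarrow> (\<exists>S\<subseteq>{a, b, c}. F = convex hull S)" for F
    using face_of_convex_hull_affine_independent[OF ai] by blast
  have dim: "aff_dim (convex hull S) = int (card S) - 1" if "S \<subseteq> {a, b, c}" for S
    using that affine_independent_subset[OF ai that]
    by (simp add: aff_dim_convex_hull aff_dim_affine_independent)
  show ?thesis
  proof
    assume "E edge_of (convex hull {a, b, c})"
    then obtain S where S: "S \<subseteq> {a, b, c}" "E = convex hull S" "aff_dim E = 1"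
      unfolding edge_of_def face by blast
    then have "card S = 2" using dim[OF S(1)] by simp
    then obtain x y where xy: "S = {x, y}" "x \<noteq> y" by (auto simp: card_2_iff)
    then show "E = closed_segment a b \<or> E = closed_segment a c \<or> E = closed_segment b c"
      using S by (auto simp: segment_convex_hull insert_commute)
  next
    assume "E = closed_segment a b \<or> E = closed_segment a c \<or> E = closed_segment b c"
    then have "E = convex hull {a, b} \<or> E = convex hull {a, c} \<or> E = convex hull {b, c}"
      by (simp only: segment_convex_hull)
    moreover have "card {a, b} = 2" "card {a, c} = 2" "card {b, c} = 2" using d by auto
    ultimately have "\<exists>S\<subseteq>{a, b, c}. card S = 2 \<and> E = convex hull S"
      by (elim disjE) (rule exI[of _ "{a, b}"], simp, rule exI[of _ "{a, c}"], simp,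
        rule exI[of _ "{b, c}"], simp)
    then obtain S where S: "S \<subseteq> {a, b, c}" "card S = 2" "E = convex hull S" by metis
    then show "E edge_of (convex hull {a, b, c})"
      unfolding edge_of_def face using dim[OF S(1)] S(1,2) unfolding S(3) by (intro conjI exI[of _ S]) auto
  qed
qed

lemma edge_of_2_simplexD:
  fixes z w :: vec2
  assumes "2 simplex K" "closed_segment z w edge_of K"
  obtains c where "K = convex hull {z, w, c}" "cross2 (w - z) (c - z) \<noteq> 0"
proof -
  obtain p q r where K: "K = convex hull {p, q, r}" and nz: "cross2 (q - p) (r - p) \<noteq> 0"
    using assms(1) simplex_2_iff by blast
  have "{z, w} = {p, q} \<or> {z, w} = {p, r} \<or> {z, w} = {q, r}"
    using assms(2) unfolding K edge_of_triangle[OF nz] by simp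
  then have "{p, q, r} = {z, w, r} \<or> {p, q, r} = {z, w, q} \<or> {p, q, r} = {z, w, p}"
    by (elim disjE) blast+
  then obtain c where c: "{p, q, r} = {z, w, c}" by blast
  have "\<not> collinear {p, q, r}" using nz collinear_iff_cross2 by blast
  then have "cross2 (w - z) (c - z) \<noteq> 0" unfolding c using collinear_iff_cross2 by blast
  with that K c show thesis by metis
qed

lemma edge_of_2_simplex_segment:
  assumes "2 simplex K" "E edge_of K"
  obtains z w where "E = closed_segment z w" "z \<noteq> (w::vec2)"
proof -
  obtain p q r where K: "K = convex hull {p, q, r}" and nz: "cross2 (q - p) (r - p) \<noteq> 0"
    using assms(1) unfolding simplex_2_iff by metis
  have nc: "\<not> collinear {p, q, r}" using nz collinear_iff_cross2 by blast
  then have "p \<noteq> q" "p \<noteq> r" "q \<noteq> r" by (simp_all add: collinear_3_eq_affine_dependent)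
  moreover have "E = closed_segment p q \<or> E = closed_segment p r \<or> E = closed_segment q r"
    using assms(2) unfolding K edge_of_triangle[OF nz] .
  ultimately show thesis using that by blast
qed

section \<open>Neighbours in a triangulation\<close>

text \<open>
  The point is found by starting at the midpoint of the common edge \<open>zw\<close> and moving slightly
  towards the apex \<open>b\<close>, which lies on the same side as \<open>a\<close>.
\<close>

lemma same_side_overlap:
  assumes "cross2 (w - z) (a - z) * cross2 (w - z) (b - z) > 0"
  shows "\<exists>x\<in>interior (convex hull {z, w, a}). x \<in> convex hull {z, w, b}"
proof -
  define D r s where "D = cross2 (w - z) (a - z)"
    and "r = cross2 (w - z) (b - z) / D" and "s = cross2 (b - z) (a - z) / D"
  have D: "D \<noteq> 0" and r: "r > 0"
    using assms by (auto simp: D_def r_def zero_less_mult_iff zero_less_divide_iff)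
  have "D *\<^sub>R (b - z) = cross2 (b - z) (a - z) *\<^sub>R (w - z) + cross2 (w - z) (b - z) *\<^sub>R (a - z)"
    unfolding D_def cross2_def vec_eq_iff forall_2 by (simp add: algebra_simps)
  then have "(1 / D) *\<^sub>R (D *\<^sub>R (b - z)) = (1 / D) *\<^sub>R
      (cross2 (b - z) (a - z) *\<^sub>R (w - z) + cross2 (w - z) (b - z) *\<^sub>R (a - z))" by simp
  then have b: "b - z = s *\<^sub>R (w - z) + r *\<^sub>R (a - z)"
    using D by (simp add: scaleR_add_right r_def s_def)
  \<comment> \<open>so small that the first two barycentric coordinates of the point \<open>x\<close> below are positive\<close>
  define e where "e = 1 / (4 * (1 + \<bar>s\<bar> + r))"
  have pos: "1 + \<bar>s\<bar> + r > 0" using r by linarith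
  have e: "e > 0" "e * (1 + \<bar>s\<bar> + r) = 1 / 4" using pos by (simp_all add: e_def)
  define B where "B = e * \<bar>s\<bar>"
  have es: "B \<ge> 0" "e * r > 0" "- B \<le> e * s" "e * s \<le> B"
    using e(1) r by (auto simp: abs_if B_def)
  have e2: "e + B + e * r = 1 / 4" using e(2) by (simp add: algebra_simps B_def)
  define x where "x = ((1 - e) / 2) *\<^sub>R z + ((1 - e) / 2) *\<^sub>R w + e *\<^sub>R b"
  have b': "b = z + (s *\<^sub>R (w - z) + r *\<^sub>R (a - z))" using b by (simp add: algebra_simps)
  have "x = ((1 - e) / 2 + e - e * s - e * r) *\<^sub>R z + ((1 - e) / 2 + e * s) *\<^sub>R w + (e * r) *\<^sub>R a"
    unfolding x_def b' by (simp add: algebra_simps)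
  moreover have "(1 - e) / 2 + e - e * s - e * r > 0" "(1 - e) / 2 + e * s > 0" "e * r > 0"
    using es e(1) e2 by (auto simp: field_simps)
  ultimately have "x \<in> interior (convex hull {z, w, a})"
    unfolding interior_triangle[OF D[unfolded D_def]] mem_Collect_eq
    by (intro exI conjI) (assumption, assumption, assumption, simp, simp)
  moreover have "x \<in> convex hull {z, w, b}"
    unfolding convex_hull_3 mem_Collect_eq x_def using e(1) e2 es
    by (intro exI[of _ "(1 - e) / 2"] exI[of _ e] conjI) (simp_all add: field_simps)
  ultimately show ?thesis by blast
qed

lemma interior_2_simplex:
  assumes "2 simplex K"
  shows "interior K \<noteq> ({} :: vec2 set)"
proof -
  have "aff_dim K = int (DIM(vec2))" using aff_dim_simplex[OF assms] by simp
  then show ?thesis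
    using interior_rel_interior_gen[of K] rel_interior_eq_empty[OF convex_simplex[OF assms]]
    by (metis (no_types) aff_dim_empty of_nat_0_le_iff less_minus_one_simps(1) not_le)
qed

lemma triangulation_face:
  assumes "triangulation T" "K \<in> T" "K' \<in> T"
  shows "(K \<inter> K') face_of K" "(K \<inter> K') face_of K'"
  using assms unfolding triangulation_def by (metis Int_commute)+

lemma triangulation_interior_eq:
  fixes K K' :: "vec2 set"
  assumes T: "triangulation T" "K \<in> T" "K' \<in> T" and s: "2 simplex K" "2 simplex K'"
    and x: "x \<in> interior K" "x \<in> K'"
  shows "K = K'"
proof -
  note F = triangulation_face[OF T]
  have "K \<inter> K' = K"
    using face_of_disjoint_interior[OF F(1)] x interior_subset by blast
  then have "aff_dim (K \<inter> K') = aff_dim K'" using aff_dim_simplex s by metis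
  then have "K \<inter> K' = K'"
    using face_of_aff_dim_lt[OF convex_simplex[OF s(2)] F(2)] by linarith
  with \<open>K \<inter> K' = K\<close> show ?thesis by simp
qed

lemma triangulation_common_edge:
  fixes K K' :: "vec2 set"
  assumes T: "triangulation T" "K \<in> T" "K' \<in> T" and s: "2 simplex K" "2 simplex K'"
    and ne: "K \<noteq> K'" and E: "E edge_of K" "E \<subseteq> K'"
  shows "E edge_of K'"
proof -
  note F = triangulation_face[OF T]
  have sub: "E \<subseteq> K \<inter> K'" using E edge_of_imp_subset by blast
  have "K \<inter> K' \<noteq> K"
  proof
    assume "K \<inter> K' = K"
    moreover obtain x where "x \<in> interior K" using interior_2_simplex[OF s(1)] by blast
    ultimately show False
      using triangulation_interior_eq[OF T s] ne interior_subset by blast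
  qed
  then have "aff_dim (K \<inter> K') < 2"
    using face_of_aff_dim_lt[OF convex_simplex[OF s(1)] F(1)] aff_dim_simplex[OF s(1)] by linarith
  moreover have "E face_of (K \<inter> K')"
    using E(1) sub face_of_subset[of E K "K \<inter> K'"] by (simp add: edge_of_def)
  moreover have "convex (K \<inter> K')" using s convex_simplex convex_Int by blast
  moreover have "aff_dim E = 1" using E(1) by (simp add: edge_of_def)
  ultimately have "E = K \<inter> K'" using face_of_aff_dim_lt by fastforce
  then show ?thesis using F(2) \<open>aff_dim E = 1\<close> by (simp add: edge_of_def)
qed

lemma triangulation_opposite_sides:
  assumes T: "triangulation T" "convex hull {z, w, a} \<in> T" "convex hull {z, w, b} \<in> T"
    and nz: "cross2 (w - z) (a - z) \<noteq> 0" "cross2 (w - z) (b - z) \<noteq> 0"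
    and ne: "convex hull {z, w, a} \<noteq> convex hull {z, w, b}"
  shows "cross2 (w - z) (a - z) * cross2 (w - z) (b - z) < 0"
proof (rule ccontr)
  assume "\<not> ?thesis"
  with nz have "cross2 (w - z) (a - z) * cross2 (w - z) (b - z) > 0"
    by (metis linorder_neqE_linordered_idom mult_eq_0_iff)
  from same_side_overlap[OF this] show False
    using triangulation_interior_eq[OF T] nz ne simplex_2_iff by blast
qed

lemma triangulation_neighbour_unique:
  fixes K :: "vec2 set"
  assumes T: "triangulation T" "\<And>K. K \<in> T \<Longrightarrow> 2 simplex K"
    and K: "K \<in> T" "K1 \<in> T" "K2 \<in> T" and ne: "K1 \<noteq> K" "K2 \<noteq> K"
    and E: "E edge_of K" "E edge_of K1" "E edge_of K2"
  shows "K1 = K2"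
proof (rule ccontr)
  assume ne12: "K1 \<noteq> K2"
  obtain z w where Ezw: "E = closed_segment z w"
    using edge_of_2_simplex_segment[OF T(2)[OF K(1)] E(1)] by blast
  note S = edge_of_2_simplexD[OF T(2), OF _ E(1)[unfolded Ezw]]
    edge_of_2_simplexD[OF T(2), OF _ E(2)[unfolded Ezw]]
    edge_of_2_simplexD[OF T(2), OF _ E(3)[unfolded Ezw]]
  obtain c where c: "K = convex hull {z, w, c}" "cross2 (w - z) (c - z) \<noteq> 0"
    using S(1) K by blast
  obtain c1 where c1: "K1 = convex hull {z, w, c1}" "cross2 (w - z) (c1 - z) \<noteq> 0"
    using S(2) K by blast
  obtain c2 where c2: "K2 = convex hull {z, w, c2}" "cross2 (w - z) (c2 - z) \<noteq> 0"
    using S(3) K by blast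
  note opp = triangulation_opposite_sides[OF T(1)]
  have "cross2 (w - z) (c1 - z) * cross2 (w - z) (c - z) < 0"
    "cross2 (w - z) (c2 - z) * cross2 (w - z) (c - z) < 0"
    "cross2 (w - z) (c1 - z) * cross2 (w - z) (c2 - z) < 0"
    using opp K c c1 c2 ne ne12 by metis+
  then show False by (auto simp: mult_less_0_iff)
qed

text \<open>
  Otherwise a point in the relative interior of the edge would see only \<open>K\<close>, while \<open>\<Omega>\<close> is a
  neighbourhood of it that is covered by the mesh, so that it would be interior to \<open>K\<close>.
\<close>

lemma triangulation_neighbour_exists:
  fixes K :: "vec2 set"
  assumes \<Omega>: "open \<Omega>" and T: "triangulation_of \<Omega> T"
    and K: "K \<in> T" and E: "E edge_of K" "\<not> E \<subseteq> frontier \<Omega>"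
  shows "\<exists>K'\<in>T. K' \<noteq> K \<and> E edge_of K'"
proof -
  have tri: "triangulation T" and s: "\<And>K. K \<in> T \<Longrightarrow> 2 simplex K" and U: "\<Union>T = closure \<Omega>"
    using T by (auto simp: triangulation_of_def)
  have fin: "finite T" using tri by (simp add: triangulation_def)
  obtain z w where zw: "E = closed_segment z w" "z \<noteq> w"
    using edge_of_2_simplex_segment[OF s[OF K] E(1)] .
  have sub: "E \<subseteq> K" using E(1) edge_of_imp_subset by blast
  have "closure (rel_interior E) = E"
    using convex_closure_rel_interior[of E] zw by simp
  then have "\<not> rel_interior E \<subseteq> frontier \<Omega>"
    using E(2) closure_minimal[OF _ frontier_closed] by metis
  then obtain x where x: "x \<in> rel_interior E" "x \<notin> frontier \<Omega>" by blast
  have "x \<in> E" using x(1) rel_interior_subset by blast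
  then have "x \<in> closure \<Omega>" using sub K U by blast
  then have x\<Omega>: "x \<in> \<Omega>" using x(2) \<Omega> by (simp add: frontier_def interior_open)
  have "\<exists>K'\<in>T. K' \<noteq> K \<and> x \<in> K'"
  proof (rule ccontr)
    assume "\<not> ?thesis"
    then have nx: "x \<notin> \<Union>(T - {K})" by blast
    have "closed (\<Union>(T - {K}))" using fin s closed_simplex by blast
    then have "open (\<Omega> - \<Union>(T - {K}))" using \<Omega> by blast
    moreover have "\<Omega> - \<Union>(T - {K}) \<subseteq> K" using U closure_subset[of \<Omega>] by blast
    ultimately have "x \<in> interior K" using x\<Omega> nx interior_maximal by blast
    moreover have "E \<noteq> K" using E(1) aff_dim_simplex[OF s[OF K]] by (auto simp: edge_of_def)
    ultimately show False
      using face_of_disjoint_interior[of E K] E(1) \<open>x \<in> E\<close> by (auto simp: edge_of_def)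
  qed
  then obtain K' where K': "K' \<in> T" "K' \<noteq> K" "x \<in> K'" by blast
  have "E \<subseteq> K \<inter> K'"
    using subset_of_face_of[OF triangulation_face(1)[OF tri K K'(1)] sub] x(1) K'(3) \<open>x \<in> E\<close> sub
    by blast
  then show ?thesis
    using triangulation_common_edge[OF tri K K'(1) s[OF K] s[OF K'(1)] _ E(1)] K' by blast
qed

lemma finite_has_maximizer:
  fixes f :: "'a \<Rightarrow> real"
  assumes "finite A" "A \<noteq> {}"
  obtains a where "a \<in> A" "\<And>b. b \<in> A \<Longrightarrow> f b \<le> f a"
proof -
  have "Max (f ` A) \<in> f ` A" using assms by simp
  then obtain a where "a \<in> A" "f a = Max (f ` A)" by auto
  then show thesis using that assms by simp
qed

text \<open>
  At a vertex \<open>z\<close> of largest norm all edges point into an open half plane, so one of them is extreme in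
  direction. The two triangles at this edge lie on different sides of it, and one of them has a further
  edge at \<open>z\<close> that is more extreme.
\<close>

lemma closed_mesh_impossible:
  fixes S :: "vec2 set set"
  assumes tri: "triangulation T" and s: "\<And>K. K \<in> T \<Longrightarrow> 2 simplex K" and S: "S \<subseteq> T"
    and nb: "\<And>K E. K \<in> S \<Longrightarrow> E edge_of K \<Longrightarrow> \<exists>K'\<in>S. K' \<noteq> K \<and> E edge_of K'"
  shows "S = {}"
proof (rule ccontr)
  assume "S \<noteq> {}"
  have fin: "finite S" using tri S finite_subset by (auto simp: triangulation_def)
  define V where "V = {z. \<exists>K\<in>S. {z} face_of K}"
  have finV: "finite V"
  proof -
    have "finite {z. {z} face_of K}" if "K \<in> S" for K
    proof -
      have "finite {F. F face_of K}"
        using s S that simplex_imp_polytope finite_polytope_faces by blast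
      then have "finite ((\<lambda>z. {z}) -` {F. F face_of K})" by (rule finite_vimageI) auto
      then show ?thesis by (simp add: vimage_def)
    qed
    moreover have "V = (\<Union>K\<in>S. {z. {z} face_of K})" by (auto simp: V_def)
    ultimately show ?thesis using fin by simp
  qed
  have seg: "z \<in> V" "w \<in> V" "z \<noteq> w" if "K \<in> S" "closed_segment z w edge_of K" for z w K
  proof -
    have f: "closed_segment z w face_of K" and d: "aff_dim (closed_segment z w) = 1"
      using that by (auto simp: edge_of_def)
    show "z \<noteq> w" using d by auto
    have "{z} face_of K" "{w} face_of K"
      by (rule face_of_trans[OF _ f], simp add: face_of_singleton extreme_point_of_segment)+
    then show "z \<in> V" "w \<in> V" using that V_def by auto
  qed
  have edge: "\<exists>z w. closed_segment z w edge_of K" if "K \<in> S" for K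
  proof -
    obtain a b c where "K = convex hull {a, b, c}" "cross2 (b - a) (c - a) \<noteq> 0"
      using s[of K] S \<open>K \<in> S\<close> unfolding simplex_2_iff by blast
    then show ?thesis using edge_of_triangle by blast
  qed
  obtain K0 where "K0 \<in> S" using \<open>S \<noteq> {}\<close> by blast
  then have "V \<noteq> {}" using edge[of K0] seg(1)[of K0] by blast
  obtain z where z: "z \<in> V" "\<And>w. w \<in> V \<Longrightarrow> norm w \<le> norm z"
    using finite_has_maximizer[OF finV \<open>V \<noteq> {}\<close>, of norm] by blast
  have neg: "z \<bullet> (w - z) < 0" if "w \<in> V" "w \<noteq> z" for w
  proof -
    have "(norm (w - z))\<^sup>2 > 0" using that by simp
    moreover have "(norm (w - z))\<^sup>2 = (norm w)\<^sup>2 - (norm z)\<^sup>2 - 2 * (z \<bullet> (w - z))"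
      by (simp add: power2_norm_eq_inner algebra_simps inner_commute)
    moreover have "(norm w)\<^sup>2 \<le> (norm z)\<^sup>2" using z(2)[OF that(1)] by simp
    ultimately show ?thesis by linarith
  qed
  define N where "N = {w. \<exists>K\<in>S. closed_segment z w edge_of K}"
  \<comment> \<open>the tangent of the angle between \<open>w - z\<close> and \<open>z\<close>, which orders the directions in the half plane\<close>
  define slope where "slope w = cross2 z (w - z) / (z \<bullet> (w - z))" for w
  have NV: "N \<subseteq> V - {z}" using seg(2,3) unfolding N_def by blast
  have third: "c \<in> N" if "convex hull {z, w, c} \<in> S" "cross2 (w - z) (c - z) \<noteq> 0" for w c
    using that edge_of_triangle[OF that(2)] by (auto simp: N_def)
  have "N \<noteq> {}"
  proof -
    obtain K where K: "K \<in> S" "{z} face_of K" using z(1) V_def by blast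
    obtain a b c where abc: "K = convex hull {a, b, c}" "cross2 (b - a) (c - a) \<noteq> 0"
      using s[of K] S K(1) unfolding simplex_2_iff by blast
    have "z \<in> {a, b, c}"
      using K(2) extreme_point_of_convex_hull unfolding abc(1) face_of_singleton by blast
    then show ?thesis
      using K(1) edge_of_triangle[OF abc(2)] closed_segment_commute[of b a]
        closed_segment_commute[of c a] unfolding N_def abc(1) by blast
  qed
  have "finite N" using finV NV finite_subset by blast
  then obtain w where w: "w \<in> N" "\<And>u. u \<in> N \<Longrightarrow> slope u \<le> slope w"
    using finite_has_maximizer[OF _ \<open>N \<noteq> {}\<close>, of slope] by blast
  then obtain K where K: "K \<in> S" "closed_segment z w edge_of K" by (auto simp: N_def)
  obtain K' where K': "K' \<in> S" "K' \<noteq> K" "closed_segment z w edge_of K'" using nb[OF K] by blast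
  obtain c where c: "K = convex hull {z, w, c}" "cross2 (w - z) (c - z) \<noteq> 0"
    using edge_of_2_simplexD[OF _ K(2)] s S K(1) by blast
  obtain c' where c': "K' = convex hull {z, w, c'}" "cross2 (w - z) (c' - z) \<noteq> 0"
    using edge_of_2_simplexD[OF _ K'(3)] s S K'(1) by blast
  have "cross2 (w - z) (c - z) * cross2 (w - z) (c' - z) < 0"
    using triangulation_opposite_sides[OF tri] c c' K(1) K'(1,2) S by blast
  then obtain d where d: "d \<in> N" "cross2 (w - z) (d - z) > 0"
    using third K(1) K'(1) c c' by (metis mult_less_0_iff)
  have pos: "(z \<bullet> (w - z)) * (z \<bullet> (d - z)) > 0"
    using neg NV w(1) d(1) by (simp add: mult_neg_neg subset_iff)
  have zz: "z \<bullet> z > 0" using neg[of w] NV w(1) by (cases "z = 0") auto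
  have "(z \<bullet> (w - z)) * cross2 z (d - z) - cross2 z (w - z) * (z \<bullet> (d - z))
      = (z \<bullet> z) * cross2 (w - z) (d - z)"
    unfolding cross2_def inner_vec_def sum_2 by (simp add: algebra_simps)
  moreover have "slope d - slope w =
      ((z \<bullet> (w - z)) * cross2 z (d - z) - cross2 z (w - z) * (z \<bullet> (d - z)))
       / ((z \<bullet> (w - z)) * (z \<bullet> (d - z)))"
    using pos unfolding slope_def by (simp add: diff_divide_distrib zero_less_mult_iff) (auto simp: field_simps)
  ultimately have "slope d - slope w > 0" using pos zz d(2) by simp
  then show False using w(2)[OF d(1)] by simp
qed

section \<open>Affine pieces and their traces\<close>

type_synonym affmap = "(real ^ 2 ^ 2) \<times> vec2"

definition aff_app :: "affmap \<Rightarrow> vec2 \<Rightarrow> vec2" where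
  "aff_app F x = fst F *v x + snd F"

text \<open>
  The affine function that \<open>g\<close> agrees with inside \<open>K\<close>. It is unique because \<open>K\<close> has interior points,
  which makes it linear in \<open>g\<close> and inherited by subtriangles.
\<close>

definition local_aff :: "(vec2 \<Rightarrow> vec2) \<Rightarrow> vec2 set \<Rightarrow> affmap" where
  "local_aff g K = (SOME F. \<forall>x\<in>interior K. g x = aff_app F x)"

definition affine_inside :: "(vec2 \<Rightarrow> vec2) \<Rightarrow> vec2 set \<Rightarrow> bool" where
  "affine_inside g K \<longleftrightarrow> (\<exists>F. \<forall>x\<in>interior K. g x = aff_app F x)"

lemma local_aff_app:
  assumes "affine_inside g K" "x \<in> interior K"
  shows "g x = aff_app (local_aff g K) x"
  using assms someI_ex[of "\<lambda>F. \<forall>x\<in>interior K. g x = aff_app F x"]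
  unfolding affine_inside_def local_aff_def by blast

lemma aff_app_diff: "aff_app (F - G) x = aff_app F x - aff_app G x"
  by (simp add: aff_app_def matrix_vector_mult_diff_rdistrib)

lemma aff_app_add: "aff_app (F + G) x = aff_app F x + aff_app G x"
  by (simp add: aff_app_def matrix_vector_mult_add_rdistrib)

lemma aff_app_minus_point: "aff_app F x - aff_app F y = fst F *v (x - y)"
  by (simp add: aff_app_def matrix_vector_mult_diff_distrib)

lemma aff_app_midpoint: "aff_app F (midpoint x y) = (1 / 2) *\<^sub>R (aff_app F x + aff_app F y)"
  by (simp add: aff_app_def midpoint_def matrix_vector_right_distrib matrix_vector_mult_scaleR
      scaleR_add_right scaleR_half_double)

lemma aff_app_eq_onI:
  assumes "open S" "S \<noteq> {}" "\<And>x. x \<in> S \<Longrightarrow> aff_app F x = aff_app G x"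
  shows "F = G"
proof -
  define D where "D = F - G"
  obtain x where x: "x \<in> S" using assms(2) by blast
  have z: "aff_app D y = 0" if "y \<in> S" for y
    using assms(3)[OF that] by (simp add: D_def aff_app_diff)
  obtain e where e: "e > 0" "ball x e \<subseteq> S" using assms(1) x open_contains_ball by blast
  have "fst D *v u = 0" for u
  proof (cases "u = 0")
    case False
    define d where "d = e / (2 * norm u)"
    have d: "d > 0" using e(1) False by (simp add: d_def)
    have "x + d *\<^sub>R u \<in> ball x e"
      using e(1) False by (simp add: d_def dist_norm)
    then have "aff_app D (x + d *\<^sub>R u) = 0" using z e(2) by blast
    then have "fst D *v (d *\<^sub>R u) = 0"
      using aff_app_minus_point[of D "x + d *\<^sub>R u" x] z[OF x] by simp
    then show ?thesis using d by (simp add: matrix_vector_mult_scaleR)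
  qed simp
  then have "fst D = 0" by (simp add: matrix_eq)
  moreover from this have "snd D = 0" using z[OF x] by (simp add: aff_app_def)
  ultimately have "D = 0" by (simp add: prod_eq_iff)
  then show ?thesis by (simp add: D_def)
qed

lemma local_aff_eqI:
  assumes "2 simplex K" "\<And>x. x \<in> interior K \<Longrightarrow> g x = aff_app F x"
  shows "local_aff g K = F"
proof -
  have "affine_inside g K" using assms(2) affine_inside_def by blast
  then show ?thesis
    using aff_app_eq_onI[OF open_interior interior_2_simplex[OF assms(1)], of "local_aff g K" F]
      local_aff_app assms(2) by metis
qed

lemma local_aff_subset:
  assumes "affine_inside g K" "2 simplex K'" "K' \<subseteq> K"
  shows "local_aff g K' = local_aff g K" "affine_inside g K'"
proof -
  have *: "g x = aff_app (local_aff g K) x" if "x \<in> interior K'" for x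
    using local_aff_app[OF assms(1)] interior_mono[OF assms(3)] that by blast
  show "local_aff g K' = local_aff g K" by (rule local_aff_eqI[OF assms(2) *])
  show "affine_inside g K'" using * affine_inside_def by blast
qed

lemma local_aff_diff:
  assumes "affine_inside g K" "affine_inside h K" "2 simplex K"
  shows "local_aff (\<lambda>x. g x - h x) K = local_aff g K - local_aff h K"
    "affine_inside (\<lambda>x. g x - h x) K"
proof -
  have *: "g x - h x = aff_app (local_aff g K - local_aff h K) x" if "x \<in> interior K" for x
    using assms(1,2)[THEN local_aff_app, OF that] by (simp add: aff_app_diff)
  show "local_aff (\<lambda>x. g x - h x) K = local_aff g K - local_aff h K"
    by (rule local_aff_eqI[OF assms(3) *])
  show "affine_inside (\<lambda>x. g x - h x) K" using * affine_inside_def by blast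
qed

lemma grad_affine_inside:
  assumes "affine_inside g K" "x \<in> interior K"
  shows "grad g x = fst (local_aff g K)"
proof -
  let ?F = "local_aff g K"
  have "(aff_app ?F has_derivative (\<lambda>h. fst ?F *v h)) (at x)"
    unfolding aff_app_def[abs_def]
    by (auto intro!: derivative_eq_intros bounded_linear_imp_has_derivative
        matrix_vector_mul_bounded_linear)
  then have "(g has_derivative (\<lambda>h. fst ?F *v h)) (at x)"
    by (rule has_derivative_transform_within_open[OF _ open_interior assms(2)])
      (use local_aff_app[OF assms(1)] in auto)
  then have "frechet_derivative g (at x) = (\<lambda>h. fst ?F *v h)"
    using frechet_derivative_at by metis
  then show ?thesis by (simp add: grad_def matrix_of_matrix_vector_mul)
qed

lemma side_trace_eq:
  fixes h :: "vec2 \<Rightarrow> vec2"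
  assumes K: "2 simplex K" "x \<in> K" and h: "\<And>y. y \<in> interior K \<Longrightarrow> h y = H y"
    and H: "isCont H x"
  shows "side_trace K h x = H x"
proof -
  have "x \<in> closure (interior K)"
    using convex_closure_interior[OF convex_simplex[OF K(1)] interior_2_simplex[OF K(1)]] K(2)
      closure_subset by blast
  then have "x islimpt interior K"
    by (metis Un_iff closure_def interior_limit_point interior_interior mem_Collect_eq)
  then have nt: "\<not> trivial_limit (at x within interior K)" by (simp add: trivial_limit_within)
  have "(H \<longlongrightarrow> H x) (at x within interior K)"
    using H unfolding isCont_def by (rule tendsto_within_subset) simp
  then have "(h \<longlongrightarrow> H x) (at x within interior K)"
    by (rule Lim_transform_eventually) (auto simp: eventually_at_filter h)
  then show ?thesis unfolding side_trace_def by (rule tendsto_Lim[OF nt])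
qed

lemma side_trace_affine_inside:
  assumes "2 simplex K" "x \<in> K" "affine_inside g K"
  shows "side_trace K g x = aff_app (local_aff g K) x"
proof (rule side_trace_eq[OF assms(1,2) local_aff_app[OF assms(3)]])
  show "isCont (aff_app (local_aff g K)) x"
    unfolding aff_app_def[abs_def]
    by (intro continuous_intros linear_continuous_at matrix_vector_mul_bounded_linear)
qed

section \<open>Bisection trees and bottom-up interpolation\<close>

text \<open>
  The shape of a sequence of bisections below one labelled triangle. A forest of such trees
  records a refinement independently of the order of the bisections and of the nonconforming meshes
  in between.
\<close>

datatype bisection_tree = Leaf | Node bisection_tree bisection_tree

fun left_child :: "ltriangle \<Rightarrow> ltriangle" where
  "left_child (v, a, b) = (midpoint a b, v, a)"

fun right_child :: "ltriangle \<Rightarrow> ltriangle" where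
  "right_child (v, a, b) = (midpoint a b, b, v)"

lemma children_eq: "children K = {left_child K, right_child K}"
  by (cases K) auto

primrec leaves :: "bisection_tree \<Rightarrow> ltriangle \<Rightarrow> ltriangle set" where
  "leaves Leaf K = {K}"
| "leaves (Node l r) K = leaves l (left_child K) \<union> leaves r (right_child K)"

primrec split_leaf :: "ltriangle \<Rightarrow> bisection_tree \<Rightarrow> ltriangle \<Rightarrow> bisection_tree" where
  "split_leaf K0 Leaf K = (if K = K0 then Node Leaf Leaf else Leaf)"
| "split_leaf K0 (Node l r) K =
     Node (split_leaf K0 l (left_child K)) (split_leaf K0 r (right_child K))"

lemma leaves_split_leaf:
  "leaves (split_leaf K0 t K) K =
     (if K0 \<in> leaves t K then (leaves t K - {K0}) \<union> children K0 else leaves t K)"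
proof (induction t arbitrary: K)
  case Leaf
  then show ?case by (auto simp: children_eq)
next
  case (Node l r)
  show ?case unfolding split_leaf.simps leaves.simps Node by (auto split: if_splits)
qed

text \<open>
  Bisecting a labelled triangle is read as splitting all leaves that equal it, in every tree of the
  forest at once.
\<close>

lemma nvb_forest:
  assumes "nvb_step\<^sup>*\<^sup>* L L'"
  shows "\<exists>t. L' = (\<Union>K\<in>L. leaves (t K) K)"
  using assms
proof (induction rule: rtranclp_induct)
  case base
  show ?case by (rule exI[of _ "\<lambda>_. Leaf"]) simp
next
  case (step M M')
  then obtain t where t: "M = (\<Union>K\<in>L. leaves (t K) K)" by blast
  obtain K0 where K0: "K0 \<in> M" "M' = (M - {K0}) \<union> children K0"
    using step(2) by (auto simp: nvb_step_def)
  have "M' = (\<Union>K\<in>L. leaves (split_leaf K0 (t K) K) K)"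
    using K0 unfolding leaves_split_leaf t by (auto split: if_splits)
  then show ?case by (intro exI[of _ "\<lambda>K. split_leaf K0 (t K) K"])
qed

text \<open>
  Composition of two successive refinements.
\<close>

primrec graft :: "bisection_tree \<Rightarrow> (ltriangle \<Rightarrow> bisection_tree) \<Rightarrow> ltriangle \<Rightarrow> bisection_tree" where
  "graft Leaf s K = s K"
| "graft (Node l r) s K = Node (graft l s (left_child K)) (graft r s (right_child K))"

lemma leaves_graft: "leaves (graft t s K) K = (\<Union>K'\<in>leaves t K. leaves (s K') K')"
  by (induction t arbitrary: K) auto

fun tri_det :: "ltriangle \<Rightarrow> real" where
  "tri_det (v, a, b) = cross2 (a - v) (b - v)"

fun verts :: "ltriangle \<Rightarrow> vec2 set" where
  "verts (v, a, b) = {v, a, b}"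

fun spread :: "ltriangle \<Rightarrow> real" where
  "spread (v, a, b) = (norm (a - v))\<^sup>2 + (norm (b - v))\<^sup>2"

lemma triangle_eq_verts: "triangle K = convex hull verts K"
  by (cases K) simp

lemma simplex_iff_tri_det: "2 simplex triangle K \<longleftrightarrow> tri_det K \<noteq> 0"
proof
  assume s: "2 simplex triangle K"
  obtain v a b where K: "K = (v, a, b)" by (cases K)
  show "tri_det K \<noteq> 0"
  proof
    assume "tri_det K = 0"
    then have "measure lebesgue (triangle K) = 0" by (simp add: K measure_triangle)
    moreover have "bounded (triangle K)" "convex (triangle K)"
      using s compact_simplex compact_imp_bounded convex_simplex by blast+
    ultimately have "interior (triangle K) = {}"
      using negligible_iff_measure0[of "triangle K"] measurable_convex
      by (metis interior_subset negligible_subset open_interior open_not_negligible)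
    then show False using interior_2_simplex[OF s] by simp
  qed
next
  assume "tri_det K \<noteq> 0"
  then show "2 simplex triangle K" by (cases K) (auto simp: simplex_2_iff)
qed

lemma measure_ltriangle: "measure lebesgue (triangle K) = \<bar>tri_det K\<bar> / 2"
  by (cases K) (simp add: measure_triangle)

lemma tri_det_child:
  "tri_det (left_child K) = - tri_det K / 2 \<or> tri_det (left_child K) = tri_det K / 2"
  "tri_det (right_child K) = - tri_det K / 2 \<or> tri_det (right_child K) = tri_det K / 2"
  by (cases K; simp add: cross2_def midpoint_def; simp add: field_simps)+

lemma tri_det_child_nz:
  assumes "tri_det K \<noteq> 0"
  shows "tri_det (left_child K) \<noteq> 0" "tri_det (right_child K) \<noteq> 0"
  using tri_det_child[of K] assms by auto

lemma measure_child:
  "measure lebesgue (triangle (left_child K)) = measure lebesgue (triangle K) / 2"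
  "measure lebesgue (triangle (right_child K)) = measure lebesgue (triangle K) / 2"
  using tri_det_child[of K] by (auto simp: measure_ltriangle)

text \<open>
  The parallelogram law. Together with \<open>measure_child\<close> this keeps \<open>spread K / measure K\<close> constant
  along the tree, which is the shape regularity of newest vertex bisection.
\<close>

lemma spread_child:
  "spread (left_child K) = spread K / 2" "spread (right_child K) = spread K / 2"
  by (cases K; simp add: norm_sq_vec2 midpoint_def; simp add: power2_eq_square field_simps)+

lemma edge_of_ltriangle:
  assumes "tri_det K \<noteq> 0"
  shows "closed_segment x y edge_of triangle K \<longleftrightarrow> x \<noteq> y \<and> {x, y} \<subseteq> verts K"
proof -
  obtain v a b where K: "K = (v, a, b)" by (cases K)
  have nz: "cross2 (a - v) (b - v) \<noteq> 0" using assms by (simp add: K)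
  then have d: "v \<noteq> a" "v \<noteq> b" "a \<noteq> b" by (auto simp: cross2_def)
  show ?thesis
    unfolding K triangle.simps edge_of_triangle[OF nz] closed_segment_eq verts.simps
    using d by (auto simp: doubleton_eq_iff)
qed

text \<open>
  The Crouzeix-Raviart interpolant on a bisected triangle of the function that equals \<open>F\<close> and \<open>G\<close>
  on the children. If \<open>F\<close> and \<open>G\<close> agree at the midpoint of the bisecting segment, the mean of \<open>F\<close> and
  \<open>G\<close>, shifted by the constant in the second summand, has the same mean values as the given function on
  the three edges of the parent.
\<close>

fun bisect_aff :: "ltriangle \<Rightarrow> affmap \<Rightarrow> affmap \<Rightarrow> affmap" where
  "bisect_aff (v, a, b) F G =
     (1 / 2) *\<^sub>R (F + G) +
     (0, (1 / 2) *\<^sub>R (aff_app F (midpoint v a) + aff_app G (midpoint v b))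
         - aff_app F (midpoint (midpoint a b) v))"

declare bisect_aff.simps [simp del]

text \<open>
  Interpolation from the leaves up to the root. On every edge of the root the value of \<open>cr_interp \<phi> t K\<close> at the
  midpoint is the mean of the leaf functions over the edge, provided the tree is \<open>mid_compatible\<close>.
\<close>

primrec cr_interp :: "(ltriangle \<Rightarrow> affmap) \<Rightarrow> bisection_tree \<Rightarrow> ltriangle \<Rightarrow> affmap" where
  "cr_interp \<phi> Leaf K = \<phi> K"
| "cr_interp \<phi> (Node l r) K = bisect_aff K (cr_interp \<phi> l (left_child K)) (cr_interp \<phi> r (right_child K))"

fun bisector_mid :: "ltriangle \<Rightarrow> vec2" where
  "bisector_mid (v, a, b) = midpoint (midpoint a b) v"

primrec mid_compatible :: "(ltriangle \<Rightarrow> affmap) \<Rightarrow> bisection_tree \<Rightarrow> ltriangle \<Rightarrow> bool" where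
  "mid_compatible \<phi> Leaf K = True"
| "mid_compatible \<phi> (Node l r) K \<longleftrightarrow> mid_compatible \<phi> l (left_child K) \<and> mid_compatible \<phi> r (right_child K) \<and>
     aff_app (cr_interp \<phi> l (left_child K)) (bisector_mid K) =
     aff_app (cr_interp \<phi> r (right_child K)) (bisector_mid K)"

lemma fst_bisect_aff: "fst (bisect_aff K F G) = (1 / 2) *\<^sub>R (fst F + fst G)"
  by (cases K) (simp add: bisect_aff.simps)

lemma bisect_aff_self: "bisect_aff K F F = F"
proof -
  obtain v a b where K: "K = (v, a, b)" by (cases K)
  have "(1 / 2) *\<^sub>R (aff_app F (midpoint v a) + aff_app F (midpoint v b))
      - aff_app F (midpoint (midpoint a b) v) = 0"
    unfolding vec_eq_iff by (simp add: aff_app_midpoint) (simp add: field_simps)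
  moreover have "(1 / 2) *\<^sub>R (F + F) = F" by (rule scaleR_half_double)
  ultimately show ?thesis unfolding K bisect_aff.simps by (simp only: zero_prod_def[symmetric]) simp
qed

lemma bisect_aff_diff: "bisect_aff K (F - F') (G - G') = bisect_aff K F G - bisect_aff K F' G'"
proof -
  obtain v a b where K: "K = (v, a, b)" by (cases K)
  show ?thesis
    unfolding K bisect_aff.simps prod_eq_iff by (simp add: aff_app_diff algebra_simps)
qed

lemma aff_app_0_const: "aff_app (F + (0, c)) x = aff_app F x + c"
  by (simp add: aff_app_def)

lemma aff_app_scaleR: "aff_app (r *\<^sub>R F) x = r *\<^sub>R aff_app F x"
  by (simp add: aff_app_def scaleR_matrix_vector_assoc scaleR_add_right)

lemma bisect_aff_edges:
  fixes v a b :: vec2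
  defines "m \<equiv> midpoint a b"
  assumes c: "aff_app F (midpoint m v) = aff_app G (midpoint m v)"
  shows "aff_app (bisect_aff (v, a, b) F G) (midpoint v a) = aff_app F (midpoint v a)"
    "aff_app (bisect_aff (v, a, b) F G) (midpoint v b) = aff_app G (midpoint v b)"
    "aff_app (bisect_aff (v, a, b) F G) (midpoint a b) =
       (1 / 2) *\<^sub>R (aff_app F (midpoint a m) + aff_app G (midpoint m b))"
proof -
  have Fm: "aff_app F m = (1 / 2) *\<^sub>R (aff_app F a + aff_app F b)"
    and Gm: "aff_app G m = (1 / 2) *\<^sub>R (aff_app G a + aff_app G b)"
    by (simp_all add: m_def aff_app_midpoint)
  have c': "aff_app G v $ i = aff_app F v $ i + (aff_app F a $ i + aff_app F b $ i) / 2
      - (aff_app G a $ i + aff_app G b $ i) / 2" for i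
    using arg_cong[OF c, of "\<lambda>u. u $ i"]
    by (simp add: aff_app_midpoint[of _ m] Fm Gm) (simp add: field_simps)
  show "aff_app (bisect_aff (v, a, b) F G) (midpoint v a) = aff_app F (midpoint v a)"
    "aff_app (bisect_aff (v, a, b) F G) (midpoint v b) = aff_app G (midpoint v b)"
    "aff_app (bisect_aff (v, a, b) F G) (midpoint a b) =
       (1 / 2) *\<^sub>R (aff_app F (midpoint a m) + aff_app G (midpoint m b))"
    unfolding bisect_aff.simps aff_app_0_const
    unfolding aff_app_scaleR aff_app_add vec_eq_iff
    by (simp_all add: aff_app_midpoint Fm Gm c' m_def[symmetric]) (simp_all add: field_simps)
qed

lemma cr_interp_diff: "cr_interp (\<lambda>K. \<phi> K - \<psi> K) t K = cr_interp \<phi> t K - cr_interp \<psi> t K"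
  by (induction t arbitrary: K) (simp_all add: bisect_aff_diff)

lemma mid_compatible_diff:
  "mid_compatible \<phi> t K \<Longrightarrow> mid_compatible \<psi> t K \<Longrightarrow> mid_compatible (\<lambda>K. \<phi> K - \<psi> K) t K"
  by (induction t arbitrary: K) (simp_all add: cr_interp_diff aff_app_diff)

lemma cr_interp_const:
  assumes "\<And>K'. K' \<in> leaves t K \<Longrightarrow> \<phi> K' = F"
  shows "cr_interp \<phi> t K = F" "mid_compatible \<phi> t K"
proof -
  have "cr_interp \<phi> t K = F \<and> mid_compatible \<phi> t K" using assms
  proof (induction t arbitrary: K)
    case (Node l r)
    then have "cr_interp \<phi> l (left_child K) = F \<and> mid_compatible \<phi> l (left_child K)"
      "cr_interp \<phi> r (right_child K) = F \<and> mid_compatible \<phi> r (right_child K)" by auto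
    then show ?case by (simp add: bisect_aff_self)
  qed simp
  then show "cr_interp \<phi> t K = F" "mid_compatible \<phi> t K" by auto
qed

lemma cr_interp_graft: "cr_interp \<phi> (graft t s K) K = cr_interp (\<lambda>K'. cr_interp \<phi> (s K') K') t K"
  by (induction t arbitrary: K) simp_all

lemma mid_compatible_graft:
  "mid_compatible \<phi> (graft t s K) K \<longleftrightarrow>
     mid_compatible (\<lambda>K'. cr_interp \<phi> (s K') K') t K \<and> (\<forall>K'\<in>leaves t K. mid_compatible \<phi> (s K') K')"
  by (induction t arbitrary: K) (auto simp: cr_interp_graft)

lemma cr_interp_cong:
  "(\<And>K'. K' \<in> leaves t K \<Longrightarrow> \<phi> K' = \<psi> K') \<Longrightarrow> cr_interp \<phi> t K = cr_interp \<psi> t K"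
  by (induction t arbitrary: K) simp_all

lemma mid_compatible_cong:
  "(\<And>K'. K' \<in> leaves t K \<Longrightarrow> \<phi> K' = \<psi> K') \<Longrightarrow> mid_compatible \<phi> t K = mid_compatible \<psi> t K"
  by (induction t arbitrary: K) (simp_all cong: cr_interp_cong)

definition subtrees :: "bisection_tree \<Rightarrow> ltriangle \<Rightarrow> (bisection_tree \<times> ltriangle) set" where
  "subtrees t K = (case t of Leaf \<Rightarrow> {} | Node l r \<Rightarrow> {(l, left_child K), (r, right_child K)})"

lemma subtreesD:
  assumes "(t', K') \<in> subtrees t K"
  shows "size t' < size t" "leaves t' K' \<subseteq> leaves t K"
    "mid_compatible \<phi> t K \<Longrightarrow> mid_compatible \<phi> t' K'" "tri_det K \<noteq> 0 \<Longrightarrow> tri_det K' \<noteq> 0"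
  using assms tri_det_child_nz[of K]
  by (auto simp: subtrees_def simp del: tri_det.simps left_child.simps right_child.simps
      split: bisection_tree.splits)

lemma verts_leaf: "z \<in> verts K \<Longrightarrow> \<exists>K'\<in>leaves t K. z \<in> verts K'"
proof (induction t arbitrary: K)
  case (Node l r)
  then have "z \<in> verts (left_child K) \<or> z \<in> verts (right_child K)"
    by (cases K) auto
  then show ?case
  proof
    assume "z \<in> verts (left_child K)"
    from Node.IH(1)[OF this] show ?thesis unfolding leaves.simps by blast
  next
    assume "z \<in> verts (right_child K)"
    from Node.IH(2)[OF this] show ?thesis unfolding leaves.simps by blast
  qed
qed simp

text \<open>
  The case distinction by which statements on edge means are passed down a tree: \<open>xy\<close> is either an edge
  of one child or the refinement edge, and then each child has one of its halves.
\<close>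

lemma node_edge:
  assumes c: "mid_compatible \<phi> (Node l r) K" and xy: "x \<noteq> y" "{x, y} \<subseteq> verts K"
  shows
    "(\<exists>t' K'. (t', K') \<in> subtrees (Node l r) K \<and> {x, y} \<subseteq> verts K' \<and>
       aff_app (cr_interp \<phi> (Node l r) K) (midpoint x y) = aff_app (cr_interp \<phi> t' K') (midpoint x y)) \<or>
     (\<exists>t1 K1 t2 K2. (t1, K1) \<in> subtrees (Node l r) K \<and> (t2, K2) \<in> subtrees (Node l r) K \<and>
       {x, midpoint x y} \<subseteq> verts K1 \<and> {midpoint x y, y} \<subseteq> verts K2 \<and>
       aff_app (cr_interp \<phi> (Node l r) K) (midpoint x y) =
         (1 / 2) *\<^sub>R (aff_app (cr_interp \<phi> t1 K1) (midpoint x (midpoint x y))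
                   + aff_app (cr_interp \<phi> t2 K2) (midpoint (midpoint x y) y)))"
    (is "?A \<or> ?B")
proof -
  obtain v a b where K: "K = (v, a, b)" by (cases K)
  define m where "m = midpoint a b"
  let ?F = "cr_interp \<phi> l (m, v, a)" and ?G = "cr_interp \<phi> r (m, b, v)"
  have F: "cr_interp \<phi> (Node l r) K = bisect_aff (v, a, b) ?F ?G" by (simp add: K m_def)
  have eq: "aff_app ?F (midpoint m v) = aff_app ?G (midpoint m v)"
    using c by (simp add: K m_def)
  note E = bisect_aff_edges[OF eq[unfolded m_def], folded m_def]
  have S: "subtrees (Node l r) K = {(l, (m, v, a)), (r, (m, b, v))}"
    by (simp add: subtrees_def K m_def)
  from xy consider "{x, y} = {v, a}" | "{x, y} = {v, b}" | "{x, y} = {a, b}"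
    by (auto simp: K)
  then show ?thesis
  proof cases
    case 1
    then have "midpoint x y = midpoint v a" "{x, y} \<subseteq> verts (m, v, a)"
      by (auto simp: doubleton_eq_iff midpoint_sym)
    then have ?A unfolding S F by (intro exI[of _ l] exI[of _ "(m, v, a)"]) (simp_all add: E(1))
    then show ?thesis ..
  next
    case 2
    then have "midpoint x y = midpoint v b" "{x, y} \<subseteq> verts (m, b, v)"
      by (auto simp: doubleton_eq_iff midpoint_sym)
    then have ?A unfolding S F by (intro exI[of _ r] exI[of _ "(m, b, v)"]) (simp_all add: E(2))
    then show ?thesis ..
  next
    case 3
    then consider "x = a" "y = b" | "x = b" "y = a" by (auto simp: doubleton_eq_iff)
    then have ?B
    proof cases
      case 1
      then show ?thesis unfolding S F
        by (intro exI[of _ l] exI[of _ "(m, v, a)"] exI[of _ r] exI[of _ "(m, b, v)"]) (simp_all add: E(3)[folded m_def] m_def[symmetric])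
    next
      case 2
      then have "midpoint x y = m" by (simp add: m_def midpoint_sym)
      with 2 show ?thesis unfolding S F
        using E(3) midpoint_sym[of a m] midpoint_sym[of b m] midpoint_sym[of b a]
        by (intro exI[of _ r] exI[of _ "(m, b, v)"] exI[of _ l] exI[of _ "(m, v, a)"]) (simp_all add: m_def[symmetric] add.commute)
    qed
    then show ?thesis ..
  qed
qed

text \<open>
  The common face of the two triangles contains the midpoint, hence the whole edge; but a vertex of \<open>K'\<close>
  is an extreme point of \<open>K'\<close>.
\<close>

lemma no_hanging_node:
  assumes tri: "triangulation T" and T: "triangle K \<in> T" "triangle K' \<in> T"
    and nz: "tri_det K \<noteq> 0" "tri_det K' \<noteq> 0"
    and xy: "x \<noteq> y" "{x, y} \<subseteq> verts K" and m: "midpoint x y \<in> verts K'"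
  shows False
proof -
  let ?E = "closed_segment x y"
  have E: "?E edge_of triangle K" using edge_of_ltriangle[OF nz(1)] xy by blast
  have seg: "midpoint x y \<in> open_segment x y" using xy(1) by simp
  have mK': "midpoint x y \<in> triangle K'"
    using m hull_inc[of _ "verts K'"] by (simp add: triangle_eq_verts)
  have "midpoint x y \<in> rel_interior ?E" using seg xy(1) by (simp add: rel_interior_closed_segment)
  then have "?E \<subseteq> triangle K \<inter> triangle K'"
    using subset_of_face_of[OF triangulation_face(1)[OF tri T] edge_of_imp_subset[OF E]] mK' E
      edge_of_imp_subset seg open_closed_segment by blast
  then have "x \<in> triangle K'" "y \<in> triangle K'" by auto
  moreover have "midpoint x y extreme_point_of triangle K'"
  proof -
    obtain v a b where K': "K' = (v, a, b)" by (cases K')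
    have "\<not> collinear {v, a, b}" using nz(2) collinear_iff_cross2 by (simp add: K')
    then have "\<not> affine_dependent {v, a, b}" by (simp add: collinear_3_eq_affine_dependent)
    then show ?thesis
      using m by (simp add: extreme_point_of_convex_hull_affine_independent K')
  qed
  ultimately show False using seg unfolding extreme_point_of_def by blast
qed

definition edge_matching :: "ltriangle set \<Rightarrow> (ltriangle \<Rightarrow> affmap) \<Rightarrow> bool" where
  "edge_matching N \<phi> \<longleftrightarrow> (\<forall>K\<in>N. \<forall>K'\<in>N. \<forall>x y. x \<noteq> y \<longrightarrow> {x, y} \<subseteq> verts K \<longrightarrow>
     {x, y} \<subseteq> verts K' \<longrightarrow> aff_app (\<phi> K) (midpoint x y) = aff_app (\<phi> K') (midpoint x y))"

text \<open>
  Continuity of edge means across an edge shared by two trees. The two trees are descended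
  simultaneously along the edge; conformity of the leaves excludes that one of them bisects the
  edge where the other has a leaf, and at two leaves the claim is the continuity at the midpoint.
\<close>

lemma cr_interp_edge_agree:
  assumes tri: "triangulation (mesh N)" and nz: "\<And>K. K \<in> N \<Longrightarrow> tri_det K \<noteq> 0"
    and mt: "edge_matching N \<phi>"
    and "leaves t K \<subseteq> N" "leaves t' K' \<subseteq> N" "tri_det K \<noteq> 0" "tri_det K' \<noteq> 0"
    and "mid_compatible \<phi> t K" "mid_compatible \<phi> t' K'"
    and "x \<noteq> y" "{x, y} \<subseteq> verts K" "{x, y} \<subseteq> verts K'"
  shows "aff_app (cr_interp \<phi> t K) (midpoint x y) = aff_app (cr_interp \<phi> t' K') (midpoint x y)"
  using assms(4-)
proof (induction "size t + size t'" arbitrary: t t' K K' x y rule: less_induct)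
  case less
  note prems = less.prems
  have mesh: "triangle K0 \<in> mesh N" if "K0 \<in> N" for K0 using that by (simp add: mesh_def)
  have hang: False if K0: "K0 \<in> N" "{x, y} \<subseteq> verts K0"
    and s: "leaves s K1 \<subseteq> N" "midpoint x y \<in> verts K1" for K0 K1 s
  proof -
    obtain K2 where "K2 \<in> leaves s K1" "midpoint x y \<in> verts K2" using verts_leaf s(2) by blast
    then show False
      using no_hanging_node[OF tri mesh mesh] K0 s(1) nz prems(7) by blast
  qed
  have mid: "x \<noteq> midpoint x y" "midpoint x y \<noteq> y"
    using prems(7) midpoint_eq_endpoint by metis+
  show ?case
  proof (cases t)
    case Leaf
    then have KN: "K \<in> N" using prems(1) by simp
    show ?thesis
    proof (cases t')
      case Leaf': Leaf
      then have "K' \<in> N" using prems(2) by simp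
      then show ?thesis
        using mt KN prems(7-9) unfolding edge_matching_def Leaf Leaf' cr_interp.simps by blast
    next
      case (Node l r)
      note sub = subtreesD[where t = t' and K = K']
      from node_edge[OF prems(6)[unfolded Node] prems(7,9), folded Node] show ?thesis
      proof (elim disjE exE conjE)
        fix s K1
        assume s: "(s, K1) \<in> subtrees t' K'" "{x, y} \<subseteq> verts K1"
          and eq: "aff_app (cr_interp \<phi> t' K') (midpoint x y) = aff_app (cr_interp \<phi> s K1) (midpoint x y)"
        have "aff_app (cr_interp \<phi> t K) (midpoint x y) = aff_app (cr_interp \<phi> s K1) (midpoint x y)"
          by (rule less.hyps[OF _ prems(1) order_trans[OF sub(2)[OF s(1)] prems(2)] prems(3)
                sub(4)[OF s(1) prems(4)] prems(5) sub(3)[OF s(1) prems(6)] prems(7,8) s(2)])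
            (use sub(1)[OF s(1)] in simp)
        with eq show ?thesis by simp
      next
        fix s1 K1 s2 K2
        assume "(s1, K1) \<in> subtrees t' K'" "{x, midpoint x y} \<subseteq> verts K1"
        then show ?thesis using hang[OF KN prems(8)] sub(2) prems(2) by blast
      qed
    qed
  next
    case (Node l r)
    note sub = subtreesD[where t = t and K = K]
    from node_edge[OF prems(5)[unfolded Node] prems(7,8), folded Node] show ?thesis
    proof (elim disjE exE conjE)
      fix s K1
      assume s: "(s, K1) \<in> subtrees t K" "{x, y} \<subseteq> verts K1"
        and eq: "aff_app (cr_interp \<phi> t K) (midpoint x y) = aff_app (cr_interp \<phi> s K1) (midpoint x y)"
      have "aff_app (cr_interp \<phi> s K1) (midpoint x y) = aff_app (cr_interp \<phi> t' K') (midpoint x y)"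
        by (rule less.hyps[OF _ order_trans[OF sub(2)[OF s(1)] prems(1)] prems(2)
              sub(4)[OF s(1) prems(3)] prems(4) sub(3)[OF s(1) prems(5)] prems(6,7) s(2) prems(9)])
          (use sub(1)[OF s(1)] in simp)
      with eq show ?thesis by simp
    next
      fix s1 K1 s2 K2
      assume s1: "(s1, K1) \<in> subtrees t K" "{x, midpoint x y} \<subseteq> verts K1"
        and s2: "(s2, K2) \<in> subtrees t K" "{midpoint x y, y} \<subseteq> verts K2"
        and eq: "aff_app (cr_interp \<phi> t K) (midpoint x y) =
         (1 / 2) *\<^sub>R (aff_app (cr_interp \<phi> s1 K1) (midpoint x (midpoint x y))
                   + aff_app (cr_interp \<phi> s2 K2) (midpoint (midpoint x y) y))"
      show ?thesis
      proof (cases t')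
        case Leaf
        then have "K' \<in> N" using prems(2) by simp
        then show ?thesis using hang[OF _ prems(9)] s1 sub(2) prems(1) by blast
      next
        case Node': (Node l' r')
        note sub' = subtreesD[where t = t' and K = K']
        from node_edge[OF prems(6)[unfolded Node'] prems(7,9), folded Node'] show ?thesis
        proof (elim disjE exE conjE)
          fix s K3
          assume s: "(s, K3) \<in> subtrees t' K'" "{x, y} \<subseteq> verts K3"
            and eq': "aff_app (cr_interp \<phi> t' K') (midpoint x y) = aff_app (cr_interp \<phi> s K3) (midpoint x y)"
          have "aff_app (cr_interp \<phi> t K) (midpoint x y) = aff_app (cr_interp \<phi> s K3) (midpoint x y)"
            by (rule less.hyps[OF _ prems(1) order_trans[OF sub'(2)[OF s(1)] prems(2)] prems(3)
                  sub'(4)[OF s(1) prems(4)] prems(5) sub'(3)[OF s(1) prems(6)] prems(7,8) s(2)])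
              (use sub'(1)[OF s(1)] in simp)
          with eq' show ?thesis by simp
        next
          fix s3 K3 s4 K4
          assume s3: "(s3, K3) \<in> subtrees t' K'" "{x, midpoint x y} \<subseteq> verts K3"
            and s4: "(s4, K4) \<in> subtrees t' K'" "{midpoint x y, y} \<subseteq> verts K4"
            and eq': "aff_app (cr_interp \<phi> t' K') (midpoint x y) =
             (1 / 2) *\<^sub>R (aff_app (cr_interp \<phi> s3 K3) (midpoint x (midpoint x y))
                       + aff_app (cr_interp \<phi> s4 K4) (midpoint (midpoint x y) y))"
          have "aff_app (cr_interp \<phi> s1 K1) (midpoint x (midpoint x y)) =
              aff_app (cr_interp \<phi> s3 K3) (midpoint x (midpoint x y))"
            by (rule less.hyps[OF _ order_trans[OF sub(2)[OF s1(1)] prems(1)]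
                  order_trans[OF sub'(2)[OF s3(1)] prems(2)]
                  sub(4)[OF s1(1) prems(3)] sub'(4)[OF s3(1) prems(4)]
                  sub(3)[OF s1(1) prems(5)] sub'(3)[OF s3(1) prems(6)] mid(1) s1(2) s3(2)])
              (use sub(1)[OF s1(1)] sub'(1)[OF s3(1)] in simp)
          moreover have "aff_app (cr_interp \<phi> s2 K2) (midpoint (midpoint x y) y) =
              aff_app (cr_interp \<phi> s4 K4) (midpoint (midpoint x y) y)"
            by (rule less.hyps[OF _ order_trans[OF sub(2)[OF s2(1)] prems(1)]
                  order_trans[OF sub'(2)[OF s4(1)] prems(2)]
                  sub(4)[OF s2(1) prems(3)] sub'(4)[OF s4(1) prems(4)]
                  sub(3)[OF s2(1) prems(5)] sub'(3)[OF s4(1) prems(6)] mid(2) s2(2) s4(2)])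
              (use sub(1)[OF s2(1)] sub'(1)[OF s4(1)] in simp)
          ultimately show ?thesis unfolding eq eq' by simp
        qed
      qed
    qed
  qed
qed

text \<open>
  Siblings are themselves a pair of trees with a common edge, so the preceding lemma provides the
  compatibility at every node.
\<close>

lemma mid_compatible_of_matching:
  assumes tri: "triangulation (mesh N)" and nz: "\<And>K. K \<in> N \<Longrightarrow> tri_det K \<noteq> 0"
    and mt: "edge_matching N \<phi>"
    and "leaves t K \<subseteq> N" "tri_det K \<noteq> 0"
  shows "mid_compatible \<phi> t K"
  using assms(4-)
proof (induction t arbitrary: K)
  case (Node l r)
  obtain v a b where K: "K = (v, a, b)" by (cases K)
  note nz' = tri_det_child_nz[OF Node.prems(2)]
  have c: "mid_compatible \<phi> l (left_child K)" "mid_compatible \<phi> r (right_child K)"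
    using Node.IH Node.prems nz' by auto
  have "midpoint a b \<noteq> v" using nz'(1) by (auto simp: K cross2_def)
  then have "aff_app (cr_interp \<phi> l (left_child K)) (midpoint (midpoint a b) v) =
      aff_app (cr_interp \<phi> r (right_child K)) (midpoint (midpoint a b) v)"
    by (intro cr_interp_edge_agree[OF tri nz mt _ _ nz' c]) (use Node.prems in \<open>auto simp: K\<close>)
  with c show ?case by (simp add: K)
qed simp

lemma cr_interp_zero_on:
  assumes z: "\<And>K x y. K \<in> leaves t K0 \<Longrightarrow> x \<noteq> y \<Longrightarrow> {x, y} \<subseteq> verts K \<Longrightarrow>
      closed_segment x y \<subseteq> S \<Longrightarrow> aff_app (\<phi> K) (midpoint x y) = 0"
    and "mid_compatible \<phi> t K0" "x \<noteq> y" "{x, y} \<subseteq> verts K0" "closed_segment x y \<subseteq> S"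
  shows "aff_app (cr_interp \<phi> t K0) (midpoint x y) = 0"
  using assms
proof (induction "size t" arbitrary: t K0 x y rule: less_induct)
  case less
  note prems = less.prems
  show ?case
  proof (cases t)
    case Leaf
    then show ?thesis using prems(1,3-5) by simp
  next
    case (Node l r)
    note sub = subtreesD[where t = t and K = K0]
    have mid: "x \<noteq> midpoint x y" "midpoint x y \<noteq> y"
      using prems(3) midpoint_eq_endpoint by metis+
    have seg: "closed_segment x (midpoint x y) \<subseteq> S" "closed_segment (midpoint x y) y \<subseteq> S"
      using prems(5) by (meson midpoint_in_closed_segment ends_in_segment subset_closed_segment subset_trans)+
    have IH: "aff_app (cr_interp \<phi> s K1) (midpoint p q) = 0"
      if s: "(s, K1) \<in> subtrees t K0" "p \<noteq> q" "{p, q} \<subseteq> verts K1" "closed_segment p q \<subseteq> S" for s K1 p q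
    proof (rule less.hyps[OF sub(1)[OF s(1)] _ sub(3)[OF s(1) prems(2)] s(2-4)])
      fix K x y assume "K \<in> leaves s K1" "x \<noteq> y" "{x, y} \<subseteq> verts K" "closed_segment x y \<subseteq> S"
      then show "aff_app (\<phi> K) (midpoint x y) = 0" using prems(1) sub(2)[OF s(1)] by blast
    qed
    from node_edge[OF prems(2)[unfolded Node] prems(3,4), folded Node] show ?thesis
    proof (elim disjE exE conjE)
      fix s K1
      assume "(s, K1) \<in> subtrees t K0" "{x, y} \<subseteq> verts K1"
        "aff_app (cr_interp \<phi> t K0) (midpoint x y) = aff_app (cr_interp \<phi> s K1) (midpoint x y)"
      then show ?thesis using IH prems(3,5) by simp
    next
      fix s1 K1 s2 K2
      assume s1: "(s1, K1) \<in> subtrees t K0" "{x, midpoint x y} \<subseteq> verts K1"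
        and s2: "(s2, K2) \<in> subtrees t K0" "{midpoint x y, y} \<subseteq> verts K2"
        and eq: "aff_app (cr_interp \<phi> t K0) (midpoint x y) =
         (1 / 2) *\<^sub>R (aff_app (cr_interp \<phi> s1 K1) (midpoint x (midpoint x y))
                   + aff_app (cr_interp \<phi> s2 K2) (midpoint (midpoint x y) y))"
      show ?thesis unfolding eq IH[OF s1(1) mid(1) s1(2) seg(1)] IH[OF s2(1) mid(2) s2(2) seg(2)]
        by simp
    qed
  qed
qed

section \<open>The Poincare inequality on a bisection tree\<close>

lemma norm_add_sq_le: "(norm (p + q))\<^sup>2 \<le> 2 * (norm p)\<^sup>2 + 2 * (norm q)\<^sup>2" for p q :: "'a::real_inner"
proof -
  have "2 * (norm p)\<^sup>2 + 2 * (norm q)\<^sup>2 - (norm (p + q))\<^sup>2 = (norm (p - q))\<^sup>2"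
    by (simp add: power2_norm_eq_inner inner_commute algebra_simps)
  then show ?thesis by (smt (verit) zero_le_power2)
qed

lemma norm_matrix_vector_le: "norm (A *v x) \<le> norm A * norm (x :: vec2)" for A :: "real ^ 2 ^ 2"
proof (rule power2_le_imp_le)
  have "(norm (A *v x))\<^sup>2 = (A $ 1 \<bullet> x)\<^sup>2 + (A $ 2 \<bullet> x)\<^sup>2"
    by (simp add: norm_sq_vec2 matrix_vector_mul_component)
  also have "\<dots> \<le> (norm (A $ 1) * norm x)\<^sup>2 + (norm (A $ 2) * norm x)\<^sup>2"
    using Cauchy_Schwarz_ineq2[of "A $ 1" x] Cauchy_Schwarz_ineq2[of "A $ 2" x]
    by (intro add_mono) (simp_all add: abs_le_square_iff[symmetric] abs_mult)
  also have "\<dots> = (norm A * norm x)\<^sup>2"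
    by (simp add: power_mult_distrib power2_norm_eq_inner inner_vec_def[of A] sum_2 algebra_simps)
  finally show "(norm (A *v x))\<^sup>2 \<le> (norm A * norm x)\<^sup>2" .
qed simp

lemma convex_hull_diameter:
  fixes S :: "'a::real_normed_vector set"
  assumes "\<And>p q. p \<in> S \<Longrightarrow> q \<in> S \<Longrightarrow> norm (p - q) \<le> d"
    and xy: "x \<in> convex hull S" "y \<in> convex hull S"
  shows "norm (x - y) \<le> d"
proof -
  have "S \<subseteq> cball q d" if "q \<in> S" for q
    using assms(1) that by (auto simp: dist_norm)
  then have "convex hull S \<subseteq> cball q d" if "q \<in> S" for q
    using that by (simp add: hull_minimal)
  then have "S \<subseteq> cball x d" using xy(1) by (metis mem_cball subsetD subsetI dist_commute)
  then have "convex hull S \<subseteq> cball x d" by (simp add: hull_minimal)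
  then show ?thesis using xy(2) by (auto simp: dist_norm)
qed

lemma spread_nonneg: "spread K \<ge> 0"
  by (cases K) simp

lemma triangle_diameter:
  assumes "x \<in> triangle K" "y \<in> triangle K"
  shows "(norm (x - y))\<^sup>2 \<le> 2 * spread K"
proof -
  obtain v a b where K: "K = (v, a, b)" by (cases K)
  have "(norm (a - b))\<^sup>2 \<le> 2 * spread K"
    using norm_add_sq_le[of "a - v" "v - b"] by (simp add: K norm_minus_commute)
  moreover have "(norm (a - v))\<^sup>2 \<le> 2 * spread K" "(norm (b - v))\<^sup>2 \<le> 2 * spread K"
    by (simp_all add: K)
  ultimately have "norm (p - q) \<le> sqrt (2 * spread K)" if "p \<in> verts K" "q \<in> verts K" for p q
    using that spread_nonneg[of K] by (auto simp: K norm_minus_commute intro!: real_le_rsqrt)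
  then have "norm (x - y) \<le> sqrt (2 * spread K)"
    using convex_hull_diameter[of "verts K"] assms by (simp add: triangle_eq_verts)
  then show ?thesis
    using spread_nonneg[of K] by (metis norm_ge_zero power_mono real_sqrt_pow2 mult_nonneg_nonneg zero_le_numeral)
qed

lemma compact_triangle: "compact (triangle K)" and convex_triangle: "convex (triangle K)"
  by (cases K; simp add: compact_convex_hull finite_imp_compact)+

lemma triangle_lmeasurable: "triangle K \<in> lmeasurable"
  by (simp add: lmeasurable_compact compact_triangle)

lemma triangle_bisect: "triangle K = triangle (left_child K) \<union> triangle (right_child K)"
proof -
  obtain v a b where K: "K = (v, a, b)" by (cases K)
  define m where "m = midpoint a b"
  have "m \<in> convex hull {v, a, b}"
    using convex_contains_segment[of "convex hull {v, a, b}"] midpoint_in_closed_segment[of a b]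
      hull_inc[of a "{v, a, b}"] hull_inc[of b "{v, a, b}"] unfolding m_def by blast
  then have "{m, v, a} \<subseteq> convex hull {v, a, b}" "{m, b, v} \<subseteq> convex hull {v, a, b}"
    by (simp_all add: hull_inc)
  then have 1: "convex hull {m, v, a} \<subseteq> convex hull {v, a, b}" "convex hull {m, b, v} \<subseteq> convex hull {v, a, b}"
    by (simp_all add: hull_minimal)
  have "x \<in> convex hull {m, v, a} \<union> convex hull {m, b, v}" if "x \<in> convex hull {v, a, b}" for x
  proof -
    obtain p q r where pqr: "0 \<le> p" "0 \<le> q" "0 \<le> r" "p + q + r = 1"
      "x = p *\<^sub>R v + q *\<^sub>R a + r *\<^sub>R b"
      using \<open>x \<in> convex hull {v, a, b}\<close> unfolding convex_hull_3 by blast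
    show ?thesis
    proof (cases "r \<le> q")
      case True
      have "x = (2 * r) *\<^sub>R m + p *\<^sub>R v + (q - r) *\<^sub>R a"
        unfolding pqr(5) m_def midpoint_def by (simp add: vec_eq_iff algebra_simps)
      then have "x \<in> convex hull {m, v, a}"
        unfolding convex_hull_3 using pqr True
        by (intro CollectI exI[of _ "2 * r"] exI[of _ p] exI[of _ "q - r"]) simp
      then show ?thesis ..
    next
      case False
      have "x = (2 * q) *\<^sub>R m + (r - q) *\<^sub>R b + p *\<^sub>R v"
        unfolding pqr(5) m_def midpoint_def by (simp add: vec_eq_iff algebra_simps)
      then have "x \<in> convex hull {m, b, v}"
        unfolding convex_hull_3 using pqr False
        by (intro CollectI exI[of _ "2 * q"] exI[of _ "r - q"] exI[of _ p]) simp
      then show ?thesis ..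
    qed
  qed
  with 1 show ?thesis by (auto simp: K m_def)
qed

lemma negligible_bisect: "negligible (triangle (left_child K) \<inter> triangle (right_child K))"
proof -
  have "measure lebesgue (triangle K) = measure lebesgue (triangle (left_child K))
      + measure lebesgue (triangle (right_child K))
      - measure lebesgue (triangle (left_child K) \<inter> triangle (right_child K))"
    unfolding triangle_bisect[of K]
    by (rule measure_Un3) (rule triangle_lmeasurable)+
  then have "measure lebesgue (triangle (left_child K) \<inter> triangle (right_child K)) = 0"
    by (simp add: measure_child)
  then show ?thesis
    using negligible_iff_measure0[OF fmeasurable.Int[OF triangle_lmeasurable triangle_lmeasurable]]
    by simp
qed

lemma triangle_subset_child:
  "triangle (left_child K) \<subseteq> triangle K" "triangle (right_child K) \<subseteq> triangle K"
  using triangle_bisect by blast+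

lemma leaves_subset_triangle: "K' \<in> leaves t K \<Longrightarrow> triangle K' \<subseteq> triangle K"
proof (induction t arbitrary: K)
  case (Node l r)
  from Node.prems have "K' \<in> leaves l (left_child K) \<or> K' \<in> leaves r (right_child K)"
    unfolding leaves.simps by (rule UnE) blast+
  then show ?case
  proof
    assume "K' \<in> leaves l (left_child K)"
    from order_trans[OF Node.IH(1)[OF this] triangle_subset_child(1)] show ?thesis .
  next
    assume "K' \<in> leaves r (right_child K)"
    from order_trans[OF Node.IH(2)[OF this] triangle_subset_child(2)] show ?thesis .
  qed
qed (unfold leaves.simps, simp)

text \<open>
  Piecewise functions are known only inside the triangles; the boundary of a convex set is a null set.
\<close>

lemma has_integral_interior_cong:
  assumes "\<And>x. x \<in> interior K \<Longrightarrow> f x = g x" "convex K"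
  shows "(f has_integral i) K \<longleftrightarrow> (g has_integral i) K"
proof (rule has_integral_spike_eq[OF negligible_convex_frontier[OF assms(2)]])
  fix x assume "x \<in> K - frontier K"
  then have "x \<in> interior K" using closure_subset[of K] unfolding frontier_def by blast
  then show "g x = f x" using assms(1) by simp
qed

lemma integrable_on_compact_continuous:
  fixes f :: "vec2 \<Rightarrow> real"
  assumes "continuous_on UNIV f" "compact K"
  shows "f integrable_on K"
proof -
  obtain a b where ab: "K \<subseteq> cbox a b"
    using bounded_subset_cbox_symmetric[OF compact_imp_bounded[OF assms(2)]] by blast
  have "f absolutely_integrable_on cbox a b"
    using absolutely_integrable_continuous continuous_on_subset assms(1) by blast
  then have "f absolutely_integrable_on K"
    by (rule set_integrable_subset) (use ab assms(2) lmeasurable_compact in auto)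
  then show ?thesis using set_lebesgue_integral_eq_integral(1) by blast
qed

lemma continuous_aff_app: "continuous_on S (aff_app F)"
  unfolding aff_app_def[abs_def]
  by (intro continuous_intros linear_continuous_on matrix_vector_mul_bounded_linear)

lemma has_integral_const_lmeasurable:
  fixes c :: real
  assumes "S \<in> lmeasurable"
  shows "((\<lambda>x. c) has_integral (measure lebesgue S * c)) S"
proof -
  have "((\<lambda>x::'a. 1::real) has_integral measure lebesgue S) S"
    using lmeasure_integral[OF assms] integrable_on_const[OF assms, of "1::real"]
    by (simp add: has_integral_iff)
  from has_integral_mult_left[OF this, of c] show ?thesis by simp
qed

primrec tree_sum :: "(ltriangle \<Rightarrow> real) \<Rightarrow> bisection_tree \<Rightarrow> ltriangle \<Rightarrow> real" where
  "tree_sum e Leaf K = e K"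
| "tree_sum e (Node l r) K = tree_sum e l (left_child K) + tree_sum e r (right_child K)"

lemma has_integral_tree_sum:
  assumes "\<And>K'. K' \<in> leaves t K \<Longrightarrow> (f has_integral e K') (triangle K')"
  shows "(f has_integral tree_sum e t K) (triangle K)"
  using assms
proof (induction t arbitrary: K)
  case (Node l r)
  have "(f has_integral tree_sum e l (left_child K)) (triangle (left_child K))"
    "(f has_integral tree_sum e r (right_child K)) (triangle (right_child K))"
    using Node by auto
  from has_integral_Un[OF this negligible_bisect] show ?case
    by (simp only: tree_sum.simps triangle_bisect[symmetric])
qed simp

definition aff_energy :: "affmap \<Rightarrow> vec2 set \<Rightarrow> real" where
  "aff_energy F K = measure lebesgue K * (norm (fst F))\<^sup>2"

lemma integrable_sq_dev:
  assumes "\<And>K' x. K' \<in> leaves t K \<Longrightarrow> x \<in> interior (triangle K') \<Longrightarrow> g x = aff_app (\<phi> K') x"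
  shows "(\<lambda>x. (norm (g x - aff_app F x))\<^sup>2) integrable_on triangle K"
proof -
  let ?f = "\<lambda>x. (norm (g x - aff_app F x))\<^sup>2"
  have "(?f has_integral integral (triangle K') ?f) (triangle K')" if K': "K' \<in> leaves t K" for K'
  proof -
    have "(\<lambda>x. (norm (aff_app (\<phi> K') x - aff_app F x))\<^sup>2) integrable_on triangle K'"
      by (intro integrable_on_compact_continuous continuous_intros continuous_aff_app compact_triangle)
    then obtain i where "((\<lambda>x. (norm (aff_app (\<phi> K') x - aff_app F x))\<^sup>2) has_integral i) (triangle K')"
      by blast
    then have "(?f has_integral i) (triangle K')"
      using has_integral_interior_cong[of "triangle K'" ?f] assms[OF K'] convex_triangle by simp
    then show ?thesis by (rule integrable_integral[OF has_integral_integrable])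
  qed
  from has_integral_tree_sum[OF this] show ?thesis by (rule has_integral_integrable)
qed

lemma norm_half_add_sq:
  fixes G H :: "'a::real_inner"
  shows "(norm ((1 / 2) *\<^sub>R (G + H)))\<^sup>2 = ((norm G)\<^sup>2 + (norm H)\<^sup>2) / 2 - (norm (G - H))\<^sup>2 / 4"
proof -
  have "(norm ((1 / 2) *\<^sub>R (G + H)))\<^sup>2 = (1 / 4) * ((G + H) \<bullet> (G + H))"
    unfolding norm_scaleR power_mult_distrib power2_norm_eq_inner by (simp add: power2_eq_square)
  also have "(G + H) \<bullet> (G + H) = 2 * ((norm G)\<^sup>2 + (norm H)\<^sup>2) - (norm (G - H))\<^sup>2"
    unfolding power2_norm_eq_inner inner_add_left inner_add_right inner_diff_left
      inner_diff_right inner_commute[of H G] by simp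
  finally show ?thesis by (simp add: field_simps)
qed

lemma aff_app_sq_le_of_zero:
  assumes F: "\<And>x. fst D *v (x - z) = aff_app D x" and x: "x \<in> triangle K1" and z: "z \<in> triangle K1"
    and D: "(norm (fst D))\<^sup>2 = d / 4"
  shows "(norm (aff_app D x))\<^sup>2 \<le> 2 * spread K1 * (d / 4)"
proof -
  have "(norm (aff_app D x))\<^sup>2 \<le> (norm (fst D) * norm (x - z))\<^sup>2"
    using norm_matrix_vector_le[of "fst D" "x - z"] F[of x] by (simp add: power_mono)
  also have "\<dots> \<le> (d / 4) * (2 * spread K1)"
    unfolding power_mult_distrib D
    by (rule mult_left_mono[OF triangle_diameter[OF x z]]) (use D in \<open>metis zero_le_power2\<close>)
  finally show ?thesis by (simp add: mult_ac)
qed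

text \<open>
  At a node the gradient of the interpolant differs from the gradient on each child by half the jump
  \<open>fst F1 - fst F2\<close>, and the energy lost there is exactly the area times the square of this
  difference; this is why the loss of energy can stand on the right-hand side. Using \<open>\<parallel>a + b\<parallel>\<^sup>2 \<le> 2 \<parallel>a\<parallel>\<^sup>2 + 2 \<parallel>b\<parallel>\<^sup>2\<close> doubles the constant of the children,
  which is compensated because \<open>spread\<close> is halved.
\<close>

lemma tree_poincare:
  assumes "\<And>K' x. K' \<in> leaves t K \<Longrightarrow> x \<in> interior (triangle K') \<Longrightarrow> g x = aff_app (\<phi> K') x"
    and "mid_compatible \<phi> t K"
  shows "integral (triangle K) (\<lambda>x. (norm (g x - aff_app (cr_interp \<phi> t K) x))\<^sup>2)
    \<le> 2 * spread K * (tree_sum (\<lambda>K. aff_energy (\<phi> K) (triangle K)) t K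
         - aff_energy (cr_interp \<phi> t K) (triangle K))"
  using assms
proof (induction t arbitrary: K)
  case Leaf
  have "((\<lambda>x. (norm (g x - aff_app (\<phi> K) x))\<^sup>2) has_integral 0) (triangle K)"
    using has_integral_interior_cong[of "triangle K" "\<lambda>x. (norm (g x - aff_app (\<phi> K) x))\<^sup>2" "\<lambda>x. 0"]
      Leaf(1) convex_triangle by simp
  then show ?case by (simp add: integral_unique)
next
  case (Node l r)
  obtain v a b where K: "K = (v, a, b)" by (cases K)
  define m where "m = midpoint a b"
  define K1 K2 where "K1 = left_child K" and "K2 = right_child K"
  define F1 F2 where "F1 = cr_interp \<phi> l K1" and "F2 = cr_interp \<phi> r K2"
  define I where "I = cr_interp \<phi> (Node l r) K"
  define M S where "M = measure lebesgue (triangle K)" and "S = spread K"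
  define d where "d = (norm (fst F1 - fst F2))\<^sup>2"
  define E1 E2 where "E1 = tree_sum (\<lambda>K. aff_energy (\<phi> K) (triangle K)) l K1"
    and "E2 = tree_sum (\<lambda>K. aff_energy (\<phi> K) (triangle K)) r K2"
  have I: "I = bisect_aff K F1 F2" by (simp add: I_def F1_def F2_def K1_def K2_def)
  have fstI: "fst I = (1 / 2) *\<^sub>R (fst F1 + fst F2)" by (simp add: I fst_bisect_aff)
  have eq: "aff_app F1 (midpoint (midpoint a b) v) = aff_app F2 (midpoint (midpoint a b) v)"
    using Node.prems(2) by (simp add: F1_def F2_def K1_def K2_def K)
  have z1: "aff_app (F1 - I) (midpoint v a) = 0" and z2: "aff_app (F2 - I) (midpoint v b) = 0"
    using bisect_aff_edges(1,2)[OF eq] by (simp_all add: I K aff_app_diff)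
  have pw: "\<And>K' x. K' \<in> leaves l K1 \<Longrightarrow> x \<in> interior (triangle K') \<Longrightarrow> g x = aff_app (\<phi> K') x"
      "\<And>K' x. K' \<in> leaves r K2 \<Longrightarrow> x \<in> interior (triangle K') \<Longrightarrow> g x = aff_app (\<phi> K') x"
    using Node.prems(1) by (auto simp: K1_def K2_def)
  have IH: "integral (triangle K1) (\<lambda>x. (norm (g x - aff_app F1 x))\<^sup>2)
      \<le> 2 * (S / 2) * (E1 - M / 2 * (norm (fst F1))\<^sup>2)"
    "integral (triangle K2) (\<lambda>x. (norm (g x - aff_app F2 x))\<^sup>2)
      \<le> 2 * (S / 2) * (E2 - M / 2 * (norm (fst F2))\<^sup>2)"
  proof -
    have c: "mid_compatible \<phi> l K1" "mid_compatible \<phi> r K2"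
      using Node.prems(2) by (simp_all add: K1_def K2_def)
    have "integral (triangle K1) (\<lambda>x. (norm (g x - aff_app F1 x))\<^sup>2)
        \<le> 2 * spread K1 * (E1 - aff_energy F1 (triangle K1))"
      unfolding E1_def F1_def by (rule Node.IH(1)[OF _ c(1)]) (erule (1) pw(1))
    moreover have "integral (triangle K2) (\<lambda>x. (norm (g x - aff_app F2 x))\<^sup>2)
        \<le> 2 * spread K2 * (E2 - aff_energy F2 (triangle K2))"
      unfolding E2_def F2_def by (rule Node.IH(2)[OF _ c(2)]) (erule (1) pw(2))
    ultimately show "integral (triangle K1) (\<lambda>x. (norm (g x - aff_app F1 x))\<^sup>2)
        \<le> 2 * (S / 2) * (E1 - M / 2 * (norm (fst F1))\<^sup>2)"
      "integral (triangle K2) (\<lambda>x. (norm (g x - aff_app F2 x))\<^sup>2)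
        \<le> 2 * (S / 2) * (E2 - M / 2 * (norm (fst F2))\<^sup>2)"
      by (simp_all only: K1_def K2_def S_def M_def aff_energy_def spread_child measure_child)
  qed
  have Sc: "spread K1 = S / 2" "spread K2 = S / 2" by (simp_all add: K1_def K2_def S_def spread_child)
  have Mc: "measure lebesgue (triangle K1) = M / 2" "measure lebesgue (triangle K2) = M / 2"
    by (simp_all add: K1_def K2_def M_def measure_child)
  have mid: "midpoint v a \<in> triangle K1" "midpoint v b \<in> triangle K2"
  proof -
    have "midpoint p q \<in> convex hull V" if "p \<in> V" "q \<in> V" for p q :: vec2 and V
      using convex_contains_segment[of "convex hull V"] midpoint_in_closed_segment[of p q]
        hull_inc[of p V] hull_inc[of q V] that by (meson convex_convex_hull subsetD)
    then show "midpoint v a \<in> triangle K1" "midpoint v b \<in> triangle K2"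
      by (simp_all add: K1_def K2_def K)
  qed
  have nd: "(norm (fst (F1 - I)))\<^sup>2 = d / 4" "(norm (fst (F2 - I)))\<^sup>2 = d / 4"
  proof -
    have "fst (F1 - I) = (1 / 2) *\<^sub>R (fst F1 - fst F2)" "fst (F2 - I) = (1 / 2) *\<^sub>R (fst F2 - fst F1)"
      unfolding fst_diff fstI by (simp_all add: vec_eq_iff field_simps)
    then show "(norm (fst (F1 - I)))\<^sup>2 = d / 4" "(norm (fst (F2 - I)))\<^sup>2 = d / 4"
      by (simp_all add: d_def power_divide norm_minus_commute)
  qed
  have dev: "(norm (aff_app (F1 - I) x))\<^sup>2 \<le> 2 * spread K1 * (d / 4)" if "x \<in> triangle K1" for x
    by (rule aff_app_sq_le_of_zero[OF _ that mid(1) nd(1)]) (simp only: aff_app_minus_point[symmetric] z1 diff_zero)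
  have dev': "(norm (aff_app (F2 - I) x))\<^sup>2 \<le> 2 * spread K2 * (d / 4)" if "x \<in> triangle K2" for x
    by (rule aff_app_sq_le_of_zero[OF _ that mid(2) nd(2)]) (simp only: aff_app_minus_point[symmetric] z2 diff_zero)
  have split: "integral (triangle J) (\<lambda>x. (norm (g x - aff_app I x))\<^sup>2)
      \<le> 2 * integral (triangle J) (\<lambda>x. (norm (g x - aff_app F x))\<^sup>2) + (M / 2) * (S * d / 2)"
    if J: "measure lebesgue (triangle J) = M / 2" "spread J = S / 2"
      and D: "\<And>x. x \<in> triangle J \<Longrightarrow> (norm (aff_app (F - I) x))\<^sup>2 \<le> 2 * spread J * (d / 4)"
      and int: "\<And>F. (\<lambda>x. (norm (g x - aff_app F x))\<^sup>2) integrable_on triangle J" for J F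
  proof -
    have c: "((\<lambda>x. S * d / 2) has_integral (M / 2) * (S * d / 2)) (triangle J)"
      using has_integral_const_lmeasurable[OF triangle_lmeasurable[of J], of "S * d / 2"] J(1) by simp
    have h: "((\<lambda>x. 2 * (norm (g x - aff_app F x))\<^sup>2 + S * d / 2) has_integral
        2 * integral (triangle J) (\<lambda>x. (norm (g x - aff_app F x))\<^sup>2) + (M / 2) * (S * d / 2)) (triangle J)"
      by (rule has_integral_add[OF has_integral_mult_right[OF integrable_integral[OF int]] c])
    show ?thesis
    proof (rule has_integral_le[OF integrable_integral[OF int[of I]] h])
      fix x assume x: "x \<in> triangle J"
      have "(norm (g x - aff_app I x))\<^sup>2
          = (norm ((g x - aff_app F x) + aff_app (F - I) x))\<^sup>2"
        by (simp add: aff_app_diff)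
      also have "\<dots> \<le> 2 * (norm (g x - aff_app F x))\<^sup>2 + 2 * (norm (aff_app (F - I) x))\<^sup>2"
        by (rule norm_add_sq_le)
      also have "\<dots> \<le> 2 * (norm (g x - aff_app F x))\<^sup>2 + S * d / 2"
        using D[OF x] unfolding J(2) by simp
      finally show "(norm (g x - aff_app I x))\<^sup>2 \<le> 2 * (norm (g x - aff_app F x))\<^sup>2 + S * d / 2" .
    qed
  qed
  have int1: "(\<lambda>x. (norm (g x - aff_app F x))\<^sup>2) integrable_on triangle K1" for F
    by (rule integrable_sq_dev[OF pw(1)])
  have int2: "(\<lambda>x. (norm (g x - aff_app F x))\<^sup>2) integrable_on triangle K2" for F
    by (rule integrable_sq_dev[OF pw(2)])
  have tri: "triangle K = triangle K1 \<union> triangle K2" unfolding K1_def K2_def by (rule triangle_bisect)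
  have "integral (triangle K) (\<lambda>x. (norm (g x - aff_app I x))\<^sup>2) =
      integral (triangle K1) (\<lambda>x. (norm (g x - aff_app I x))\<^sup>2) +
      integral (triangle K2) (\<lambda>x. (norm (g x - aff_app I x))\<^sup>2)"
    unfolding tri
    by (rule integral_unique[OF has_integral_Un[OF int1[THEN integrable_integral]
          int2[THEN integrable_integral]]]) (simp add: K1_def K2_def negligible_bisect)
  also have "\<dots> \<le> (2 * (2 * (S / 2) * (E1 - M / 2 * (norm (fst F1))\<^sup>2)) + (M / 2) * (S * d / 2))
      + (2 * (2 * (S / 2) * (E2 - M / 2 * (norm (fst F2))\<^sup>2)) + (M / 2) * (S * d / 2))"
    using split[OF Mc(1) Sc(1) dev int1] split[OF Mc(2) Sc(2) dev' int2] IH by linarith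
  also have "\<dots> = 2 * S * (E1 + E2 - M * (norm (fst I))\<^sup>2)"
    unfolding fstI norm_half_add_sq d_def by (simp add: field_simps)
  finally show ?case
    by (simp add: I_def S_def E1_def E2_def K1_def K2_def M_def aff_energy_def)
qed

section \<open>The Friedrichs inequality across two meshes\<close>

lemma LINT_lebesgue_on_nonneg:
  fixes f :: "vec2 \<Rightarrow> real"
  assumes "\<And>x. 0 \<le> f x" "f integrable_on S" "S \<in> sets lebesgue"
  shows "(LINT x|lebesgue_on S. f x) = integral S f" "integrable (lebesgue_on S) f"
proof -
  have "f absolutely_integrable_on S" using assms absolutely_integrable_on_iff_nonneg by blast
  then show i: "integrable (lebesgue_on S) f"
    using absolutely_integrable_imp_integrable assms(3) by blast
  show "(LINT x|lebesgue_on S. f x) = integral S f"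
    by (rule lebesgue_integral_eq_integral[OF i assms(3)])
qed

lemma polygonal_frontier_negligible:
  assumes "polygonal_domain \<Omega>"
  shows "negligible (frontier \<Omega>)"
proof -
  obtain S where S: "finite S" "frontier \<Omega> = (\<Union>(a, b)\<in>S. closed_segment a b)"
    using assms by (auto simp: polygonal_domain_def)
  have "negligible (closed_segment a b)" for a b :: vec2
    by (simp add: negligible_convex_interior interior_closed_segment_ge2)
  then have "negligible (\<Union>((\<lambda>(a, b). closed_segment a b) ` S))"
    using S(1) by (intro negligible_Union) auto
  then show ?thesis using S(2) by simp
qed

lemma has_integral_closure_iff:
  fixes f :: "vec2 \<Rightarrow> real"
  assumes "polygonal_domain \<Omega>"
  shows "(f has_integral i) (closure \<Omega>) \<longleftrightarrow> (f has_integral i) \<Omega>"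
proof (rule has_integral_spike_set_eq)
  have "{x \<in> closure \<Omega> - \<Omega>. f x \<noteq> 0} \<subseteq> frontier \<Omega>"
    using assms by (auto simp: frontier_def polygonal_domain_def interior_open)
  then show "negligible {x \<in> closure \<Omega> - \<Omega>. f x \<noteq> 0}"
    using polygonal_frontier_negligible[OF assms] negligible_subset by blast
  have "{x \<in> \<Omega> - closure \<Omega>. f x \<noteq> 0} = {}" using closure_subset by auto
  then show "negligible {x \<in> \<Omega> - closure \<Omega>. f x \<noteq> 0}" by (simp only: negligible_empty)
qed

lemma triangulation_ofD:
  assumes "triangulation_of \<Omega> T"
  shows "triangulation T" "finite T" "\<And>K. K \<in> T \<Longrightarrow> 2 simplex K" "\<Union>T = closure \<Omega>"
  using assms by (auto simp: triangulation_of_def triangulation_def)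

lemma mesh_has_integral:
  fixes f :: "vec2 \<Rightarrow> real"
  assumes T: "triangulation_of \<Omega> T" and i: "\<And>K. K \<in> T \<Longrightarrow> (f has_integral i K) K"
  shows "(f has_integral sum i T) (closure \<Omega>)"
proof -
  note T' = triangulation_ofD[OF T]
  have "negligible (K \<inter> K')" if "K \<in> T" "K' \<in> T" "K \<noteq> K'" for K K'
  proof -
    have "interior K \<inter> K' = {}"
      using triangulation_interior_eq[OF T'(1) that(1,2) T'(3)[OF that(1)] T'(3)[OF that(2)]] that(3)
      by blast
    then have "K \<inter> K' \<subseteq> frontier K"
      using closure_subset[of K] unfolding frontier_def by blast
    then show ?thesis
      using negligible_convex_frontier[OF convex_simplex[OF T'(3)[OF that(1)]]] negligible_subset
      by blast
  qed
  then have "(f has_integral sum i T) (\<Union>T)"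
    by (intro has_integral_Union T'(2) i) (auto simp: pairwise_def)
  then show ?thesis using T'(4) by simp
qed

lemma measure_2_simplex_pos: "2 simplex K \<Longrightarrow> measure lebesgue (K :: vec2 set) > 0"
  unfolding simplex_2_iff by (auto simp: measure_triangle)

lemma has_integral_grad_sq:
  assumes "2 simplex K" "affine_inside g K"
  shows "((\<lambda>x. (norm (grad g x))\<^sup>2) has_integral aff_energy (local_aff g K) K) K"
proof -
  have "((\<lambda>x. (norm (fst (local_aff g K)))\<^sup>2) has_integral aff_energy (local_aff g K) K) K"
    unfolding aff_energy_def
    using has_integral_const_lmeasurable lmeasurable_compact compact_simplex[OF assms(1)] by blast
  then show ?thesis
    using has_integral_interior_cong[of K "\<lambda>x. (norm (grad g x))\<^sup>2"] grad_affine_inside[OF assms(2)]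
      convex_simplex[OF assms(1)] by simp
qed

lemma LINT_grad_sq:
  assumes "2 simplex K" "affine_inside g K"
  shows "(LINT x|lebesgue_on K. (norm (grad g x))\<^sup>2) = aff_energy (local_aff g K) K"
  using LINT_lebesgue_on_nonneg(1)[of "\<lambda>x. (norm (grad g x))\<^sup>2" K] has_integral_grad_sq[OF assms]
    compact_simplex[OF assms(1)] lmeasurable_compact[of K]
  by (metis fmeasurableD has_integral_integrable integral_unique zero_le_power2)

lemma aff_energy_nonneg: "aff_energy F K \<ge> 0"
  by (simp add: aff_energy_def)

lemma energy_norm_sq:
  assumes "\<And>K. K \<in> T \<Longrightarrow> 2 simplex K" "\<And>K. K \<in> T \<Longrightarrow> affine_inside g K"
  shows "(energy_norm T g)\<^sup>2 = (\<Sum>K\<in>T. aff_energy (local_aff g K) K)"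
  unfolding energy_norm_def
  using LINT_grad_sq assms by (simp add: sum_nonneg aff_energy_nonneg)

text \<open>
  The Crouzeix-Raviart conditions, expressed for the family of affine pieces rather than for a function.
\<close>

definition cr_data :: "vec2 set \<Rightarrow> vec2 set set \<Rightarrow> (vec2 set \<Rightarrow> affmap) \<Rightarrow> bool" where
  "cr_data \<Omega> T \<psi> \<longleftrightarrow>
     (\<forall>K\<in>T. \<forall>K'\<in>T. \<forall>x y. closed_segment x y edge_of K \<longrightarrow> closed_segment x y edge_of K' \<longrightarrow>
        aff_app (\<psi> K) (midpoint x y) = aff_app (\<psi> K') (midpoint x y)) \<and>
     (\<forall>K\<in>T. \<forall>x y. closed_segment x y edge_of K \<longrightarrow> closed_segment x y \<subseteq> frontier \<Omega> \<longrightarrow>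
        aff_app (\<psi> K) (midpoint x y) = 0)"

lemma Vh_affine_inside: "v \<in> Vh \<Omega> T \<Longrightarrow> K \<in> T \<Longrightarrow> affine_inside v K"
  unfolding Vh_def affine_inside_def aff_app_def by fastforce

lemma cr_data_of_Vh:
  assumes v: "v \<in> Vh \<Omega> T" and T: "triangulation_of \<Omega> T"
  shows "cr_data \<Omega> T (local_aff v)"
proof -
  have tr: "side_trace K v (midpoint x y) = aff_app (local_aff v K) (midpoint x y)"
    if "K \<in> T" "closed_segment x y edge_of K" for K x y
  proof (rule side_trace_affine_inside[OF triangulation_ofD(3)[OF T that(1)] _
        Vh_affine_inside[OF v that(1)]])
    show "midpoint x y \<in> K"
      using edge_of_imp_subset[OF that(2)] midpoint_in_closed_segment by blast
  qed
  have z: "aff_app (local_aff v K) (midpoint x y) = 0"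
    if "K \<in> T" "closed_segment x y edge_of K" "closed_segment x y \<subseteq> frontier \<Omega>" for K x y
  proof -
    have "side_trace K v (midpoint x y) = 0" using v that unfolding Vh_def by blast
    then show ?thesis using tr[OF that(1,2)] by simp
  qed
  have "aff_app (local_aff v K) (midpoint x y) = aff_app (local_aff v K') (midpoint x y)"
    if K: "K \<in> T" "K' \<in> T" "closed_segment x y edge_of K" "closed_segment x y edge_of K'" for K K' x y
  proof (cases "closed_segment x y \<subseteq> frontier \<Omega>")
    case True
    then show ?thesis using z K by simp
  next
    case False
    then have "side_trace K v (midpoint x y) = side_trace K' v (midpoint x y)"
      using v K unfolding Vh_def by blast
    then show ?thesis using tr K by simp
  qed
  with z show ?thesis unfolding cr_data_def by blast
qed

text \<open>
  The constant may depend on the mesh in an arbitrary way, since the lemma serves for the initial mesh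
  only. The set \<open>R\<close> collects the triangles on which a bound is available. It contains the triangles with
  a boundary edge and spreads through common edges; its complement would be a family of triangles
  without boundary edge.
\<close>

lemma cr_sup_bound:
  assumes \<Omega>: "open \<Omega>" and T: "triangulation_of \<Omega> T"
  shows "\<exists>C\<ge>0. \<forall>\<psi>. cr_data \<Omega> T \<psi> \<longrightarrow>
    (\<forall>K\<in>T. \<forall>x\<in>K. norm (aff_app (\<psi> K) x) \<le> C * sqrt (\<Sum>K\<in>T. aff_energy (\<psi> K) K))"
proof -
  note T' = triangulation_ofD[OF T]
  define Q where "Q \<psi> = sqrt (\<Sum>K\<in>T. aff_energy (\<psi> K) K)" for \<psi> :: "vec2 set \<Rightarrow> affmap"
  have Q: "Q \<psi> \<ge> 0" for \<psi> by (simp add: Q_def sum_nonneg aff_energy_nonneg)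
  define D where "D K = diameter K / sqrt (measure lebesgue K)" for K :: "vec2 set"
  have dev: "norm (aff_app (\<psi> K) x) \<le> norm (aff_app (\<psi> K) y) + D K * Q \<psi>"
    if K: "K \<in> T" and xy: "x \<in> K" "y \<in> K" for \<psi> K x y
  proof -
    have m: "measure lebesgue K > 0" using measure_2_simplex_pos T'(3) K by blast
    have "aff_energy (\<psi> K) K \<le> (\<Sum>K\<in>T. aff_energy (\<psi> K) K)"
      using K T'(2) by (intro member_le_sum aff_energy_nonneg) auto
    then have "sqrt (measure lebesgue K * (norm (fst (\<psi> K)))\<^sup>2) \<le> Q \<psi>"
      unfolding Q_def aff_energy_def by (rule real_sqrt_le_mono)
    then have G: "norm (fst (\<psi> K)) \<le> Q \<psi> / sqrt (measure lebesgue K)"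
      using m by (simp add: real_sqrt_mult field_simps)
    have "norm (x - y) \<le> diameter K"
      using diameter_bounded_bound[OF compact_imp_bounded[OF compact_simplex[OF T'(3)[OF K]]] xy]
      by (simp add: dist_norm)
    then have "norm (fst (\<psi> K)) * norm (x - y) \<le> (Q \<psi> / sqrt (measure lebesgue K)) * diameter K"
      using G Q[of \<psi>] m by (intro mult_mono) auto
    moreover have "norm (aff_app (\<psi> K) x - aff_app (\<psi> K) y) \<le> norm (fst (\<psi> K)) * norm (x - y)"
      unfolding aff_app_minus_point by (rule norm_matrix_vector_le)
    ultimately have "norm (aff_app (\<psi> K) x - aff_app (\<psi> K) y) \<le> D K * Q \<psi>"
      by (simp add: D_def mult.commute)
    then show ?thesis using norm_triangle_sub[of "aff_app (\<psi> K) x" "aff_app (\<psi> K) y"] by linarith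
  qed
  define R where
    "R = {K \<in> T. \<exists>C. \<forall>\<psi>. cr_data \<Omega> T \<psi> \<longrightarrow> (\<forall>x\<in>K. norm (aff_app (\<psi> K) x) \<le> C * Q \<psi>)}"
  have seg: "\<exists>x y. E = closed_segment x y \<and> midpoint x y \<in> K" if K: "K \<in> T" and E: "E edge_of K" for K E
  proof -
    obtain x y where "E = closed_segment x y"
      using edge_of_2_simplex_segment[OF T'(3)[OF K] E] by blast
    then show ?thesis
      using edge_of_imp_subset[OF E] midpoint_in_closed_segment[of x y] by blast
  qed
  have bd: "K \<in> R" if K: "K \<in> T" "E edge_of K" "E \<subseteq> frontier \<Omega>" for K E
  proof -
    obtain x y where xy: "E = closed_segment x y" "midpoint x y \<in> K" using seg K by blast
    have "norm (aff_app (\<psi> K) z) \<le> D K * Q \<psi>" if "cr_data \<Omega> T \<psi>" "z \<in> K" for \<psi> z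
    proof -
      have "aff_app (\<psi> K) (midpoint x y) = 0" using that(1) K xy(1) unfolding cr_data_def by blast
      then show ?thesis using dev[OF K(1) that(2) xy(2), of \<psi>] by simp
    qed
    then show ?thesis unfolding R_def using K(1) by blast
  qed
  have nb: "K \<in> R" if K: "K \<in> T" "K' \<in> R" "E edge_of K" "E edge_of K'" for K K' E
  proof -
    have K': "K' \<in> T" using K(2) by (simp add: R_def)
    obtain C where C: "\<And>\<psi> x. cr_data \<Omega> T \<psi> \<Longrightarrow> x \<in> K' \<Longrightarrow> norm (aff_app (\<psi> K') x) \<le> C * Q \<psi>"
      using K(2) unfolding R_def by blast
    obtain x y where xy: "E = closed_segment x y" "midpoint x y \<in> K" using seg K by blast
    have mK': "midpoint x y \<in> K'"
      using edge_of_imp_subset[OF K(4)] xy(1) midpoint_in_closed_segment by blast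
    have "norm (aff_app (\<psi> K) z) \<le> (C + D K) * Q \<psi>" if c: "cr_data \<Omega> T \<psi>" and "z \<in> K" for \<psi> z
    proof -
      have "aff_app (\<psi> K) (midpoint x y) = aff_app (\<psi> K') (midpoint x y)"
        using c K K' xy(1) unfolding cr_data_def by blast
      then show ?thesis
        using dev[OF K(1) \<open>z \<in> K\<close> xy(2), of \<psi>] C[OF c mK'] by (simp add: distrib_right)
    qed
    then show ?thesis unfolding R_def using K(1) by blast
  qed
  have "T - R = {}"
  proof (rule closed_mesh_impossible[OF T'(1) T'(3)])
    fix K E assume K: "K \<in> T - R" "E edge_of K"
    then have "\<not> E \<subseteq> frontier \<Omega>" using bd by blast
    then obtain K' where K': "K' \<in> T" "K' \<noteq> K" "E edge_of K'"
      using triangulation_neighbour_exists[OF \<Omega> T] K by blast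
    then show "\<exists>K'\<in>T - R. K' \<noteq> K \<and> E edge_of K'" using nb K by blast
  qed auto
  then have "\<forall>K\<in>T. \<exists>C. \<forall>\<psi>. cr_data \<Omega> T \<psi> \<longrightarrow> (\<forall>x\<in>K. norm (aff_app (\<psi> K) x) \<le> C * Q \<psi>)"
    unfolding R_def by blast
  then obtain C where C: "\<And>K \<psi> x. K \<in> T \<Longrightarrow> cr_data \<Omega> T \<psi> \<Longrightarrow> x \<in> K \<Longrightarrow>
      norm (aff_app (\<psi> K) x) \<le> C K * Q \<psi>"
    by metis
  define B where "B = (\<Sum>K\<in>T. \<bar>C K\<bar>)"
  have "norm (aff_app (\<psi> K) x) \<le> B * Q \<psi>" if "K \<in> T" "cr_data \<Omega> T \<psi>" "x \<in> K" for K \<psi> x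
  proof -
    have "C K \<le> B"
      unfolding B_def using member_le_sum[of K T "\<lambda>K. \<bar>C K\<bar>"] that(1) T'(2) by fastforce
    then show ?thesis using C[OF that] Q[of \<psi>] mult_right_mono by (meson order_trans)
  qed
  moreover have "B \<ge> 0" by (simp add: B_def sum_nonneg)
  ultimately show ?thesis unfolding Q_def by blast
qed

lemma edge_matching_of_cr_data:
  assumes "cr_data \<Omega> (mesh N) \<psi>" "\<And>K. K \<in> N \<Longrightarrow> tri_det K \<noteq> 0"
  shows "edge_matching N (\<lambda>K. \<psi> (triangle K))"
  unfolding edge_matching_def
proof (intro ballI allI impI)
  fix K K' x y
  assume K: "K \<in> N" "K' \<in> N" and xy: "x \<noteq> y" "{x, y} \<subseteq> verts K" "{x, y} \<subseteq> verts K'"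
  have "closed_segment x y edge_of triangle K" "closed_segment x y edge_of triangle K'"
    using edge_of_ltriangle assms(2) K xy by blast+
  then show "aff_app (\<psi> (triangle K)) (midpoint x y) = aff_app (\<psi> (triangle K')) (midpoint x y)"
    using assms(1) K unfolding cr_data_def mesh_def by blast
qed

lemma mesh_triangle:
  assumes "triangulation_of \<Omega> (mesh L)" "K \<in> L"
  shows "2 simplex triangle K" "tri_det K \<noteq> 0" "triangle K \<in> mesh L"
proof -
  show m: "triangle K \<in> mesh L" using assms(2) by (simp add: mesh_def)
  show "2 simplex triangle K" using triangulation_ofD(3)[OF assms(1) m] .
  then show "tri_det K \<noteq> 0" by (simp add: simplex_iff_tri_det)
qed

lemma spread_pos:
  assumes "tri_det K \<noteq> 0"
  shows "spread K > 0"
proof -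
  obtain v a b where K: "K = (v, a, b)" by (cases K)
  have "\<bar>tri_det K\<bar> \<le> norm (a - v) * norm (b - v)" by (simp add: K cross2_norm_le)
  then have "norm (a - v) * norm (b - v) > 0" using assms by linarith
  then have "norm (a - v) > 0" by (metis mult_eq_0_iff norm_ge_zero order_less_le)
  then show ?thesis by (simp add: K add_pos_nonneg)
qed

text \<open>
  Both functions are interpolated along the same trees, from the initial mesh to the fine mesh. For the
  coarse function this is harmless: below a triangle of the coarse mesh it is a single affine
  function, which is reproduced. By linearity the interpolant of the difference satisfies the
  Crouzeix-Raviart conditions on the initial mesh.
\<close>

lemma friedrichs_two_meshes:
  assumes poly: "polygonal_domain \<Omega>" and L0: "initial_mesh \<Omega> L0"
  shows "\<exists>C\<ge>0. \<forall>L\<in>admissible_refinements \<Omega> L0. \<forall>L'\<in>admissible_refinements \<Omega> L.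
    \<forall>v\<in>Vh \<Omega> (mesh L). \<forall>v'\<in>Vh \<Omega> (mesh L').
      integral \<Omega> (\<lambda>x. (norm (v' x - v x))\<^sup>2) \<le> C * (energy_norm (mesh L') (\<lambda>x. v' x - v x))\<^sup>2"
proof -
  define T0 where "T0 = mesh L0"
  have T0: "triangulation_of \<Omega> (mesh L0)" using L0 by (simp add: initial_mesh_def)
  note T0' = triangulation_ofD[OF T0, folded T0_def]
  have \<Omega>: "open \<Omega>"
    using poly by (simp_all add: polygonal_domain_def)
  define lab where "lab = inv_into L0 triangle"
  have lab: "lab K \<in> L0" "triangle (lab K) = K" if "K \<in> T0" for K
    using that inv_into_into[of K triangle L0] f_inv_into_f[of K triangle L0]
    by (auto simp: lab_def T0_def mesh_def)
  obtain C where C: "C \<ge> 0" "\<And>\<psi> K x. cr_data \<Omega> T0 \<psi> \<Longrightarrow> K \<in> T0 \<Longrightarrow> x \<in> K \<Longrightarrow>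
      norm (aff_app (\<psi> K) x) \<le> C * sqrt (\<Sum>K\<in>T0. aff_energy (\<psi> K) K)"
    using cr_sup_bound[OF \<Omega> T0, folded T0_def] by blast
  define CF where "CF = (\<Sum>K\<in>T0. 4 * spread (lab K) + 2 * (measure lebesgue K * C\<^sup>2))"
  have "integral \<Omega> (\<lambda>x. (norm (v' x - v x))\<^sup>2) \<le> CF * (energy_norm (mesh L') (\<lambda>x. v' x - v x))\<^sup>2"
    if L: "L \<in> admissible_refinements \<Omega> L0" and L': "L' \<in> admissible_refinements \<Omega> L"
      and v: "v \<in> Vh \<Omega> (mesh L)" and v': "v' \<in> Vh \<Omega> (mesh L')" for L L' v v'
  proof -
    have tL: "triangulation_of \<Omega> (mesh L)" and tL': "triangulation_of \<Omega> (mesh L')"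
      using L L' by (auto simp: admissible_refinements_def)
    obtain t where t: "L = (\<Union>K\<in>L0. leaves (t K) K)"
      using L nvb_forest unfolding admissible_refinements_def by blast
    obtain s where s: "L' = (\<Union>K\<in>L. leaves (s K) K)"
      using L' nvb_forest unfolding admissible_refinements_def by blast
    define tt where "tt K = graft (t K) s K" for K
    have lt: "leaves (t K) K \<subseteq> L" if "K \<in> L0" for K using that t by blast
    have lt': "leaves (tt K) K \<subseteq> L'" if "K \<in> L0" for K
      using lt[OF that] s unfolding tt_def leaves_graft by blast
    note nzL = mesh_triangle(2)[OF tL] and nzL' = mesh_triangle(2)[OF tL']
      and nz0 = mesh_triangle(2)[OF T0]
    define g where "g x = v' x - v x" for x
    define \<phi>' \<phi> where "\<phi>' K = local_aff v' (triangle K)" and "\<phi> K = local_aff v (triangle K)"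
      for K :: ltriangle
    define \<gamma> where "\<gamma> K = local_aff g (triangle K)" for K :: ltriangle
    note cd = cr_data_of_Vh[OF v tL] and cd' = cr_data_of_Vh[OF v' tL']
    have m: "edge_matching L \<phi>"
      using edge_matching_of_cr_data[OF cd nzL] unfolding \<phi>_def .
    have m': "edge_matching L' \<phi>'"
      using edge_matching_of_cr_data[OF cd' nzL'] unfolding \<phi>'_def .
    \<comment> \<open>A triangle below \<open>K'\<close> in the fine mesh inherits the affine piece of \<open>v\<close> on \<open>K'\<close>.\<close>
    have sub: "\<phi> K'' = \<phi> K'" "affine_inside v (triangle K'')"
      if "K' \<in> L" "K'' \<in> leaves (s K') K'" for K' K''
    proof -
      have "K'' \<in> L'" using s that by blast
      then show "\<phi> K'' = \<phi> K'" "affine_inside v (triangle K'')"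
        unfolding \<phi>_def
        using local_aff_subset[OF Vh_affine_inside[OF v mesh_triangle(3)[OF tL that(1)]]
            mesh_triangle(1)[OF tL'] leaves_subset_triangle[OF that(2)]] by blast+
    qed
    have aff_v: "affine_inside v (triangle K)" if "K \<in> L'" for K
      using that sub(2) unfolding s by blast
    have aff_v': "affine_inside v' (triangle K)" if "K \<in> L'" for K
      using Vh_affine_inside[OF v' mesh_triangle(3)[OF tL' that]] .
    have \<gamma>: "\<gamma> K = \<phi>' K - \<phi> K" and aff_g: "affine_inside g (triangle K)" if "K \<in> L'" for K
      unfolding \<gamma>_def \<phi>'_def \<phi>_def g_def
      using local_aff_diff[OF aff_v'[OF that] aff_v[OF that] mesh_triangle(1)[OF tL' that]] .
    have c': "mid_compatible \<phi>' (tt K) K" if "K \<in> L0" for K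
      by (rule mid_compatible_of_matching[OF triangulation_ofD(1)[OF tL'] nzL' m' lt'[OF that] nz0[OF that]])
    have c: "mid_compatible \<phi> (t K) K" if "K \<in> L0" for K
      by (rule mid_compatible_of_matching[OF triangulation_ofD(1)[OF tL] nzL m lt[OF that] nz0[OF that]])
    have fine: "cr_interp \<phi> (s K') K' = \<phi> K'" "mid_compatible \<phi> (s K') K'" if "K' \<in> L" for K'
      using cr_interp_const[of "s K'" K' \<phi> "\<phi> K'"] sub(1)[OF that] by blast+
    have iv: "cr_interp \<phi> (tt K) K = cr_interp \<phi> (t K) K" if "K \<in> L0" for K
      unfolding tt_def cr_interp_graft by (rule cr_interp_cong) (use fine(1) lt[OF that] in blast)
    have cv: "mid_compatible \<phi> (tt K) K" if "K \<in> L0" for K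
    proof -
      have "mid_compatible (\<lambda>K'. cr_interp \<phi> (s K') K') (t K) K = mid_compatible \<phi> (t K) K"
        by (rule mid_compatible_cong) (use fine(1) lt[OF that] in blast)
      then show ?thesis
        unfolding tt_def mid_compatible_graft using c[OF that] fine(2) lt[OF that] by blast
    qed
    have i\<gamma>: "cr_interp \<gamma> (tt K) K = cr_interp \<phi>' (tt K) K - cr_interp \<phi> (t K) K" if "K \<in> L0" for K
    proof -
      have "cr_interp \<gamma> (tt K) K = cr_interp (\<lambda>K. \<phi>' K - \<phi> K) (tt K) K"
        by (rule cr_interp_cong, rule \<gamma>, rule subsetD[OF lt'[OF that]])
      then show ?thesis unfolding cr_interp_diff iv[OF that] .
    qed
    have c\<gamma>: "mid_compatible \<gamma> (tt K) K" if "K \<in> L0" for K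
    proof -
      have "mid_compatible \<gamma> (tt K) K = mid_compatible (\<lambda>K. \<phi>' K - \<phi> K) (tt K) K"
        by (rule mid_compatible_cong, rule \<gamma>, rule subsetD[OF lt'[OF that]])
      then show ?thesis using mid_compatible_diff[OF c'[OF that] cv[OF that]] by blast
    qed
    define I where "I K = cr_interp \<gamma> (tt (lab K)) (lab K)" for K
    have cdI: "cr_data \<Omega> T0 I"
      unfolding cr_data_def
    proof (intro conjI ballI allI impI)
      fix K K' x y
      assume K: "K \<in> T0" "K' \<in> T0" and "closed_segment x y edge_of K" "closed_segment x y edge_of K'"
      then have xy: "x \<noteq> y" "{x, y} \<subseteq> verts (lab K)" "{x, y} \<subseteq> verts (lab K')"
        using edge_of_ltriangle[OF nz0[OF lab(1)[OF K(1)]]] edge_of_ltriangle[OF nz0[OF lab(1)[OF K(2)]]]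
          lab(2) by auto
      note l = lab(1)[OF K(1)] lab(1)[OF K(2)]
      show "aff_app (I K) (midpoint x y) = aff_app (I K') (midpoint x y)"
        unfolding I_def i\<gamma>[OF l(1)] i\<gamma>[OF l(2)] aff_app_diff
        using cr_interp_edge_agree[OF triangulation_ofD(1)[OF tL'] nzL' m' lt'[OF l(1)] lt'[OF l(2)]
            nz0[OF l(1)] nz0[OF l(2)] c'[OF l(1)] c'[OF l(2)] xy]
          cr_interp_edge_agree[OF triangulation_ofD(1)[OF tL] nzL m lt[OF l(1)] lt[OF l(2)]
            nz0[OF l(1)] nz0[OF l(2)] c[OF l(1)] c[OF l(2)] xy]
        by simp
    next
      fix K x y
      assume K: "K \<in> T0" and e: "closed_segment x y edge_of K" and fr: "closed_segment x y \<subseteq> frontier \<Omega>"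
      have xy: "x \<noteq> y" "{x, y} \<subseteq> verts (lab K)"
        using edge_of_ltriangle[OF nz0[OF lab(1)[OF K]]] e lab(2)[OF K] by auto
      note l = lab(1)[OF K]
      have z: "aff_app (\<phi> J) (midpoint p q) = 0"
        if J: "J \<in> leaves (t (lab K)) (lab K)" and pq: "p \<noteq> q" "{p, q} \<subseteq> verts J"
          "closed_segment p q \<subseteq> frontier \<Omega>" for J p q
      proof -
        have "J \<in> L" using lt[OF l] J by blast
        then show ?thesis
          using cd mesh_triangle(3)[OF tL] edge_of_ltriangle[OF nzL, of J p q] pq
          unfolding cr_data_def \<phi>_def by blast
      qed
      have z': "aff_app (\<phi>' J) (midpoint p q) = 0"
        if J: "J \<in> leaves (tt (lab K)) (lab K)" and pq: "p \<noteq> q" "{p, q} \<subseteq> verts J"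
          "closed_segment p q \<subseteq> frontier \<Omega>" for J p q
      proof -
        have "J \<in> L'" using lt'[OF l] J by blast
        then show ?thesis
          using cd' mesh_triangle(3)[OF tL'] edge_of_ltriangle[OF nzL', of J p q] pq
          unfolding cr_data_def \<phi>'_def by blast
      qed
      show "aff_app (I K) (midpoint x y) = 0"
        unfolding I_def i\<gamma>[OF l] aff_app_diff
        using cr_interp_zero_on[OF z' c'[OF l] xy fr] cr_interp_zero_on[OF z c[OF l] xy fr] by simp
    qed
    have pw: "g x = aff_app (\<gamma> J) x"
      if "K \<in> L0" "J \<in> leaves (tt K) K" "x \<in> interior (triangle J)" for K J x
    proof -
      have J: "J \<in> L'" using lt'[OF that(1)] that(2) by blast
      show ?thesis unfolding \<gamma>_def by (rule local_aff_app) (rule aff_g J that(3))+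
    qed
    define E where "E K = tree_sum (\<lambda>J. aff_energy (\<gamma> J) (triangle J)) (tt (lab K)) (lab K)" for K
    have hE: "((\<lambda>x. (norm (grad g x))\<^sup>2) has_integral E K) K" if "K \<in> T0" for K
    proof -
      have "((\<lambda>x. (norm (grad g x))\<^sup>2) has_integral E K) (triangle (lab K))"
        unfolding E_def
      proof (rule has_integral_tree_sum)
        fix J assume "J \<in> leaves (tt (lab K)) (lab K)"
        then have J: "J \<in> L'" using lt'[OF lab(1)[OF that]] by blast
        show "((\<lambda>x. (norm (grad g x))\<^sup>2) has_integral aff_energy (\<gamma> J) (triangle J)) (triangle J)"
          unfolding \<gamma>_def by (rule has_integral_grad_sq[OF mesh_triangle(1)[OF tL' J] aff_g[OF J]])
      qed
      then show ?thesis using lab(2)[OF that] by simp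
    qed
    define e2 where "e2 = (energy_norm (mesh L') g)\<^sup>2"
    have affm: "affine_inside g K" if "K \<in> mesh L'" for K
      using that aff_g by (auto simp: mesh_def)
    have e2: "e2 = sum E T0"
    proof -
      have en: "(energy_norm (mesh L') g)\<^sup>2 = (\<Sum>K\<in>mesh L'. aff_energy (local_aff g K) K)"
        by (rule energy_norm_sq; (rule triangulation_ofD(3)[OF tL'] | rule affm); assumption)
      have "((\<lambda>x. (norm (grad g x))\<^sup>2) has_integral sum E T0) (closure \<Omega>)"
        unfolding T0_def by (rule mesh_has_integral[OF T0]) (use hE T0_def in blast)
      moreover have "((\<lambda>x. (norm (grad g x))\<^sup>2) has_integral
          (\<Sum>K\<in>mesh L'. aff_energy (local_aff g K) K)) (closure \<Omega>)"
        by (rule mesh_has_integral[OF tL'])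
          (rule has_integral_grad_sq[OF triangulation_ofD(3)[OF tL'] affm])
      ultimately show ?thesis
        unfolding e2_def en by (rule has_integral_unique[symmetric])
    qed
    have int: "(\<lambda>x. (norm (g x - aff_app F x))\<^sup>2) integrable_on K" if "K \<in> T0" for K F
    proof -
      have "(\<lambda>x. (norm (g x - aff_app F x))\<^sup>2) integrable_on triangle (lab K)"
        by (rule integrable_sq_dev, rule pw[OF lab(1)[OF that]])
      then show ?thesis unfolding lab(2)[OF that] .
    qed
    have poinc: "integral K (\<lambda>x. (norm (g x - aff_app (I K) x))\<^sup>2)
        \<le> 2 * spread (lab K) * (E K - aff_energy (I K) K)" if "K \<in> T0" for K
    proof -
      have "integral (triangle (lab K)) (\<lambda>x. (norm (g x - aff_app (I K) x))\<^sup>2)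
          \<le> 2 * spread (lab K) * (E K - aff_energy (I K) (triangle (lab K)))"
        unfolding I_def E_def
        by (rule tree_poincare, rule pw[OF lab(1)[OF that]]) (assumption+, rule c\<gamma>[OF lab(1)[OF that]])
      then show ?thesis unfolding lab(2)[OF that] .
    qed
    have aE: "aff_energy (I K) K \<le> E K" if "K \<in> T0" for K
    proof (rule ccontr)
      assume "\<not> ?thesis"
      moreover have "spread (lab K) > 0"
        using spread_pos[OF nz0[OF lab(1)[OF that]]] .
      ultimately have "2 * spread (lab K) * (E K - aff_energy (I K) K) < 0"
        by (simp add: mult_pos_neg)
      moreover have "0 \<le> integral K (\<lambda>x. (norm (g x - aff_app (I K) x))\<^sup>2)"
        by (rule integral_nonneg[OF int[OF that]]) simp
      ultimately show False using poinc[OF that] by linarith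
    qed
    have E0: "E K \<ge> 0" if "K \<in> T0" for K using aE[OF that] aff_energy_nonneg order_trans by blast
    have Ee: "E K \<le> e2" if "K \<in> T0" for K
      unfolding e2 using member_le_sum[of K T0 E] that E0 T0'(2) by auto
    have sup: "(norm (aff_app (I K) x))\<^sup>2 \<le> C\<^sup>2 * e2" if "K \<in> T0" "x \<in> K" for K x
    proof -
      have "(\<Sum>K\<in>T0. aff_energy (I K) K) \<le> e2" unfolding e2 by (rule sum_mono) (rule aE)
      then have "norm (aff_app (I K) x) \<le> C * sqrt e2"
        using C(2)[OF cdI that] C(1) by (meson mult_left_mono order_trans real_sqrt_le_mono)
      then have "(norm (aff_app (I K) x))\<^sup>2 \<le> (C * sqrt e2)\<^sup>2" by (rule power_mono) simp
      then show ?thesis by (simp add: power_mult_distrib e2_def)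
    qed
    have loc: "integral K (\<lambda>x. (norm (g x))\<^sup>2)
        \<le> (4 * spread (lab K) + 2 * (measure lebesgue K * C\<^sup>2)) * e2" if "K \<in> T0" for K
    proof -
      have K: "K \<in> lmeasurable" using T0'(3)[OF that] compact_simplex lmeasurable_compact by blast
      have h: "((\<lambda>x. 2 * (norm (g x - aff_app (I K) x))\<^sup>2 + 2 * (C\<^sup>2 * e2)) has_integral
        2 * integral K (\<lambda>x. (norm (g x - aff_app (I K) x))\<^sup>2) + measure lebesgue K * (2 * (C\<^sup>2 * e2))) K"
        by (rule has_integral_add[OF has_integral_mult_right[OF integrable_integral[OF int[OF that]]]
              has_integral_const_lmeasurable[OF K]])
      have i0: "(\<lambda>x. (norm (g x))\<^sup>2) integrable_on K"
        using int[OF that, of 0] by (simp add: aff_app_def)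
      have "integral K (\<lambda>x. (norm (g x))\<^sup>2)
          \<le> 2 * integral K (\<lambda>x. (norm (g x - aff_app (I K) x))\<^sup>2) + measure lebesgue K * (2 * (C\<^sup>2 * e2))"
      proof (rule has_integral_le[OF integrable_integral[OF i0] h])
        fix x assume "x \<in> K"
        then show "(norm (g x))\<^sup>2 \<le> 2 * (norm (g x - aff_app (I K) x))\<^sup>2 + 2 * (C\<^sup>2 * e2)"
          using norm_add_sq_le[of "g x - aff_app (I K) x" "aff_app (I K) x"] sup[OF that] by fastforce
      qed
      also have "integral K (\<lambda>x. (norm (g x - aff_app (I K) x))\<^sup>2) \<le> 2 * spread (lab K) * e2"
      proof -
        have "E K - aff_energy (I K) K \<le> e2" using Ee[OF that] aff_energy_nonneg[of "I K" K] by linarith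
        then show ?thesis
          using poinc[OF that] spread_nonneg[of "lab K"]
          by (meson mult_left_mono mult_nonneg_nonneg order_trans zero_le_numeral)
      qed
      finally show ?thesis by (simp add: algebra_simps)
    qed
    have i0: "((\<lambda>x. (norm (g x))\<^sup>2) has_integral integral K (\<lambda>x. (norm (g x))\<^sup>2)) K" if "K \<in> T0" for K
      using int[OF that, of 0] by (simp add: aff_app_def integrable_integral)
    have "((\<lambda>x. (norm (g x))\<^sup>2) has_integral (\<Sum>K\<in>T0. integral K (\<lambda>x. (norm (g x))\<^sup>2))) \<Omega>"
      unfolding has_integral_closure_iff[OF poly, symmetric] T0_def
      by (rule mesh_has_integral[OF T0]) (use i0 T0_def in blast)
    then have "integral \<Omega> (\<lambda>x. (norm (g x))\<^sup>2) = (\<Sum>K\<in>T0. integral K (\<lambda>x. (norm (g x))\<^sup>2))"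
      by (rule integral_unique)
    also have "\<dots> \<le> CF * e2" unfolding CF_def sum_distrib_right by (rule sum_mono) (rule loc)
    finally show ?thesis unfolding e2_def g_def .
  qed
  moreover have "CF \<ge> 0" unfolding CF_def by (intro sum_nonneg add_nonneg_nonneg mult_nonneg_nonneg spread_nonneg) auto
  ultimately show ?thesis by blast
qed

section \<open>Perturbation of sums of squares\<close>

text \<open>
  For nonnegative arguments this says that \<open>\<surd>A\<close> and \<open>\<surd>B\<close> differ by at most \<open>\<surd>D\<close>. In this form
  the property passes to sums and integrals termwise, where the triangle inequality itself would call for
  Minkowski's inequality.
\<close>

definition young :: "real \<Rightarrow> real \<Rightarrow> real \<Rightarrow> bool" where
  "young A B D \<longleftrightarrow>
     (\<forall>t>0. A \<le> (1 + t) * B + (1 + 1 / t) * D \<and> B \<le> (1 + t) * A + (1 + 1 / t) * D)"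

text \<open>
  The choice \<open>t = \<surd>D / \<surd>B\<close> turns the right-hand side into \<open>(\<surd>B + \<surd>D)\<^sup>2\<close>; both roots are enlarged by
  \<open>e / 2\<close> in order to be positive.
\<close>

lemma young_sqrt_le:
  assumes Y: "\<And>t. t > 0 \<Longrightarrow> A \<le> (1 + t) * B + (1 + 1 / t) * D" and nn: "B \<ge> 0" "D \<ge> 0"
  shows "sqrt A \<le> sqrt B + sqrt D"
proof (rule field_le_epsilon)
  fix e :: real assume e: "e > 0"
  define b d where "b = sqrt B + e / 2" and "d = sqrt D + e / 2"
  have pos: "b > 0" "d > 0" using e nn by (simp_all add: b_def d_def add_nonneg_pos)
  have "B = (sqrt B)\<^sup>2" "D = (sqrt D)\<^sup>2" using nn by simp_all
  moreover have "(sqrt B)\<^sup>2 \<le> b\<^sup>2" "(sqrt D)\<^sup>2 \<le> d\<^sup>2"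
    unfolding b_def d_def by (rule power_mono; use e nn in simp)+
  ultimately have le: "B \<le> b\<^sup>2" "D \<le> d\<^sup>2" by simp_all
  have "A \<le> (1 + d / b) * B + (1 + 1 / (d / b)) * D" using Y[of "d / b"] pos by simp
  also have "\<dots> \<le> (1 + d / b) * b\<^sup>2 + (1 + 1 / (d / b)) * d\<^sup>2"
    using le pos by (intro add_mono mult_left_mono) simp_all
  also have "\<dots> = (b + d)\<^sup>2" using pos by (simp add: field_simps power2_eq_square)
  finally have "sqrt A \<le> sqrt ((b + d)\<^sup>2)" by (rule real_sqrt_le_mono)
  then show "sqrt A \<le> sqrt B + sqrt D + e" using pos by (simp add: b_def d_def)
qed

lemma young_sqrt:
  assumes "young A B D" "A \<ge> 0" "B \<ge> 0" "D \<ge> 0"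
  shows "\<bar>sqrt A - sqrt B\<bar> \<le> sqrt D"
proof -
  have "sqrt A \<le> sqrt B + sqrt D" "sqrt B \<le> sqrt A + sqrt D"
    using assms(1) unfolding young_def by (blast intro: young_sqrt_le assms(2-4))+
  then show ?thesis by linarith
qed

lemma young_mono: "young A B D \<Longrightarrow> D \<le> D' \<Longrightarrow> young A B D'"
  unfolding young_def
proof (intro allI impI)
  fix t :: real
  assume Y: "\<forall>t>0. A \<le> (1 + t) * B + (1 + 1 / t) * D \<and> B \<le> (1 + t) * A + (1 + 1 / t) * D"
    and D: "D \<le> D'" and t: "0 < t"
  have "(1 + 1 / t) * D \<le> (1 + 1 / t) * D'" using D t by (intro mult_left_mono) simp_all
  with Y t show "A \<le> (1 + t) * B + (1 + 1 / t) * D' \<and> B \<le> (1 + t) * A + (1 + 1 / t) * D'"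
    by (smt (verit))
qed

lemma young_add: "young A B D \<Longrightarrow> young A' B' D' \<Longrightarrow> young (A + A') (B + B') (D + D')"
  unfolding young_def by (auto simp: distrib_left intro: add_mono[THEN order_trans])

lemma young_mult:
  assumes "young A B D" "c \<ge> 0"
  shows "young (c * A) (c * B) (c * D)"
proof -
  have "c * A \<le> (1 + t) * (c * B) + (1 + 1 / t) * (c * D) \<and>
      c * B \<le> (1 + t) * (c * A) + (1 + 1 / t) * (c * D)" if "t > 0" for t
  proof -
    have "A \<le> (1 + t) * B + (1 + 1 / t) * D" "B \<le> (1 + t) * A + (1 + 1 / t) * D"
      using assms(1) that unfolding young_def by blast+
    from this[THEN mult_left_mono[OF _ assms(2)]] show ?thesis by (simp only: ring_distribs mult_ac)
  qed
  then show ?thesis unfolding young_def by blast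
qed

lemma young_sum:
  assumes "\<And>i. i \<in> I \<Longrightarrow> young (A i) (B i) (D i)"
  shows "young (sum A I) (sum B I) (sum D I)"
  unfolding young_def
proof (intro allI impI)
  fix t :: real assume t: "t > 0"
  have "sum A I \<le> (\<Sum>i\<in>I. (1 + t) * B i + (1 + 1 / t) * D i)"
    "sum B I \<le> (\<Sum>i\<in>I. (1 + t) * A i + (1 + 1 / t) * D i)"
    using assms t unfolding young_def by (auto intro!: sum_mono)
  then show "sum A I \<le> (1 + t) * sum B I + (1 + 1 / t) * sum D I \<and>
      sum B I \<le> (1 + t) * sum A I + (1 + 1 / t) * sum D I"
    unfolding sum.distrib sum_distrib_left by blast
qed

lemma young_ineq:
  fixes p q :: "'a::real_inner"
  assumes "t > 0"
  shows "(norm p)\<^sup>2 \<le> (1 + t) * (norm q)\<^sup>2 + (1 + 1 / t) * (norm (p - q))\<^sup>2"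
proof -
  define r where "r = p - q"
  have p: "p = q + r" by (simp add: r_def)
  have "t * ((1 + t) * (norm q)\<^sup>2 + (1 + 1 / t) * (norm r)\<^sup>2 - (norm (q + r))\<^sup>2) = (norm (t *\<^sub>R q - r))\<^sup>2"
    using assms unfolding power2_norm_eq_inner inner_add_left inner_add_right inner_diff_left
      inner_diff_right inner_commute[of r q] inner_scaleR_left inner_scaleR_right
    by (simp add: field_simps)
  then have "0 \<le> (1 + t) * (norm q)\<^sup>2 + (1 + 1 / t) * (norm r)\<^sup>2 - (norm (q + r))\<^sup>2"
    using assms by (metis zero_le_power2 zero_le_mult_iff not_le order_less_le)
  then show ?thesis unfolding r_def[symmetric] p by simp
qed

lemma young_norm_sq:
  fixes p q :: "'a::real_inner"
  shows "young ((norm p)\<^sup>2) ((norm q)\<^sup>2) ((norm (p - q))\<^sup>2)"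
  unfolding young_def using young_ineq[of _ p q] young_ineq[of _ q p] norm_minus_commute[of p q]
  by simp

lemma young_integral:
  fixes p q :: "'b \<Rightarrow> 'a::real_inner"
  assumes "integrable M (\<lambda>x. (norm (p x))\<^sup>2)" "integrable M (\<lambda>x. (norm (q x))\<^sup>2)"
    "integrable M (\<lambda>x. (norm (p x - q x))\<^sup>2)"
  shows "young (LINT x|M. (norm (p x))\<^sup>2) (LINT x|M. (norm (q x))\<^sup>2)
    (LINT x|M. (norm (p x - q x))\<^sup>2)"
  unfolding young_def
proof (intro allI impI)
  fix t :: real assume t: "t > 0"
  have *: "(LINT x|M. (norm (f x))\<^sup>2) \<le> (1 + t) * (LINT x|M. (norm (g x))\<^sup>2)
      + (1 + 1 / t) * (LINT x|M. (norm (p x - q x))\<^sup>2)"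
    if "integrable M (\<lambda>x. (norm (f x))\<^sup>2)" "integrable M (\<lambda>x. (norm (g x))\<^sup>2)"
      "\<And>x. norm (p x - q x) = norm (f x - g x)" for f g :: "'b \<Rightarrow> 'a"
  proof -
    have "(LINT x|M. (norm (f x))\<^sup>2)
        \<le> (LINT x|M. (1 + t) * (norm (g x))\<^sup>2 + (1 + 1 / t) * (norm (p x - q x))\<^sup>2)"
      by (rule integral_mono)
        (use that assms(3) young_ineq[OF t] in \<open>auto intro!: Bochner_Integration.integrable_add\<close>)
    then show ?thesis using that assms(3) by simp
  qed
  show "(LINT x|M. (norm (p x))\<^sup>2) \<le> (1 + t) * (LINT x|M. (norm (q x))\<^sup>2)
      + (1 + 1 / t) * (LINT x|M. (norm (p x - q x))\<^sup>2) \<and>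
    (LINT x|M. (norm (q x))\<^sup>2) \<le> (1 + t) * (LINT x|M. (norm (p x))\<^sup>2)
      + (1 + 1 / t) * (LINT x|M. (norm (p x - q x))\<^sup>2)"
    using *[OF assms(1,2)] *[OF assms(2,1)] norm_minus_commute by blast
qed

section \<open>Jumps of the piecewise gradient\<close>

definition edge_length :: "vec2 set \<Rightarrow> real" where
  "edge_length E = (case edge_ends E of (a, b) \<Rightarrow> dist a b)"

lemma edge_ends_segment:
  assumes "E = closed_segment z w"
  obtains a b where "edge_ends E = (a, b)" "E = closed_segment a b"
proof -
  have "\<exists>p. case p of (a, b) \<Rightarrow> E = closed_segment a b" using assms by auto
  then have "case edge_ends E of (a, b) \<Rightarrow> E = closed_segment a b"
    unfolding edge_ends_def by (rule someI_ex)
  then show thesis using that by (cases "edge_ends E") auto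
qed

lemma edge_length_segment: "edge_length (closed_segment z w) = dist z w"
proof -
  obtain a b where ab: "edge_ends (closed_segment z w) = (a, b)" "closed_segment z w = closed_segment a b"
    using edge_ends_segment by blast
  then have "{z, w} = {a, b}" by simp
  then show ?thesis unfolding edge_length_def ab(1)
    by (auto simp: doubleton_eq_iff dist_commute)
qed

lemma edge_length_nonneg: "edge_length E \<ge> 0"
  by (simp add: edge_length_def split: prod.split)

lemma norm_tangent_le: "norm (tangent E) \<le> 1"
  by (simp add: tangent_def split: prod.split)

lemma edge_norm_const_sq:
  assumes E: "E = closed_segment z w" and g: "\<And>x. x \<in> E \<Longrightarrow> g x = c"
  shows "(edge_norm E g)\<^sup>2 = edge_length E * (norm c)\<^sup>2"
proof -
  obtain a b where ab: "edge_ends E = (a, b)" "E = closed_segment a b"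
    using edge_ends_segment[OF E] .
  have "(LINT t|lebesgue_on {0..1}. (norm (g (linepath a b t)))\<^sup>2)
      = (LINT t|lebesgue_on {0..1::real}. (norm c)\<^sup>2)"
    by (rule Bochner_Integration.integral_cong)
      (auto simp: g ab(2) linepath_in_path)
  also have "\<dots> = (norm c)\<^sup>2" by (simp add: measure_restrict_space)
  finally show ?thesis
    unfolding edge_norm_def edge_length_def ab(1) by simp
qed

definition neighbour :: "vec2 set set \<Rightarrow> vec2 set \<Rightarrow> vec2 set \<Rightarrow> vec2 set" where
  "neighbour T K E = (THE K'. K' \<in> T \<and> K' \<noteq> K \<and> E edge_of K')"

text \<open>
  The constant value of the jump of the tangential derivative along \<open>E\<close>.
\<close>

definition grad_jump :: "vec2 set \<Rightarrow> vec2 set set \<Rightarrow> vec2 set \<Rightarrow> vec2 set \<Rightarrow> (vec2 \<Rightarrow> vec2) \<Rightarrow> vec2" where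
  "grad_jump \<Omega> T K E v =
     (if E \<subseteq> frontier \<Omega> then fst (local_aff v K) *v tangent E
      else (fst (local_aff v K) - fst (local_aff v (neighbour T K E))) *v tangent E)"

locale polygonal_mesh =
  fixes \<Omega> :: "vec2 set" and T :: "vec2 set set"
  assumes open_domain: "open \<Omega>" and mesh: "triangulation_of \<Omega> T"
begin

lemmas tri = triangulation_ofD(1)[OF mesh] and fin = triangulation_ofD(2)[OF mesh]
  and simp2 = triangulation_ofD(3)[OF mesh] and cover = triangulation_ofD(4)[OF mesh]

lemma neighbourI:
  assumes "K \<in> T" "K' \<in> T" "K' \<noteq> K" "E edge_of K" "E edge_of K'"
  shows "neighbour T K E = K'"
  unfolding neighbour_def
  by (rule the_equality) (use assms triangulation_neighbour_unique[OF tri simp2] in blast)+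

lemma neighbour:
  assumes "K \<in> T" "E edge_of K" "\<not> E \<subseteq> frontier \<Omega>"
  shows "neighbour T K E \<in> T" "neighbour T K E \<noteq> K" "E edge_of neighbour T K E"
proof -
  obtain K' where "K' \<in> T" "K' \<noteq> K" "E edge_of K'"
    using triangulation_neighbour_exists[OF open_domain mesh assms] by blast
  moreover from this have "neighbour T K E = K'" using neighbourI assms(1,2) by blast
  ultimately show "neighbour T K E \<in> T" "neighbour T K E \<noteq> K" "E edge_of neighbour T K E"
    by simp_all
qed

lemma edges_sq_eq:
  assumes aff: "\<And>K. K \<in> T \<Longrightarrow> affine_inside v K" and K: "K \<in> T"
  shows "edges_sq \<Omega> T K v =
    (\<Sum>E | E edge_of K. mesh_size K * (edge_length E * (norm (grad_jump \<Omega> T K E v))\<^sup>2))"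
  unfolding edges_sq_def
proof (rule sum.cong)
  fix E assume "E \<in> {E. E edge_of K}"
  then have E: "E edge_of K" by simp
  obtain z w where zw: "E = closed_segment z w"
    using edge_of_2_simplex_segment[OF simp2[OF K] E] by blast
  have tr: "side_trace J (\<lambda>x. grad v x *v tangent E) x = fst (local_aff v J) *v tangent E"
    if "J \<in> T" "E edge_of J" "x \<in> E" for J x
    by (rule side_trace_eq[OF simp2[OF that(1)]])
      (use that edge_of_imp_subset grad_affine_inside[OF aff] in auto)
  have "jump \<Omega> T K E (\<lambda>x. grad v x *v tangent E) x = grad_jump \<Omega> T K E v" if x: "x \<in> E" for x
  proof (cases "E \<subseteq> frontier \<Omega>")
    case True
    then show ?thesis using tr[OF K E x] by (simp add: jump_def grad_jump_def)
  next
    case False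
    note n = neighbour[OF K E False]
    show ?thesis
      using False tr[OF K E x] tr[OF n(1,3) x]
      unfolding jump_def grad_jump_def neighbour_def[symmetric]
      by (simp add: matrix_vector_mult_diff_rdistrib)
  qed
  then show "mesh_size K * (edge_norm E (jump \<Omega> T K E (\<lambda>x. grad v x *v tangent E)))\<^sup>2 =
      mesh_size K * (edge_length E * (norm (grad_jump \<Omega> T K E v))\<^sup>2)"
    using edge_norm_const_sq[OF zw] by simp
qed simp

lemma finite_edges: "K \<in> T \<Longrightarrow> finite {E. E edge_of K}" "K \<in> T \<Longrightarrow> card {E. E edge_of K} \<le> 3"
proof -
  assume "K \<in> T"
  then obtain a b c where K: "K = convex hull {a, b, c}" "cross2 (b - a) (c - a) \<noteq> 0"
    using simp2 unfolding simplex_2_iff by blast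
  have "{E. E edge_of K} = {closed_segment a b, closed_segment a c, closed_segment b c}"
    unfolding K(1) edge_of_triangle[OF K(2)] by blast
  then show "finite {E. E edge_of K}" "card {E. E edge_of K} \<le> 3"
    using card_insert_le_m1[of 3] by (simp_all add: card_insert_if)
qed

lemma sum_neighbours_le:
  assumes e: "\<And>K. K \<in> T \<Longrightarrow> e K \<ge> (0 :: real)"
  shows "(\<Sum>K\<in>T. \<Sum>E | E edge_of K \<and> \<not> E \<subseteq> frontier \<Omega>. e (neighbour T K E)) \<le> 3 * sum e T"
proof -
  define P where "P = Sigma T (\<lambda>K. {E. E edge_of K})"
  define P' where "P' = Sigma T (\<lambda>K. {E. E edge_of K \<and> \<not> E \<subseteq> frontier \<Omega>})"
  define F where "F = (\<lambda>(K, E). (neighbour T K E, E))"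
  have finP: "finite P" unfolding P_def using fin finite_edges(1) by auto
  have finE': "finite {E. E edge_of K \<and> \<not> E \<subseteq> frontier \<Omega>}" if "K \<in> T" for K
    by (rule finite_subset[OF _ finite_edges(1)[OF that]]) blast
  \<comment> \<open>A triangle is determined by its neighbour and their common edge.\<close>
  have inj: "inj_on F P'"
  proof (rule inj_onI, clarify)
    fix K E K' E' assume "(K, E) \<in> P'" "(K', E') \<in> P'" and eq: "F (K, E) = F (K', E')"
    then have K: "K \<in> T" "E edge_of K" "\<not> E \<subseteq> frontier \<Omega>"
      and K': "K' \<in> T" "E' edge_of K'" "\<not> E' \<subseteq> frontier \<Omega>" by (auto simp: P'_def)
    have "neighbour T K E = neighbour T K' E' \<and> E = E'" using eq unfolding F_def prod.case prod.inject .
    then have EE: "E = E'" and nn: "neighbour T K E = neighbour T K' E'" by blast+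
    note n = neighbour[OF K] and n' = neighbour[OF K']
    have "K = K'"
      using triangulation_neighbour_unique[OF tri simp2 n(1) K(1) K'(1) n(2)[symmetric] _ n(3) K(2)]
        n'(2) nn EE K'(2) by metis
    with EE show "K = K' \<and> E = E'" by simp
  qed
  have "(\<Sum>K\<in>T. \<Sum>E | E edge_of K \<and> \<not> E \<subseteq> frontier \<Omega>. e (neighbour T K E))
      = (\<Sum>p\<in>P'. e (fst (F p)))"
    unfolding P'_def F_def using fin finE' by (subst sum.Sigma) (auto intro!: sum.cong)
  also have "\<dots> = (\<Sum>p\<in>F ` P'. e (fst p))" using inj by (simp add: sum.reindex)
  also have "\<dots> \<le> (\<Sum>p\<in>P. e (fst p))"
  proof (rule sum_mono2[OF finP])
    show "F ` P' \<subseteq> P"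
    proof
      fix p assume "p \<in> F ` P'"
      then obtain K E where "p = (neighbour T K E, E)" "K \<in> T" "E edge_of K" "\<not> E \<subseteq> frontier \<Omega>"
        unfolding F_def P'_def by (elim imageE SigmaE) simp
      then show "p \<in> P" using neighbour(1,3) unfolding P_def by blast
    qed
  qed (use e in \<open>auto simp: P_def\<close>)
  also have "\<dots> = (\<Sum>K\<in>T. \<Sum>E | E edge_of K. e K)"
    unfolding P_def using fin finite_edges(1) by (subst sum.Sigma) (auto intro!: sum.cong)
  also have "\<dots> \<le> (\<Sum>K\<in>T. 3 * e K)"
  proof (rule sum_mono)
    fix K assume K: "K \<in> T"
    have "real (card {E. E edge_of K}) * e K \<le> 3 * e K"
      using finite_edges(2)[OF K] e[OF K] by (intro mult_right_mono) simp_all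
    then show "(\<Sum>E | E edge_of K. e K) \<le> 3 * e K" by simp
  qed
  finally show ?thesis by (simp add: sum_distrib_left)
qed

end

text \<open>
  Squared diameter over area, stated for the point set so that it does not refer to the labelling.
\<close>

definition shape_bounded :: "real \<Rightarrow> vec2 set \<Rightarrow> bool" where
  "shape_bounded \<sigma> K \<longleftrightarrow> (\<forall>x\<in>K. \<forall>y\<in>K. (norm (x - y))\<^sup>2 \<le> 2 * \<sigma> * measure lebesgue K)"

lemma mesh_size_sq: "(mesh_size K)\<^sup>2 = measure lebesgue K"
  by (simp add: mesh_size_def)

lemma mesh_size_nonneg: "mesh_size K \<ge> 0"
  by (simp add: mesh_size_def)

lemma edge_length_le_mesh_size:
  assumes s: "2 simplex K" "shape_bounded \<sigma> K" "\<sigma> \<ge> 0" and E: "E edge_of K"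
  shows "edge_length E \<le> sqrt (2 * \<sigma>) * mesh_size K"
proof -
  obtain z w where zw: "E = closed_segment z w" using edge_of_2_simplex_segment[OF s(1) E] by blast
  have "z \<in> K" "w \<in> K" using edge_of_imp_subset[OF E] zw by auto
  then have "(dist z w)\<^sup>2 \<le> 2 * \<sigma> * measure lebesgue K"
    using s(2) by (auto simp: shape_bounded_def dist_norm)
  then have "dist z w \<le> sqrt (2 * \<sigma> * measure lebesgue K)" by (rule real_le_rsqrt)
  then show ?thesis by (simp add: zw edge_length_segment mesh_size_def real_sqrt_mult)
qed

lemma mesh_size_le_edge_length:
  assumes s: "2 simplex K" "shape_bounded \<sigma> K" "\<sigma> \<ge> 0" and E: "E edge_of K"
  shows "mesh_size K \<le> sqrt (2 * \<sigma>) * edge_length E"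
proof -
  obtain z w where zw: "E = closed_segment z w" using edge_of_2_simplex_segment[OF s(1) E] by blast
  obtain c where c: "K = convex hull {z, w, c}"
    using edge_of_2_simplexD[OF s(1) E[unfolded zw]] by blast
  have "z \<in> K" "c \<in> K" by (simp_all add: c hull_inc)
  then have "(norm (c - z))\<^sup>2 \<le> 2 * \<sigma> * measure lebesgue K"
    using s(2) by (auto simp: shape_bounded_def)
  then have "norm (c - z) \<le> sqrt (2 * \<sigma> * measure lebesgue K)" by (rule real_le_rsqrt)
  then have nc: "norm (c - z) \<le> sqrt (2 * \<sigma>) * mesh_size K"
    by (simp add: mesh_size_def real_sqrt_mult)
  have "(mesh_size K)\<^sup>2 \<le> \<bar>cross2 (w - z) (c - z)\<bar>"
    unfolding mesh_size_sq c measure_triangle by simp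
  also have "\<dots> \<le> norm (w - z) * norm (c - z)" by (rule cross2_norm_le)
  also have "\<dots> \<le> edge_length E * (sqrt (2 * \<sigma>) * mesh_size K)"
    unfolding zw edge_length_segment dist_norm norm_minus_commute[of z w]
    by (rule mult_left_mono[OF nc]) simp
  finally have "mesh_size K * mesh_size K \<le> (sqrt (2 * \<sigma>) * edge_length E) * mesh_size K"
    by (simp add: power2_eq_square mult_ac)
  moreover have "mesh_size K > 0"
    using measure_2_simplex_pos[OF s(1)] by (simp add: mesh_size_def)
  ultimately show ?thesis by simp
qed

text \<open>
  Passing through the length of the common edge compares the size of \<open>K\<close> with the area of its neighbour \<open>K'\<close>.
\<close>

lemma edge_weight_le:
  assumes \<sigma>: "\<sigma> \<ge> 0" and K: "2 simplex K" "shape_bounded \<sigma> K" "E edge_of K"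
    and K': "2 simplex K'" "shape_bounded \<sigma> K'" "E edge_of K'"
  shows "mesh_size K * edge_length E \<le> (2 * \<sigma>) * sqrt (2 * \<sigma>) * measure lebesgue K'"
proof -
  let ?l = "edge_length E" and ?c = "sqrt (2 * \<sigma>)"
  have "mesh_size K * ?l \<le> (?c * ?l) * ?l"
    by (rule mult_right_mono[OF mesh_size_le_edge_length[OF K(1,2) \<sigma> K(3)] edge_length_nonneg])
  also have "\<dots> = ?c * ?l\<^sup>2" by (simp add: power2_eq_square)
  also have "\<dots> \<le> ?c * (?c * mesh_size K')\<^sup>2"
    using edge_length_le_mesh_size[OF K'(1,2) \<sigma> K'(3)] edge_length_nonneg \<sigma>
    by (intro mult_left_mono power_mono) simp_all
  also have "\<dots> = (2 * \<sigma>) * ?c * measure lebesgue K'"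
    using \<sigma> by (simp add: power_mult_distrib mesh_size_sq)
  finally show ?thesis .
qed

definition edge_terms :: "vec2 set \<Rightarrow> vec2 set set \<Rightarrow> (vec2 \<Rightarrow> vec2) \<Rightarrow> vec2 set \<Rightarrow> real" where
  "edge_terms \<Omega> T v K =
     (\<Sum>E | E edge_of K. mesh_size K * (edge_length E * (norm (grad_jump \<Omega> T K E v))\<^sup>2))"

lemma (in polygonal_mesh) sum_edge_terms_le:
  assumes \<sigma>: "\<sigma> \<ge> 0" and sh: "\<And>K. K \<in> T \<Longrightarrow> shape_bounded \<sigma> K"
  shows "(\<Sum>K\<in>T. edge_terms \<Omega> T g K)
    \<le> 12 * ((2 * \<sigma>) * sqrt (2 * \<sigma>)) * (\<Sum>K\<in>T. aff_energy (local_aff g K) K)"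
proof -
  let ?B = "(2 * \<sigma>) * sqrt (2 * \<sigma>)"
  define e where "e K = aff_energy (local_aff g K) K" for K
  have e: "e K \<ge> 0" for K by (simp add: e_def aff_energy_nonneg)
  have B: "?B \<ge> 0" using \<sigma> by simp
  have G: "mesh_size K * edge_length E * (norm (fst (local_aff g J)))\<^sup>2 \<le> ?B * e J"
    if "K \<in> T" "J \<in> T" "E edge_of K" "E edge_of J" for K J E
    using mult_right_mono[OF edge_weight_le[OF \<sigma> simp2[OF that(1)] sh[OF that(1)] that(3)
        simp2[OF that(2)] sh[OF that(2)] that(4)], of "(norm (fst (local_aff g J)))\<^sup>2"]
    by (simp add: e_def aff_energy_def mult_ac)
  have edge_bd: "mesh_size K * (edge_length E * (norm (grad_jump \<Omega> T K E g))\<^sup>2)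
      \<le> 2 * ?B * (e K + (if E \<subseteq> frontier \<Omega> then 0 else e (neighbour T K E)))"
    if K: "K \<in> T" and E: "E edge_of K" for K E
  proof -
    define N where "N = (if E \<subseteq> frontier \<Omega> then 0 else fst (local_aff g (neighbour T K E)))"
    have J: "grad_jump \<Omega> T K E g = (fst (local_aff g K) - N) *v tangent E"
      by (simp add: grad_jump_def N_def)
    have "norm (grad_jump \<Omega> T K E g) \<le> norm (fst (local_aff g K) - N) * 1"
      unfolding J using norm_matrix_vector_le norm_tangent_le mult_left_mono norm_ge_zero
      by (meson order_trans)
    then have "(norm (grad_jump \<Omega> T K E g))\<^sup>2 \<le> (norm (fst (local_aff g K) + - N))\<^sup>2"
      by (simp add: power_mono)
    also have "\<dots> \<le> 2 * (norm (fst (local_aff g K)))\<^sup>2 + 2 * (norm N)\<^sup>2"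
      using norm_add_sq_le[of "fst (local_aff g K)" "- N"] by simp
    finally have "mesh_size K * edge_length E * (norm (grad_jump \<Omega> T K E g))\<^sup>2
        \<le> mesh_size K * edge_length E * (2 * (norm (fst (local_aff g K)))\<^sup>2 + 2 * (norm N)\<^sup>2)"
      by (rule mult_left_mono) (simp add: mesh_size_nonneg edge_length_nonneg)
    also have "\<dots> = 2 * (mesh_size K * edge_length E * (norm (fst (local_aff g K)))\<^sup>2)
        + 2 * (mesh_size K * edge_length E * (norm N)\<^sup>2)" by (simp add: algebra_simps)
    also have "\<dots> \<le> 2 * (?B * e K) + 2 * (?B * (if E \<subseteq> frontier \<Omega> then 0 else e (neighbour T K E)))"
    proof (intro add_mono mult_left_mono[of _ _ 2])
      show "mesh_size K * edge_length E * (norm (fst (local_aff g K)))\<^sup>2 \<le> ?B * e K"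
        by (rule G[OF K K E E])
      show "mesh_size K * edge_length E * (norm N)\<^sup>2
          \<le> ?B * (if E \<subseteq> frontier \<Omega> then 0 else e (neighbour T K E))"
        using G[OF K neighbour(1)[OF K E] E neighbour(3)[OF K E]] by (simp add: N_def)
    qed simp_all
    finally show ?thesis by (simp add: algebra_simps)
  qed
  have "(\<Sum>K\<in>T. edge_terms \<Omega> T g K) \<le> (\<Sum>K\<in>T. \<Sum>E | E edge_of K.
      2 * ?B * (e K + (if E \<subseteq> frontier \<Omega> then 0 else e (neighbour T K E))))"
    unfolding edge_terms_def by (intro sum_mono edge_bd) simp_all
  also have "\<dots> = 2 * ?B * ((\<Sum>K\<in>T. \<Sum>E | E edge_of K. e K)
      + (\<Sum>K\<in>T. \<Sum>E | E edge_of K. if E \<subseteq> frontier \<Omega> then 0 else e (neighbour T K E)))"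
    by (simp only: sum_distrib_left[symmetric] sum.distrib)
  also have "(\<Sum>K\<in>T. \<Sum>E | E edge_of K. if E \<subseteq> frontier \<Omega> then 0 else e (neighbour T K E))
      = (\<Sum>K\<in>T. \<Sum>E | E edge_of K \<and> \<not> E \<subseteq> frontier \<Omega>. e (neighbour T K E))"
  proof (rule sum.cong[OF refl])
    fix K assume "K \<in> T"
    then have "finite {E. E edge_of K}" by (rule finite_edges(1))
    from sum.inter_filter[OF this, of "\<lambda>E. e (neighbour T K E)" "\<lambda>E. \<not> E \<subseteq> frontier \<Omega>"]
    show "(\<Sum>E | E edge_of K. if E \<subseteq> frontier \<Omega> then 0 else e (neighbour T K E))
      = (\<Sum>E | E edge_of K \<and> \<not> E \<subseteq> frontier \<Omega>. e (neighbour T K E))"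
      by (simp add: if_not_P) (rule sum.cong, simp_all)
  qed
  also have "2 * ?B * ((\<Sum>K\<in>T. \<Sum>E | E edge_of K. e K) +
      (\<Sum>K\<in>T. \<Sum>E | E edge_of K \<and> \<not> E \<subseteq> frontier \<Omega>. e (neighbour T K E)))
      \<le> 2 * ?B * (3 * sum e T + 3 * sum e T)"
  proof (intro mult_left_mono add_mono sum_neighbours_le e)
    have "(\<Sum>E | E edge_of K. e K) \<le> 3 * e K" if K: "K \<in> T" for K
      using mult_right_mono[of "real (card {E. E edge_of K})" 3 "e K"] finite_edges(2)[OF K] e by simp
    then show "(\<Sum>K\<in>T. \<Sum>E | E edge_of K. e K) \<le> 3 * sum e T"
      unfolding sum_distrib_left by (rule sum_mono)
  qed (use B in simp)
  finally show ?thesis unfolding e_def by (simp add: algebra_simps)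
qed

text \<open>
  The neighbours of \<open>K\<close> in the two meshes are nested: the coarse triangle that contains the fine neighbour
  meets \<open>K\<close> along the edge, so it is the coarse neighbour. Hence the jump of the difference is the
  difference of the jumps.
\<close>

lemma edges_young:
  assumes \<Omega>: "open \<Omega>"
    and T: "triangulation_of \<Omega> T" and T': "triangulation_of \<Omega> T'"
    and ref: "\<And>K'. K' \<in> T' \<Longrightarrow> \<exists>K\<in>T. K' \<subseteq> K"
    and v: "\<And>K. K \<in> T \<Longrightarrow> affine_inside v K" and v': "\<And>K. K \<in> T' \<Longrightarrow> affine_inside v' K"
    and K: "K \<in> T" "K \<in> T'"
  shows "young (edges_sq \<Omega> T' K v') (edges_sq \<Omega> T K v) (edge_terms \<Omega> T' (\<lambda>x. v' x - v x) K)"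
proof -
  interpret coarse: polygonal_mesh \<Omega> T by standard (rule \<Omega> T)+
  interpret fine: polygonal_mesh \<Omega> T' by standard (rule \<Omega> T')+
  let ?g = "\<lambda>x. v' x - v x"
  have loc: "local_aff ?g J' = local_aff v' J' - local_aff v J" if "J' \<in> T'" "J \<in> T" "J' \<subseteq> J" for J J'
    using local_aff_diff(1)[OF v'[OF that(1)] local_aff_subset(2)[OF v[OF that(2)] fine.simp2[OF that(1)] that(3)]
        fine.simp2[OF that(1)]] local_aff_subset(1)[OF v[OF that(2)] fine.simp2[OF that(1)] that(3)] by simp
  have nb: "neighbour T' K E \<subseteq> neighbour T K E" if E: "E edge_of K" "\<not> E \<subseteq> frontier \<Omega>" for E
  proof -
    note n = fine.neighbour[OF K(2) E]
    obtain J where J: "J \<in> T" "neighbour T' K E \<subseteq> J" using ref[OF n(1)] by blast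
    have "J \<noteq> K"
    proof
      assume "J = K"
      obtain x where x: "x \<in> interior (neighbour T' K E)" using interior_2_simplex[OF fine.simp2[OF n(1)]] by blast
      then have "x \<in> K" using J(2) \<open>J = K\<close> interior_subset by blast
      then show False
        using triangulation_interior_eq[OF fine.tri n(1) K(2) fine.simp2[OF n(1)] fine.simp2[OF K(2)] x] n(2)
        by blast
    qed
    moreover have "E \<subseteq> J" using edge_of_imp_subset[OF n(3)] J(2) by blast
    ultimately have "E edge_of J"
      using triangulation_common_edge[OF coarse.tri K(1) J(1) coarse.simp2[OF K(1)] coarse.simp2[OF J(1)] _ E(1)]
      by blast
    then have "neighbour T K E = J" using coarse.neighbourI[OF K(1) J(1) \<open>J \<noteq> K\<close> E(1)] by blast
    then show ?thesis using J(2) by simp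
  qed
  have jump: "grad_jump \<Omega> T' K E ?g = grad_jump \<Omega> T' K E v' - grad_jump \<Omega> T K E v"
    if E: "E edge_of K" for E
  proof (cases "E \<subseteq> frontier \<Omega>")
    case True
    then show ?thesis
      using loc[OF K(2,1)] by (simp add: grad_jump_def matrix_vector_mult_diff_rdistrib)
  next
    case False
    then show ?thesis
      using loc[OF K(2,1)] loc[OF fine.neighbour(1)[OF K(2) E False] coarse.neighbour(1)[OF K(1) E False] nb[OF E False]]
      by (simp add: grad_jump_def matrix_vector_mult_diff_rdistrib)
  qed
  have e1: "edges_sq \<Omega> T' K v' =
      (\<Sum>E | E edge_of K. mesh_size K * (edge_length E * (norm (grad_jump \<Omega> T' K E v'))\<^sup>2))"
    by (rule fine.edges_sq_eq[OF _ K(2)]) (rule v')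
  have e2: "edges_sq \<Omega> T K v =
      (\<Sum>E | E edge_of K. mesh_size K * (edge_length E * (norm (grad_jump \<Omega> T K E v))\<^sup>2))"
    by (rule coarse.edges_sq_eq[OF _ K(1)]) (rule v)
  show ?thesis
    unfolding e1 e2 edge_terms_def
  proof (rule young_sum)
    fix E assume "E \<in> {E. E edge_of K}"
    then have E: "E edge_of K" by simp
    show "young (mesh_size K * (edge_length E * (norm (grad_jump \<Omega> T' K E v'))\<^sup>2))
      (mesh_size K * (edge_length E * (norm (grad_jump \<Omega> T K E v))\<^sup>2))
      (mesh_size K * (edge_length E * (norm (grad_jump \<Omega> T' K E ?g))\<^sup>2))"
      unfolding jump[OF E]
      by (intro young_mult young_norm_sq mesh_size_nonneg edge_length_nonneg)
  qed
qed

section \<open>Controls, volume terms and stability\<close>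

lemma L2_diff:
  fixes u v :: "vec2 \<Rightarrow> vec2"
  assumes "u \<in> L2 R" "v \<in> L2 R"
  shows "(\<lambda>x. u x - v x) \<in> L2 R"
proof -
  have m: "u \<in> borel_measurable (lebesgue_on R)" "v \<in> borel_measurable (lebesgue_on R)"
    and i: "integrable (lebesgue_on R) (\<lambda>x. (norm (u x))\<^sup>2)" "integrable (lebesgue_on R) (\<lambda>x. (norm (v x))\<^sup>2)"
    using assms by (auto simp: L2_def)
  have "integrable (lebesgue_on R) (\<lambda>x. (norm (u x - v x))\<^sup>2)"
  proof (rule Bochner_Integration.integrable_bound)
    show "integrable (lebesgue_on R) (\<lambda>x. 2 * (norm (u x))\<^sup>2 + 2 * (norm (v x))\<^sup>2)" using i by simp
    have "(norm (u x - v x))\<^sup>2 \<le> 2 * (norm (u x))\<^sup>2 + 2 * (norm (v x))\<^sup>2" for x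
      using norm_add_sq_le[of "u x" "- v x"] by simp
    then show "AE x in lebesgue_on R. norm ((norm (u x - v x))\<^sup>2)
        \<le> norm (2 * (norm (u x))\<^sup>2 + 2 * (norm (v x))\<^sup>2)" by simp
  qed (use m in measurable)
  then show ?thesis using m by (simp add: L2_def)
qed

lemma L2_add:
  fixes u v :: "vec2 \<Rightarrow> vec2"
  assumes "u \<in> L2 R" "v \<in> L2 R"
  shows "(\<lambda>x. u x + v x) \<in> L2 R"
proof -
  have "(\<lambda>x. - v x) \<in> L2 R" using assms(2) by (simp add: L2_def)
  from L2_diff[OF assms(1) this] show ?thesis by simp
qed

lemma L2_inner_integrable:
  fixes u v :: "vec2 \<Rightarrow> vec2"
  assumes "u \<in> L2 R" "v \<in> L2 R"
  shows "integrable (lebesgue_on R) (\<lambda>x. u x \<bullet> v x)"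
proof (rule Bochner_Integration.integrable_bound)
  show "integrable (lebesgue_on R) (\<lambda>x. (norm (u x))\<^sup>2 + (norm (v x))\<^sup>2)"
    using assms by (simp add: L2_def)
  have "\<bar>u x \<bullet> v x\<bar> \<le> (norm (u x))\<^sup>2 + (norm (v x))\<^sup>2" for x
  proof -
    have "\<bar>u x \<bullet> v x\<bar> \<le> norm (u x) * norm (v x)" by (rule Cauchy_Schwarz_ineq2)
    moreover have "0 \<le> (norm (u x) - norm (v x))\<^sup>2" "0 \<le> (norm (u x))\<^sup>2" "0 \<le> (norm (v x))\<^sup>2" by simp_all
    ultimately show ?thesis by (simp add: power2_diff)
  qed
  then show "AE x in lebesgue_on R. norm (u x \<bullet> v x) \<le> norm ((norm (u x))\<^sup>2 + (norm (v x))\<^sup>2)"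
    by simp
  show "(\<lambda>x. u x \<bullet> v x) \<in> borel_measurable (lebesgue_on R)"
    using assms by (auto simp: L2_def)
qed

text \<open>
  Adding the two variational inequalities gives \<open>\<alpha> \<parallel>u' - u\<parallel>\<^sup>2 \<le> (p - p', u' - u)\<close>. The product is
  split pointwise by Young's inequality.
\<close>

lemma control_difference:
  fixes u u' p p' :: "vec2 \<Rightarrow> vec2"
  assumes \<alpha>: "\<alpha> > 0" and u: "u \<in> L2 R" "u' \<in> L2 R" and p: "p \<in> L2 R" "p' \<in> L2 R"
    and vi: "L2_inner R (\<lambda>x. \<alpha> *\<^sub>R u x + p x) (\<lambda>x. u' x - u x) \<ge> 0"
      "L2_inner R (\<lambda>x. \<alpha> *\<^sub>R u' x + p' x) (\<lambda>x. u x - u' x) \<ge> 0"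
  shows "(LINT x|lebesgue_on R. (norm (u' x - u x))\<^sup>2)
    \<le> (1 / \<alpha>\<^sup>2) * (LINT x|lebesgue_on R. (norm (p' x - p x))\<^sup>2)"
proof -
  let ?M = "lebesgue_on R"
  have sc: "(\<lambda>x. \<alpha> *\<^sub>R w x) \<in> L2 R" if "w \<in> L2 R" for w :: "vec2 \<Rightarrow> vec2"
    using that by (auto simp: L2_def power_mult_distrib)
  have d: "(\<lambda>x. u' x - u x) \<in> L2 R" "(\<lambda>x. u x - u' x) \<in> L2 R" "(\<lambda>x. p' x - p x) \<in> L2 R"
    by (rule L2_diff u p)+
  have c: "(\<lambda>x. \<alpha> *\<^sub>R u x + p x) \<in> L2 R" "(\<lambda>x. \<alpha> *\<^sub>R u' x + p' x) \<in> L2 R"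
    by (rule L2_add sc u p)+
  have i1: "integrable ?M (\<lambda>x. (norm (u' x - u x))\<^sup>2)" and i2: "integrable ?M (\<lambda>x. (norm (p' x - p x))\<^sup>2)"
    using d by (auto simp: L2_def)
  have "0 \<le> (LINT x|?M. (\<alpha> *\<^sub>R u x + p x) \<bullet> (u' x - u x)) + (LINT x|?M. (\<alpha> *\<^sub>R u' x + p' x) \<bullet> (u x - u' x))"
    using vi unfolding L2_inner_def by linarith
  also have "\<dots> = (LINT x|?M. (\<alpha> *\<^sub>R u x + p x) \<bullet> (u' x - u x) + (\<alpha> *\<^sub>R u' x + p' x) \<bullet> (u x - u' x))"
    by (rule Bochner_Integration.integral_add[symmetric]) (rule L2_inner_integrable c d)+
  also have "\<dots> \<le> (LINT x|?M. (1 / (2 * \<alpha>)) * (norm (p' x - p x))\<^sup>2 - (\<alpha> / 2) * (norm (u' x - u x))\<^sup>2)"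
  proof (rule integral_mono)
    show "integrable ?M (\<lambda>x. (\<alpha> *\<^sub>R u x + p x) \<bullet> (u' x - u x) + (\<alpha> *\<^sub>R u' x + p' x) \<bullet> (u x - u' x))"
      by (rule Bochner_Integration.integrable_add) (rule L2_inner_integrable c d)+
    show "integrable ?M (\<lambda>x. (1 / (2 * \<alpha>)) * (norm (p' x - p x))\<^sup>2 - (\<alpha> / 2) * (norm (u' x - u x))\<^sup>2)"
      using i1 i2 by simp
    fix x
    let ?w = "u' x - u x" and ?q = "p' x - p x"
    have e: "(\<alpha> *\<^sub>R u x + p x) \<bullet> ?w + (\<alpha> *\<^sub>R u' x + p' x) \<bullet> (u x - u' x) = - (\<alpha> * (?w \<bullet> ?w)) - ?q \<bullet> ?w"
      by (simp add: inner_add_left inner_diff_left inner_diff_right inner_commute algebra_simps)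
    have "0 \<le> (norm (?q + \<alpha> *\<^sub>R ?w))\<^sup>2" by simp
    also have "\<dots> = (norm ?q)\<^sup>2 + 2 * \<alpha> * (?q \<bullet> ?w) + \<alpha>\<^sup>2 * (norm ?w)\<^sup>2"
      by (simp only: power2_norm_eq_inner inner_add_left inner_add_right inner_scaleR_left
          inner_scaleR_right inner_commute[of ?w ?q]) (simp add: power2_eq_square algebra_simps)
    finally have "0 \<le> (1 / (2 * \<alpha>)) * ((norm ?q)\<^sup>2 + 2 * \<alpha> * (?q \<bullet> ?w) + \<alpha>\<^sup>2 * (norm ?w)\<^sup>2)"
      using \<alpha> by simp
    also have "\<dots> = (1 / (2 * \<alpha>)) * (norm ?q)\<^sup>2 + ?q \<bullet> ?w + (\<alpha> / 2) * (norm ?w)\<^sup>2"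
      using \<alpha> by (simp add: field_simps power2_eq_square)
    finally show "(\<alpha> *\<^sub>R u x + p x) \<bullet> ?w + (\<alpha> *\<^sub>R u' x + p' x) \<bullet> (u x - u' x)
        \<le> (1 / (2 * \<alpha>)) * (norm ?q)\<^sup>2 - (\<alpha> / 2) * (norm ?w)\<^sup>2"
      unfolding e power2_norm_eq_inner[of ?w] by (simp add: field_simps)
  qed
  also have "\<dots> = (1 / (2 * \<alpha>)) * (LINT x|?M. (norm (p' x - p x))\<^sup>2)
      - (\<alpha> / 2) * (LINT x|?M. (norm (u' x - u x))\<^sup>2)"
    using i1 i2 by simp
  finally have "(\<alpha> / 2) * (LINT x|?M. (norm (u' x - u x))\<^sup>2) \<le> (1 / (2 * \<alpha>)) * (LINT x|?M. (norm (p' x - p x))\<^sup>2)"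
    by simp
  then have "(2 / \<alpha>) * ((\<alpha> / 2) * (LINT x|?M. (norm (u' x - u x))\<^sup>2))
      \<le> (2 / \<alpha>) * ((1 / (2 * \<alpha>)) * (LINT x|?M. (norm (p' x - p x))\<^sup>2))"
    by (rule mult_left_mono) (use \<alpha> in simp)
  then show ?thesis using \<alpha> by (simp add: power2_eq_square)
qed

lemma L2_on_mesh:
  fixes g :: "vec2 \<Rightarrow> vec2"
  assumes poly: "polygonal_domain \<Omega>" and T: "triangulation_of \<Omega> T" and g: "g \<in> L2 \<Omega>"
  shows "K \<in> T \<Longrightarrow> integrable (lebesgue_on K) (\<lambda>x. (norm (g x))\<^sup>2)"
    "(\<Sum>K\<in>T. LINT x|lebesgue_on K. (norm (g x))\<^sup>2) = (LINT x|lebesgue_on \<Omega>. (norm (g x))\<^sup>2)"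
proof -
  let ?f = "\<lambda>x. (norm (g x))\<^sup>2"
  have "\<Omega> \<in> sets lebesgue" using poly by (simp add: polygonal_domain_def)
  then have "(?f has_integral (LINT x|lebesgue_on \<Omega>. ?f x)) \<Omega>"
    using g by (intro has_integral_integral_lebesgue_on) (auto simp: L2_def)
  then have h: "(?f has_integral (LINT x|lebesgue_on \<Omega>. ?f x)) (closure \<Omega>)"
    unfolding has_integral_closure_iff[OF poly] .
  then have a: "?f absolutely_integrable_on closure \<Omega>"
    by (intro nonnegative_absolutely_integrable_1) auto
  have K: "K \<in> sets lebesgue" if "K \<in> T" for K
    using lmeasurable_compact[OF compact_simplex[OF triangulation_ofD(3)[OF T that]]] by blast
  have hK: "?f integrable_on K" if "K \<in> T" for K
  proof -
    have "K \<subseteq> closure \<Omega>" using triangulation_ofD(4)[OF T] that by blast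
    from set_integrable_subset[OF a K[OF that] this] show ?thesis
      using set_lebesgue_integral_eq_integral(1) by blast
  qed
  note L = LINT_lebesgue_on_nonneg[of ?f, OF _ hK K, simplified]
  show "K \<in> T \<Longrightarrow> integrable (lebesgue_on K) ?f" using L(2) by blast
  have "(?f has_integral (\<Sum>K\<in>T. LINT x|lebesgue_on K. ?f x)) (closure \<Omega>)"
    by (rule mesh_has_integral[OF T]) (use L(1) hK in \<open>simp add: integrable_integral\<close>)
  then show "(\<Sum>K\<in>T. LINT x|lebesgue_on K. ?f x) = (LINT x|lebesgue_on \<Omega>. ?f x)"
    using h by (rule has_integral_unique)
qed

lemma volume_sq_eq: "volume_sq K g = measure lebesgue K * (LINT x|lebesgue_on K. (norm (g x))\<^sup>2)"
  by (simp add: volume_sq_def mesh_size_sq L2_norm_def Bochner_Integration.integral_nonneg)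

lemma volume_young:
  fixes g h :: "vec2 \<Rightarrow> vec2"
  assumes poly: "polygonal_domain \<Omega>" and T: "triangulation_of \<Omega> T" and g: "g \<in> L2 \<Omega>" "h \<in> L2 \<Omega>"
    and K: "K \<in> T"
  shows "young (volume_sq K g) (volume_sq K h) (volume_sq K (\<lambda>x. g x - h x))"
  unfolding volume_sq_eq
  by (intro young_mult young_integral L2_on_mesh(1)[OF poly T] K g L2_diff) simp

lemma volume_nonneg: "volume_sq K g \<ge> 0"
  by (simp add: volume_sq_def)

lemma sum_volume_le:
  fixes g :: "vec2 \<Rightarrow> vec2"
  assumes poly: "polygonal_domain \<Omega>" and T: "triangulation_of \<Omega> T" and g: "g \<in> L2 \<Omega>"
  shows "(\<Sum>K\<in>T. volume_sq K g) \<le> measure lebesgue (closure \<Omega>) * (LINT x|lebesgue_on \<Omega>. (norm (g x))\<^sup>2)"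
proof -
  have "closure \<Omega> \<in> lmeasurable"
    using poly by (auto simp: polygonal_domain_def intro: lmeasurable_compact)
  then have "volume_sq K g \<le> measure lebesgue (closure \<Omega>) * (LINT x|lebesgue_on K. (norm (g x))\<^sup>2)"
    if "K \<in> T" for K
    unfolding volume_sq_eq
    using that triangulation_ofD(4)[OF T] lmeasurable_compact[OF compact_simplex[OF triangulation_ofD(3)[OF T that]]]
    by (intro mult_right_mono measure_mono_fmeasurable) auto
  then have "(\<Sum>K\<in>T. volume_sq K g) \<le> (\<Sum>K\<in>T. measure lebesgue (closure \<Omega>) * (LINT x|lebesgue_on K. (norm (g x))\<^sup>2))"
    by (rule sum_mono)
  then show ?thesis unfolding sum_distrib_left[symmetric] L2_on_mesh(2)[OF poly T g] .
qed

lemma control_sq_eq: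
  assumes s: "2 simplex K" and u: "\<exists>c. \<forall>x\<in>interior K. u x = c" and p: "affine_inside p K"
  shows "control_sq K \<alpha> u p = (measure lebesgue K)\<^sup>2 * (norm ((1 / \<alpha>) *\<^sub>R fst (local_aff p K)))\<^sup>2"
proof -
  obtain c where c: "\<And>x. x \<in> interior K \<Longrightarrow> u x = c" using u by blast
  let ?w = "\<lambda>x. u x - (1 / \<alpha>) *\<^sub>R p x" and ?F = "(0, c) - (1 / \<alpha>) *\<^sub>R local_aff p K"
  have e: "?w x = aff_app ?F x" if "x \<in> interior K" for x
    using c[OF that] local_aff_app[OF p that]
    by (simp add: aff_app_diff aff_app_scaleR) (simp add: aff_app_def)
  then have a: "affine_inside ?w K" unfolding affine_inside_def by blast
  have "local_aff ?w K = ?F" by (rule local_aff_eqI[OF s e])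
  then have "fst (local_aff ?w K) = - ((1 / \<alpha>) *\<^sub>R fst (local_aff p K))" by simp
  then have "aff_energy (local_aff ?w K) K = measure lebesgue K * (norm ((1 / \<alpha>) *\<^sub>R fst (local_aff p K)))\<^sup>2"
    unfolding aff_energy_def by (simp only: norm_minus_cancel)
  then show ?thesis
    unfolding control_sq_def L2_norm_def LINT_grad_sq[OF s a] mesh_size_sq
    by (simp add: aff_energy_nonneg power2_eq_square)
qed

lemma shape_bounded_refinement:
  assumes L: "nvb_step\<^sup>*\<^sup>* L0 L" and K: "K \<in> L"
    and \<sigma>: "\<And>K. K \<in> L0 \<Longrightarrow> spread K \<le> \<sigma> * measure lebesgue (triangle K)"
  shows "shape_bounded \<sigma> (triangle K)"
proof -
  have "\<forall>K\<in>L. spread K \<le> \<sigma> * measure lebesgue (triangle K)"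
    using L
  proof (induction rule: rtranclp_induct)
    case (step M M')
    then obtain K0 where K0: "K0 \<in> M" "M' = (M - {K0}) \<union> children K0" by (auto simp: nvb_step_def)
    then have "spread K1 \<le> \<sigma> * measure lebesgue (triangle K1)" if "K1 \<in> children K0" for K1
      using step.IH that by (auto simp: children_eq spread_child measure_child simp del: spread.simps)
    then show ?case using K0 step.IH by blast
  qed (use \<sigma> in blast)
  then have "spread K \<le> \<sigma> * measure lebesgue (triangle K)" using K by blast
  then show ?thesis unfolding shape_bounded_def using triangle_diameter[of _ K] by fastforce
qed

theorem mainTheorem9:
  fixes \<Omega> :: "vec2 set" and f yd :: "vec2 \<Rightarrow> vec2" and \<alpha> :: real and ua ub :: vec2
    and L0 :: "ltriangle set" and ap :: approach
  assumes "polygonal_domain \<Omega>"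
    and "f \<in> L2 \<Omega>" and "yd \<in> L2 \<Omega>" and "\<alpha> > 0"
    and "initial_mesh \<Omega> L0"
  shows "\<exists>\<Lambda>>0. \<forall>L\<in>admissible_refinements \<Omega> L0. \<forall>L'\<in>admissible_refinements \<Omega> L.
           \<forall>y r p s u y' r' p' s' u'.
             discrete_solution ap \<Omega> f yd \<alpha> ua ub (mesh L) y r p s u \<longrightarrow>
             discrete_solution ap \<Omega> f yd \<alpha> ua ub (mesh L') y' r' p' s' u' \<longrightarrow>
             \<bar>estimator ap \<Omega> f yd \<alpha> (mesh L') y' p' u' (mesh L \<inter> mesh L')
               - estimator ap \<Omega> f yd \<alpha> (mesh L) y p u (mesh L \<inter> mesh L')\<bar>
             \<le> \<Lambda> * distance ap \<Omega> (mesh L') y p u y' p' u'"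
proof -
  note poly = assms(1) and f = assms(2) and yd = assms(3) and \<alpha> = assms(4) and init = assms(5)
  have \<Omega>: "open \<Omega>"
    using poly by (simp_all add: polygonal_domain_def)
  have T0: "triangulation_of \<Omega> (mesh L0)" using init by (simp add: initial_mesh_def)
  obtain CF where CF: "CF \<ge> 0" "\<And>L L' v v'. L \<in> admissible_refinements \<Omega> L0 \<Longrightarrow>
      L' \<in> admissible_refinements \<Omega> L \<Longrightarrow> v \<in> Vh \<Omega> (mesh L) \<Longrightarrow> v' \<in> Vh \<Omega> (mesh L') \<Longrightarrow>
      integral \<Omega> (\<lambda>x. (norm (v' x - v x))\<^sup>2) \<le> CF * (energy_norm (mesh L') (\<lambda>x. v' x - v x))\<^sup>2"
    using friedrichs_two_meshes[OF poly init] by blast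
  have fin0: "finite L0"
    using init triangulation_ofD(2)[OF T0] finite_imageD unfolding initial_mesh_def mesh_def by blast
  define \<sigma> where "\<sigma> = (\<Sum>K\<in>L0. spread K / measure lebesgue (triangle K))"
  have \<sigma>0: "\<sigma> \<ge> 0" unfolding \<sigma>_def by (intro sum_nonneg divide_nonneg_nonneg spread_nonneg) simp
  have \<sigma>: "spread K \<le> \<sigma> * measure lebesgue (triangle K)" if "K \<in> L0" for K
  proof -
    have "spread K / measure lebesgue (triangle K) \<le> \<sigma>"
      unfolding \<sigma>_def using fin0 that
      by (intro member_le_sum[of K L0 "\<lambda>K. spread K / measure lebesgue (triangle K)"])
        (auto intro: divide_nonneg_nonneg spread_nonneg simp del: spread.simps)
    moreover have "measure lebesgue (triangle K) > 0"
      using measure_2_simplex_pos[OF mesh_triangle(1)[OF T0 that]] .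
    ultimately show ?thesis by (simp add: field_simps)
  qed
  define CE where "CE = 12 * ((2 * \<sigma>) * sqrt (2 * \<sigma>))"
  define A0 where "A0 = measure lebesgue (closure \<Omega>)"
  have nn: "CE \<ge> 0" "A0 \<ge> 0" using \<sigma>0 by (simp_all add: CE_def A0_def)
  define c2 where "c2 = 1 / \<alpha>\<^sup>2"
  have c2: "c2 \<ge> 0" by (simp add: c2_def)
  define \<Lambda>2 where "\<Lambda>2 = A0 * (c2 * CF) + A0 + CE + A0 * CF + A0 * c2 + 1"
  have \<Lambda>2: "\<Lambda>2 > 0" unfolding \<Lambda>2_def using nn c2 CF(1) by (intro add_nonneg_pos add_nonneg_nonneg mult_nonneg_nonneg) simp_all
  have "\<bar>estimator ap \<Omega> f yd \<alpha> (mesh L') y' p' u' (mesh L \<inter> mesh L')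
      - estimator ap \<Omega> f yd \<alpha> (mesh L) y p u (mesh L \<inter> mesh L')\<bar>
      \<le> sqrt \<Lambda>2 * distance ap \<Omega> (mesh L') y p u y' p' u'"
    if L: "L \<in> admissible_refinements \<Omega> L0" and L': "L' \<in> admissible_refinements \<Omega> L"
      and S: "discrete_solution ap \<Omega> f yd \<alpha> ua ub (mesh L) y r p s u"
      and S': "discrete_solution ap \<Omega> f yd \<alpha> ua ub (mesh L') y' r' p' s' u'"
    for L L' y r p s u y' r' p' s' u'
  proof -
    define T T' M where "T = mesh L" and "T' = mesh L'" and "M = T \<inter> T'"
    have tT: "triangulation_of \<Omega> T" and tT': "triangulation_of \<Omega> T'"
      and nvb: "nvb_step\<^sup>*\<^sup>* L0 L" "nvb_step\<^sup>*\<^sup>* L L'"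
      using L L' by (auto simp: admissible_refinements_def T_def T'_def)
    note TD = triangulation_ofD[OF tT] and TD' = triangulation_ofD[OF tT']
    interpret fine: polygonal_mesh \<Omega> T' by standard (rule \<Omega> tT')+
    have finM: "finite M" using TD(2) by (simp add: M_def)
    have ref: "\<exists>K\<in>T. K' \<subseteq> K" if K': "K' \<in> T'" for K'
    proof -
      obtain t where t: "L' = (\<Union>K\<in>L. leaves (t K) K)" using nvb_forest[OF nvb(2)] by blast
      obtain J' where J': "J' \<in> L'" "K' = triangle J'" using K' unfolding T'_def mesh_def by blast
      then obtain J where "J \<in> L" "J' \<in> leaves (t J) J" using t by blast
      then show ?thesis
        using leaves_subset_triangle[of J' "t J" J] J'(2) unfolding T_def mesh_def by blast
    qed
    have shape: "shape_bounded \<sigma> K" if K: "K \<in> T'" for K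
    proof -
      obtain J where "J \<in> L'" "K = triangle J" using K unfolding T'_def mesh_def by blast
      then show ?thesis using shape_bounded_refinement[OF rtranclp_trans[OF nvb] _ \<sigma>] by simp
    qed
    have V: "y \<in> Vh \<Omega> T" "p \<in> Vh \<Omega> T" "y' \<in> Vh \<Omega> T'" "p' \<in> Vh \<Omega> T'"
      and U: "u \<in> Uh ap \<Omega> ua ub T" "u' \<in> Uh ap \<Omega> ua ub T'"
      using S S' by (simp_all add: discrete_solution_def T_def T'_def)
    have VL: "v \<in> L2 \<Omega>" if "v \<in> Vh \<Omega> N" for v N using that by (simp add: Vh_def)
    have uL: "u \<in> L2 \<Omega>" "u' \<in> L2 \<Omega>" using U by (cases ap; simp add: Uad_def)+
    let ?ey = "\<lambda>x. y' x - y x" and ?ep = "\<lambda>x. p' x - p x" and ?eu = "\<lambda>x. u' x - u x"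
    have diff: "affine_inside (\<lambda>x. v' x - v x) K" if v: "v \<in> Vh \<Omega> T" "v' \<in> Vh \<Omega> T'" and K: "K \<in> T'" for v v' K
    proof -
      obtain J where J: "J \<in> T" "K \<subseteq> J" using ref[OF K] by blast
      have "affine_inside v K"
        by (rule local_aff_subset(2)[OF Vh_affine_inside[OF v(1) J(1)] TD'(3)[OF K] J(2)])
      then show ?thesis by (rule local_aff_diff(2)[OF Vh_affine_inside[OF v(2) K] _ TD'(3)[OF K]])
    qed
    have energy: "(energy_norm T' (\<lambda>x. v' x - v x))\<^sup>2 = (\<Sum>K\<in>T'. aff_energy (local_aff (\<lambda>x. v' x - v x) K) K)"
      if "v \<in> Vh \<Omega> T" "v' \<in> Vh \<Omega> T'" for v v'
      by (rule energy_norm_sq[OF TD'(3) diff[OF that]])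
    have edges: "(\<Sum>K\<in>M. edge_terms \<Omega> T' (\<lambda>x. v' x - v x) K) \<le> CE * (energy_norm T' (\<lambda>x. v' x - v x))\<^sup>2"
      if "v \<in> Vh \<Omega> T" "v' \<in> Vh \<Omega> T'" for v v'
    proof -
      have "(\<Sum>K\<in>M. edge_terms \<Omega> T' (\<lambda>x. v' x - v x) K) \<le> (\<Sum>K\<in>T'. edge_terms \<Omega> T' (\<lambda>x. v' x - v x) K)"
        by (rule sum_mono2[OF TD'(2)])
          (auto simp: M_def edge_terms_def intro!: sum_nonneg mult_nonneg_nonneg mesh_size_nonneg edge_length_nonneg)
      also have "\<dots> \<le> CE * (energy_norm T' (\<lambda>x. v' x - v x))\<^sup>2"
        unfolding CE_def energy[OF that] by (rule fine.sum_edge_terms_le[OF \<sigma>0 shape])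
      finally show ?thesis .
    qed
    have fried: "(LINT x|lebesgue_on \<Omega>. (norm (v' x - v x))\<^sup>2) \<le> CF * (energy_norm T' (\<lambda>x. v' x - v x))\<^sup>2"
      if v: "v \<in> Vh \<Omega> T" "v' \<in> Vh \<Omega> T'" for v v'
    proof -
      have "integrable (lebesgue_on \<Omega>) (\<lambda>x. (norm (v' x - v x))\<^sup>2)"
        using L2_diff[OF VL[OF v(2)] VL[OF v(1)]] by (simp add: L2_def)
      moreover have "\<Omega> \<in> sets lebesgue" using \<Omega> by simp
      ultimately have "(LINT x|lebesgue_on \<Omega>. (norm (v' x - v x))\<^sup>2) = integral \<Omega> (\<lambda>x. (norm (v' x - v x))\<^sup>2)"
        by (rule lebesgue_integral_eq_integral)
      then show ?thesis using CF(2)[OF L L' v[unfolded T_def T'_def]] by (simp add: T'_def)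
    qed
    have vol: "(\<Sum>K\<in>M. volume_sq K g) \<le> A0 * (LINT x|lebesgue_on \<Omega>. (norm (g x))\<^sup>2)"
      if "g \<in> L2 \<Omega>" for g :: "vec2 \<Rightarrow> vec2"
    proof -
      have "(\<Sum>K\<in>M. volume_sq K g) \<le> (\<Sum>K\<in>T'. volume_sq K g)"
        by (rule sum_mono2[OF TD'(2)]) (auto simp: M_def volume_nonneg)
      then show ?thesis using sum_volume_le[OF poly tT' that] by (simp add: A0_def)
    qed
    define eY eP where "eY = (energy_norm T' ?ey)\<^sup>2" and "eP = (energy_norm T' ?ep)\<^sup>2"
    define W where "W = (LINT x|lebesgue_on \<Omega>. (norm (u' x - u x))\<^sup>2)"
    define Wc where "Wc = (case ap of Variational \<Rightarrow> 0 | Discretised \<Rightarrow> W)"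
    have W0: "W \<ge> 0" unfolding W_def by (simp add: Bochner_Integration.integral_nonneg)
    have nn2: "eY \<ge> 0" "eP \<ge> 0" "Wc \<ge> 0" using W0 by (auto simp: eY_def eP_def Wc_def split: approach.split)
    have dist: "distance ap \<Omega> T' y p u y' p' u' = sqrt (eY + eP + Wc)"
      using W0 by (simp add: distance_def eY_def eP_def Wc_def W_def L2_norm_def split: approach.split)
    have Wb: "W \<le> c2 * CF * eP + Wc"
    proof (cases ap)
      case Discretised
      then show ?thesis using c2 CF(1) nn2(2) by (simp add: Wc_def)
    next
      case Variational
      have "L2_inner \<Omega> (\<lambda>x. \<alpha> *\<^sub>R u x + p x) (\<lambda>x. u' x - u x) \<ge> 0"
        "L2_inner \<Omega> (\<lambda>x. \<alpha> *\<^sub>R u' x + p' x) (\<lambda>x. u x - u' x) \<ge> 0"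
        using S S' U by (simp_all add: discrete_solution_def Variational)
      from control_difference[OF \<alpha> uL VL[OF V(2)] VL[OF V(4)] this]
      have "W \<le> c2 * (LINT x|lebesgue_on \<Omega>. (norm (p' x - p x))\<^sup>2)" by (simp add: W_def c2_def)
      also have "\<dots> \<le> c2 * (CF * eP)"
        unfolding eP_def by (rule mult_left_mono[OF fried[OF V(2,4)] c2])
      finally show ?thesis using nn2(3) by simp
    qed
    define cD where "cD K = (case ap of Variational \<Rightarrow> 0
      | Discretised \<Rightarrow> A0 * c2 * aff_energy (local_aff ?ep K) K)" for K
    have control: "young (case ap of Variational \<Rightarrow> 0 | Discretised \<Rightarrow> control_sq K \<alpha> u' p')
        (case ap of Variational \<Rightarrow> 0 | Discretised \<Rightarrow> control_sq K \<alpha> u p) (cD K)" if K: "K \<in> M" for K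
    proof (cases ap)
      case Variational
      then show ?thesis by (simp add: cD_def young_def)
    next
      case Discretised
      have KT: "K \<in> T" "K \<in> T'" using K by (simp_all add: M_def)
      have cu: "\<exists>c. \<forall>x\<in>interior K. u x = c" "\<exists>c. \<forall>x\<in>interior K. u' x = c"
        using U KT by (simp_all add: Discretised P0_def)
      note ap = Vh_affine_inside[OF V(2) KT(1)] and ap' = Vh_affine_inside[OF V(4) KT(2)]
      have le: "measure lebesgue K \<le> A0"
        unfolding A0_def using poly TD(4) KT(1) lmeasurable_compact[OF compact_simplex[OF TD(3)[OF KT(1)]]]
        by (intro measure_mono_fmeasurable) (auto simp: polygonal_domain_def intro: lmeasurable_compact)
      have "(measure lebesgue K)\<^sup>2 * (norm ((1 / \<alpha>) *\<^sub>R fst (local_aff p' K) - (1 / \<alpha>) *\<^sub>R fst (local_aff p K)))\<^sup>2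
          = measure lebesgue K * (c2 * aff_energy (local_aff ?ep K) K)"
        unfolding local_aff_diff(1)[OF ap' ap TD(3)[OF KT(1)]] scaleR_diff_right[symmetric] fst_diff[symmetric]
        by (simp add: aff_energy_def c2_def power_mult_distrib power_divide power2_eq_square)
      also have "\<dots> \<le> A0 * (c2 * aff_energy (local_aff ?ep K) K)"
        by (rule mult_right_mono[OF le]) (simp add: c2 aff_energy_nonneg)
      finally show ?thesis
        unfolding Discretised cD_def approach.case control_sq_eq[OF TD(3)[OF KT(1)] cu(1) ap]
          control_sq_eq[OF TD(3)[OF KT(1)] cu(2) ap']
        by (intro young_mono[OF young_mult[OF young_norm_sq]]) (simp_all add: mult.assoc)
    qed
    define E E' where
      "E K = volume_sq K (\<lambda>x. f x + u x) + edges_sq \<Omega> T K y + volume_sq K (\<lambda>x. y x - yd x)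
         + edges_sq \<Omega> T K p + (case ap of Variational \<Rightarrow> 0 | Discretised \<Rightarrow> control_sq K \<alpha> u p)"
      and "E' K = volume_sq K (\<lambda>x. f x + u' x) + edges_sq \<Omega> T' K y' + volume_sq K (\<lambda>x. y' x - yd x)
         + edges_sq \<Omega> T' K p' + (case ap of Variational \<Rightarrow> 0 | Discretised \<Rightarrow> control_sq K \<alpha> u' p')" for K
    define D where "D K = volume_sq K ?eu + edge_terms \<Omega> T' ?ey K + volume_sq K ?ey
        + edge_terms \<Omega> T' ?ep K + cD K" for K
    have "young (E' K) (E K) (D K)" if K: "K \<in> M" for K
    proof -
      have KT: "K \<in> T" "K \<in> T'" using K by (simp_all add: M_def)
      have 1: "young (volume_sq K (\<lambda>x. f x + u' x)) (volume_sq K (\<lambda>x. f x + u x)) (volume_sq K ?eu)"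
        using volume_young[OF poly tT L2_add[OF f uL(2)] L2_add[OF f uL(1)] KT(1)] by simp
      have 2: "young (volume_sq K (\<lambda>x. y' x - yd x)) (volume_sq K (\<lambda>x. y x - yd x)) (volume_sq K ?ey)"
        using volume_young[OF poly tT L2_diff[OF VL[OF V(3)] yd] L2_diff[OF VL[OF V(1)] yd] KT(1)] by simp
      have 3: "young (edges_sq \<Omega> T' K v') (edges_sq \<Omega> T K v) (edge_terms \<Omega> T' (\<lambda>x. v' x - v x) K)"
        if "v \<in> Vh \<Omega> T" "v' \<in> Vh \<Omega> T'" for v v'
        by (rule edges_young[OF \<Omega> tT tT' ref Vh_affine_inside[OF that(1)] Vh_affine_inside[OF that(2)] KT])
      show ?thesis unfolding E_def E'_def D_def
        by (intro young_add 1 2 3 V control[OF K])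
    qed
    then have Y: "young (sum E' M) (sum E M) (sum D M)" by (rule young_sum)
    have cDs: "sum cD M \<le> A0 * c2 * eP"
    proof (cases ap)
      case Variational
      then show ?thesis using nn c2 nn2 by (simp add: cD_def)
    next
      case Discretised
      have "sum cD M \<le> (\<Sum>K\<in>T'. A0 * c2 * aff_energy (local_aff ?ep K) K)"
        unfolding cD_def Discretised approach.case
        by (rule sum_mono2[OF TD'(2)]) (auto simp: M_def nn c2 aff_energy_nonneg)
      then show ?thesis unfolding eP_def energy[OF V(2,4)] by (simp add: sum_distrib_left)
    qed
    have "sum D M = (\<Sum>K\<in>M. volume_sq K ?eu) + (\<Sum>K\<in>M. edge_terms \<Omega> T' ?ey K)
        + (\<Sum>K\<in>M. volume_sq K ?ey) + (\<Sum>K\<in>M. edge_terms \<Omega> T' ?ep K) + sum cD M"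
      by (simp add: D_def sum.distrib)
    also have "\<dots> \<le> A0 * W + CE * eY + A0 * (CF * eY) + CE * eP + A0 * c2 * eP"
    proof (intro add_mono cDs)
      show "(\<Sum>K\<in>M. volume_sq K ?eu) \<le> A0 * W" unfolding W_def by (rule vol[OF L2_diff[OF uL(2,1)]])
      show "(\<Sum>K\<in>M. edge_terms \<Omega> T' ?ey K) \<le> CE * eY" unfolding eY_def by (rule edges[OF V(1,3)])
      show "(\<Sum>K\<in>M. edge_terms \<Omega> T' ?ep K) \<le> CE * eP" unfolding eP_def by (rule edges[OF V(2,4)])
      show "(\<Sum>K\<in>M. volume_sq K ?ey) \<le> A0 * (CF * eY)"
        using vol[OF L2_diff[OF VL[OF V(3)] VL[OF V(1)]]] mult_left_mono[OF fried[OF V(1,3)] nn(2)]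
        unfolding eY_def by linarith
    qed
    also have "\<dots> \<le> \<Lambda>2 * (eY + eP + Wc)"
    proof -
      have "A0 * W \<le> A0 * (c2 * CF * eP + Wc)" by (rule mult_left_mono[OF Wb nn(2)])
      moreover have "0 \<le> A0 * (c2 * CF) * eY" "0 \<le> A0 * (c2 * CF) * Wc" "0 \<le> A0 * eY" "0 \<le> A0 * eP"
        "0 \<le> CE * Wc" "0 \<le> A0 * CF * eP" "0 \<le> A0 * CF * Wc" "0 \<le> A0 * c2 * eY" "0 \<le> A0 * c2 * Wc"
        using nn c2 CF(1) nn2 by simp_all
      ultimately show ?thesis using nn2 by (simp add: \<Lambda>2_def algebra_simps)
    qed
    finally have DL: "sum D M \<le> \<Lambda>2 * (eY + eP + Wc)" .
    have En: "E K \<ge> 0" "E' K \<ge> 0" for K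
      unfolding E_def E'_def edges_sq_def control_sq_def
      by (auto split: approach.split intro!: add_nonneg_nonneg volume_nonneg sum_nonneg mult_nonneg_nonneg mesh_size_nonneg)
    have "\<bar>sqrt (sum E' M) - sqrt (sum E M)\<bar> \<le> sqrt (\<Lambda>2 * (eY + eP + Wc))"
      by (rule young_sqrt[OF young_mono[OF Y DL]]) (use En \<Lambda>2 nn2 in \<open>auto intro!: sum_nonneg\<close>)
    then show ?thesis
      unfolding estimator_def T_def[symmetric] T'_def[symmetric] M_def[symmetric] dist
        E_def E'_def by (simp only: real_sqrt_mult)
  qed
  moreover have "sqrt \<Lambda>2 > 0" using \<Lambda>2 by simp
  ultimately show ?thesis by blast
qed

end
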